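(* Let $\alpha>0$, let $\Delta$ be a Rüssmann approximation function, $\Lambda(t)=t\Delta(t)$, and let $\Omega\subset\mathbb{R}^n$ be a compact set such that every $\omega\in\Omega$ satisfies $$|\langle k,\omega\rangle|\ \ge\ \frac{\alpha}{\Delta(|k|)}\qquad\text{for all } 0\ne k\in\mathbb{Z}^n .$$ Let $s>0$, $h>0$, and let $N$ be the family of constant vector fields $N=\omega$ on $\mathbb{T}^n$ depending on the parameter $\omega$. Suppose $X=N+P$ is real analytic on $D_s\times\Omega_h$ with $$|P|_{s,h}=\varepsilon<\frac{h}{16}\le\frac{\alpha}{32\,\Lambda(\tau)},$$ where $\tau\ge 1$ is so large that $$r:=8\int_\tau^\infty\frac{\log\Lambda(t)}{t^2}\,dt<\frac{s}{2}.$$ Then there exists a real map $\varphi:\Omega\to\Omega_h$, and for each $\omega\in\Omega$ a real analytic diffeomorphism $\Phi_\omega$ of the $n$-torus $\mathbb{T}^n$, such that $$\Phi_\omega^*\bigl(\varphi(\omega)+P\bigr)=\omega ,$$ where $P$ is evaluated at the parameter value $\varphi(\omega)$, i.e. $\Phi_\omega$ pulls back the vector field $\theta\mapsto\varphi(\omega)+P(\theta,\varphi(\omega))$ to the constant vector field $\omega$. Moreover, $$|\varphi-\mathrm{id}|_\Omega\le\varepsilon\qquad\text{and}\qquad |\Phi-\mathrm{id}|_{s-2r,\Omega}\le\Lambda(\tau)\,\alpha^{-1}\varepsilon .$$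
   Context: $\mathbb{T}^n=\mathbb{R}^n/2\pi\mathbb{Z}^n$. $\langle k,\omega\rangle=\sum_j k_j\omega_j$. $|\cdot|$ denotes the max-norm for complex vectors and the sum-norm $|k|=|k_1|+\dots+|k_n|$ for integer vectors $k\in\mathbb{Z}^n$. A Rüssmann approximation function is a continuous, increasing, unbounded function $\Delta:[1,\infty)\to[1,\infty)$ with $\Delta(1)=1$ and $\int_1^\infty \frac{\log\Delta(t)}{t^2}\,dt<\infty$. Complex domains: $D_s=\{\theta\in\mathbb{C}^n/2\pi\mathbb{Z}^n:|\operatorname{Im}\theta|<s\}$, and $\Omega_h=\{z\in\mathbb{C}^n:|z-\Omega|<h\}$, where $|z-\Omega|$ is the distance of $z$ to $\Omega$ in the max-norm. "Real analytic" means analytic and real-valued for real arguments. A perturbation $P=P(\theta,\omega)$ has Fourier expansion $P=\sum_{k\in\mathbb{Z}^n}p_k(\omega)e^{i\langle k,\theta\rangle}$ with $p_k(\omega)\in\mathbb{C}^n$, and its weighted norm is $$|P|_{s,h}=\sup_{\omega\in\Omega_h}\sum_{k\in\mathbb{Z}^n}|p_k(\omega)|e^{|k|s}.$$ For maps depending on parameters $\omega$ in a set $\Pi$, $|\cdot|_{s,\Pi}$ is defined in the same way with the supremum over $\omega\in\Pi$; $|\varphi-\mathrm{id}|_\Omega=\sup_{\omega\in\Omega}|\varphi(\omega)-\omega|$. In $|\Phi-\mathrm{id}|_{s-2r,\Omega}$, $\Phi$ denotes the family $(\Phi_\omega)_{\omega\in\Omega}$ and the norm is that of the function $(\theta,\omega)\mapsto\Phi_\omega(\theta)-\theta$.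 The pull-back of a vector field $X$ by a diffeomorphism $\Phi$ is $\Phi^*X=(D\Phi)^{-1}\,X\circ\Phi$. Vectors in $\mathbb{R}^n$ or $\mathbb{C}^n$ are identified with constant vector fields. *)

theory Defs
  imports "HOL-Analysis.Analysis"
begin

text \<open>The dimension \<open>n\<close> is \<open>CARD('n)\<close>. Functions on the real torus, and on its complex
  neighbourhoods, are represented by functions on the universal cover that are invariant under
  the lattice of integer multiples of \<open>2\<pi>\<close>.\<close>

definition cvec :: "real^'n \<Rightarrow> complex^'n" where
  "cvec x = (\<chi> i. complex_of_real (x $ i))"

definition Re_vec :: "complex^'n \<Rightarrow> real^'n" where
  "Re_vec z = (\<chi> i. Re (z $ i))"

definition Im_vec :: "complex^'n \<Rightarrow> real^'n" where
  "Im_vec z = (\<chi> i. Im (z $ i))"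

definition lattice_vec :: "int^'n \<Rightarrow> real^'n" where
  "lattice_vec k = (\<chi> i. 2 * pi * of_int (k $ i))"

text \<open>On \<open>complex^'n\<close> this is the maximum of the moduli; the library's \<^const>\<open>infnorm\<close> would
  instead take the maximum over real and imaginary parts.\<close>

definition max_norm :: "'a::real_normed_vector^'n \<Rightarrow> real" where
  "max_norm x = Max (range (\<lambda>i. norm (x $ i)))"

definition sum_norm :: "int^'n \<Rightarrow> real" where
  "sum_norm k = of_int (\<Sum>i\<in>UNIV. \<bar>k $ i\<bar>)"

definition pairing :: "int^'n \<Rightarrow> real^'n \<Rightarrow> real" where
  "pairing k \<omega> = (\<Sum>i\<in>UNIV. of_int (k $ i) * \<omega> $ i)"

definition ruessmann :: "(real \<Rightarrow> real) \<Rightarrow> bool" where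
  "ruessmann \<Delta> \<longleftrightarrow>
     continuous_on {1..} \<Delta> \<and> mono_on {1..} \<Delta> \<and> \<not> bdd_above (\<Delta> ` {1..}) \<and>
     \<Delta> ` {1..} \<subseteq> {1..} \<and> \<Delta> 1 = 1 \<and>
     (\<lambda>t. ln (\<Delta> t) / t\<^sup>2) integrable_on {1..}"

definition Lam :: "(real \<Rightarrow> real) \<Rightarrow> real \<Rightarrow> real" where
  "Lam \<Delta> t = t * \<Delta> t"

definition strip :: "real \<Rightarrow> (complex^'n) set" where
  "strip s = {\<theta>. max_norm (Im_vec \<theta>) < s}"

text \<open>The distance is taken in \<^typ>\<open>ereal\<close>, so that the neighbourhood of the empty set is empty.\<close>

definition cnbhd :: "(real^'n) set \<Rightarrow> real \<Rightarrow> (complex^'n) set" where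
  "cnbhd \<Omega> h = {z. (INF \<omega>\<in>\<Omega>. ereal (max_norm (z - cvec \<omega>))) < ereal h}"

text \<open>Analyticity in several complex variables, in the style of the library's
  \<^const>\<open>holomorphic_on\<close>: at every point of the open set \<open>U\<close> there is a complex-linear
  total derivative. The matrices are the complex Jacobians.\<close>

definition holo_vec_on :: "(complex^'m \<Rightarrow> complex^'n) \<Rightarrow> (complex^'m) set \<Rightarrow> bool" where
  "holo_vec_on F U \<longleftrightarrow> open U \<and>
     (\<forall>z\<in>U. \<exists>A :: complex^'m^'n. (F has_derivative (\<lambda>u. A *v u)) (at z))"

definition holo_vec2_on ::
  "((complex^'l) \<times> (complex^'m) \<Rightarrow> complex^'n) \<Rightarrow> ((complex^'l) \<times> (complex^'m)) set \<Rightarrow> bool" where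
  "holo_vec2_on F U \<longleftrightarrow> open U \<and>
     (\<forall>z\<in>U. \<exists>(A :: complex^'l^'n) (B :: complex^'m^'n).
        (F has_derivative (\<lambda>(u, v). A *v u + B *v v)) (at z))"

definition real_analytic_family ::
  "real \<Rightarrow> (complex^'n) set \<Rightarrow> (complex^'n \<Rightarrow> complex^'n \<Rightarrow> complex^'n) \<Rightarrow> bool" where
  "real_analytic_family s W X \<longleftrightarrow>
     holo_vec2_on (\<lambda>(\<theta>, \<omega>). X \<theta> \<omega>) (strip s \<times> W) \<and>
     (\<forall>\<theta>\<in>strip s. \<forall>\<omega>\<in>W. \<forall>k. X (\<theta> + cvec (lattice_vec k)) \<omega> = X \<theta> \<omega>) \<and>
     (\<forall>\<theta> \<omega>. cvec \<theta> \<in> strip s \<and> cvec \<omega> \<in> W \<longrightarrow> X (cvec \<theta>) (cvec \<omega>) \<in> range cvec)"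

definition fourier_coeff :: "(real^'n \<Rightarrow> complex^'n) \<Rightarrow> int^'n \<Rightarrow> complex^'n" where
  "fourier_coeff f k =
     (1 / (2 * pi) ^ CARD('n)) *\<^sub>R
       integral (cbox 0 (\<chi> i. 2 * pi)) (\<lambda>\<theta>. exp (- \<i> * of_real (pairing k \<theta>)) *s f \<theta>)"

text \<open>The weighted norm only sees the values at real angles, because these determine the Fourier
  coefficients.\<close>

definition weighted_norm :: "real \<Rightarrow> 'p set \<Rightarrow> (real^'n \<Rightarrow> 'p \<Rightarrow> complex^'n) \<Rightarrow> ennreal" where
  "weighted_norm s W F =
     (SUP \<omega>\<in>W. \<Sum>\<^sub>\<infinity>k\<in>UNIV.
        ennreal (max_norm (fourier_coeff (\<lambda>\<theta>. F \<theta> \<omega>) k) * exp (sum_norm k * s)))"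

definition sup_norm :: "'p set \<Rightarrow> ('p \<Rightarrow> real^'n) \<Rightarrow> ennreal" where
  "sup_norm W f = (SUP \<omega>\<in>W. ennreal (max_norm (f \<omega>)))"

definition real_analytic :: "(real^'n \<Rightarrow> real^'n) \<Rightarrow> bool" where
  "real_analytic f \<longleftrightarrow>
     (\<exists>F U. range cvec \<subseteq> U \<and> holo_vec_on F U \<and> (\<forall>x. F (cvec x) = cvec (f x)))"

text \<open>Lifts of real analytic torus diffeomorphisms. The lift commutes with lattice translations,
  that is, \<open>f - id\<close> is a function on the torus, as is needed for its weighted norm.\<close>

definition real_analytic_torus_diffeo :: "(real^'n \<Rightarrow> real^'n) \<Rightarrow> bool" where
  "real_analytic_torus_diffeo f \<longleftrightarrow>
     bij f \<and> (\<forall>\<theta> k. f (\<theta> + lattice_vec k) = f \<theta> + lattice_vec k) \<and>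
     real_analytic f \<and> real_analytic (inv f)"

definition pull_back :: "(real^'n \<Rightarrow> real^'n) \<Rightarrow> (real^'n \<Rightarrow> real^'n) \<Rightarrow> real^'n \<Rightarrow> real^'n" where
  "pull_back \<Phi> X \<theta> = inv (frechet_derivative \<Phi> (at \<theta>)) (X (\<Phi> \<theta>))"

end

theory Submission
  imports Defs "HOL-Complex_Analysis.Complex_Analysis"
begin

text \<open>The frequency \<open>\<omega>\<close> is kept fixed and a pair of an embedding \<open>\<theta> + u(\<theta>)\<close> and a parameter
  \<open>\<lambda>\<close> is improved in a slowly converging iteration. In step \<open>\<nu>\<close> the linearised conjugacy equation is
  solved for the frequencies \<open>0 < |k| \<le> T\<^sub>\<nu>\<close> only, the mean value of the defect being absorbed into
  \<open>\<lambda>\<close>. With \<open>\<Lambda>(T\<^sub>\<nu>) = 2\<^sup>\<nu> \<Lambda>(\<tau>)\<close> and a loss of width \<open>3 / T\<^sub>\<nu>\<close> the defect shrinks by the factor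
  \<open>1 / 4\<close>, which beats the growth of the small divisors, and the integral condition bounds the total
  loss of width by \<open>r\<close>. The correction is a trigonometric polynomial, the estimates take place in
  weighted algebras of exponential series, and the derivative of \<open>u\<close> stays below \<open>1 / 15\<close>, so neither
  inverse Jacobians nor an analytic dependence on the parameter have to be carried along: of the
  dependence of \<open>P\<close> on the parameter only a Lipschitz bound is used. The asserted bounds follow
  afterwards by comparing Fourier coefficients in the limiting conjugacy equation, where the
  remaining width \<open>r\<close> pays for the small divisors.\<close>

section \<open>The maximum norm\<close>

text \<open>The constants form one budget. The smallness hypothesis makes the correction of step
  \<open>\<nu>\<close> at most \<open>2^-\<nu> / (32 T \<nu>)\<close>. Its derivative, measured
  after giving up the width \<open>1 / T \<nu>\<close>, therefore adds at most
  \<open>2^-\<nu> / 30\<close>, and these increments add up to \<open>1 / 15\<close>. The four parts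
  of the new defect are at most 1/32, 1/16, 1/12 and 1/15 of the old one, together 39/160 < 1/4.
  Treating one frequency at a time keeps the parameter a single real vector, so no frequency map has
  to be inverted and no parameter domain shrinks. Complex parameters occur only once, where a Cauchy
  estimate gives the Lipschitz bound 1/12. The iteration alone yields only
  \<open>2 \<epsilon>\<close> for the parameter and \<open>r\<close> for the embedding. The limit,
  however, satisfies an exact equation in which every small divisor occurs once. That equation does
  not see the mean value of the embedding, which is why the mean is normalised to zero before the
  coefficients are compared.\<close>

lemma norm_nth_le_max_norm: "norm (x $ i) \<le> max_norm x"
  unfolding max_norm_def by (intro Max_ge) auto

lemma max_norm_le_iff: "max_norm x \<le> B \<longleftrightarrow> (\<forall>i. norm (x $ i) \<le> B)"
  unfolding max_norm_def by (subst Max_le_iff) auto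

lemma max_norm_leI: "(\<And>i. norm (x $ i) \<le> B) \<Longrightarrow> max_norm x \<le> B"
  by (simp add: max_norm_le_iff)

lemma max_norm_attained: obtains i where "max_norm x = norm (x $ i)"
proof -
  have "max_norm x \<in> range (\<lambda>i. norm (x $ i))"
    unfolding max_norm_def by (intro Max_in) auto
  then show ?thesis using that by auto
qed

lemma max_norm_nonneg [simp]: "0 \<le> max_norm x"
  using norm_nth_le_max_norm[of x undefined] norm_ge_zero order_trans by blast

lemma max_norm_0 [simp]: "max_norm 0 = 0"
  by (intro antisym max_norm_leI) auto

lemma max_norm_eq_0 [simp]: "max_norm x = 0 \<longleftrightarrow> x = 0"
  by (metis max_norm_0 norm_le_zero_iff norm_nth_le_max_norm vec_eq_iff zero_index)

lemma max_norm_add: "max_norm (x + y) \<le> max_norm x + max_norm y"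
  by (intro max_norm_leI)
    (metis add_mono norm_nth_le_max_norm norm_triangle_le vector_add_component)

lemma max_norm_minus [simp]: "max_norm (- x) = max_norm x"
  by (simp add: max_norm_def)

lemma max_norm_diff_commute: "max_norm (x - y) = max_norm (y - x)"
  by (metis max_norm_minus minus_diff_eq)

lemma max_norm_scaleR: "max_norm (a *\<^sub>R x) = \<bar>a\<bar> * max_norm x"
proof (rule antisym)
  show "max_norm (a *\<^sub>R x) \<le> \<bar>a\<bar> * max_norm x"
    by (intro max_norm_leI) (simp add: mult_left_mono norm_nth_le_max_norm)
  obtain i where "max_norm x = norm (x $ i)" by (rule max_norm_attained)
  then show "\<bar>a\<bar> * max_norm x \<le> max_norm (a *\<^sub>R x)"
    by (metis norm_nth_le_max_norm norm_scaleR vector_scaleR_component)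
qed

lemma max_norm_smult:
  fixes x :: "complex^'n"
  shows "max_norm (a *s x) = norm a * max_norm x"
proof (rule antisym)
  show "max_norm (a *s x) \<le> norm a * max_norm x"
    by (intro max_norm_leI) (simp add: mult_left_mono norm_nth_le_max_norm norm_mult)
  obtain i where "max_norm x = norm (x $ i)" by (rule max_norm_attained)
  then show "norm a * max_norm x \<le> max_norm (a *s x)"
    by (metis norm_nth_le_max_norm norm_mult vector_smult_component)
qed

lemma max_norm_times:
  fixes x :: "complex^'n"
  shows "max_norm (x * y) \<le> max_norm x * max_norm y"
  by (intro max_norm_leI) (simp add: norm_mult mult_mono norm_nth_le_max_norm)

lemma max_norm_vec [simp]: "max_norm (vec a) = norm a"
  by (simp add: max_norm_def)

lemma max_norm_le_norm: "max_norm x \<le> norm x"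
  by (intro max_norm_leI) (rule Finite_Cartesian_Product.norm_nth_le)

lemma norm_le_max_norm:
  fixes x :: "'a::real_normed_vector^'n"
  shows "norm x \<le> real CARD('n) * max_norm x"
proof -
  have "norm x \<le> (\<Sum>i\<in>UNIV. norm (x $ i))"
    unfolding norm_vec_def by (rule L2_set_le_sum) auto
  also have "\<dots> \<le> (\<Sum>i\<in>(UNIV::'n set). max_norm x)"
    by (intro sum_mono norm_nth_le_max_norm)
  finally show ?thesis by simp
qed

lemma continuous_on_max_norm [continuous_intros]:
  "continuous_on S f \<Longrightarrow> continuous_on S (\<lambda>x. max_norm (f x))"
proof -
  have "\<bar>max_norm x - max_norm y\<bar> \<le> 1 * norm (x - y)" for x y :: "'b^'c"
    using max_norm_add[of "x - y" y] max_norm_add[of "y - x" x] max_norm_le_norm[of "x - y"]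
      max_norm_le_norm[of "y - x"] by (auto simp: norm_minus_commute)
  then have "1-lipschitz_on UNIV (max_norm :: 'b^'c \<Rightarrow> real)"
    by (intro lipschitz_onI) (auto simp: dist_norm)
  then have "continuous_on UNIV (max_norm :: 'b^'c \<Rightarrow> real)"
    by (rule lipschitz_on_continuous_on)
  then show "continuous_on S f \<Longrightarrow> continuous_on S (\<lambda>x. max_norm (f x))"
    by (auto intro: continuous_on_compose2)
qed

lemma max_norm_cvec [simp]: "max_norm (cvec x) = max_norm x"
  by (simp add: max_norm_def cvec_def)

lemma max_norm_Re_vec: "max_norm (Re_vec z) \<le> max_norm z"
  by (intro max_norm_leI)
    (auto simp: Re_vec_def intro: order_trans[OF abs_Re_le_cmod norm_nth_le_max_norm])

lemma max_norm_Im_vec: "max_norm (Im_vec z) \<le> max_norm z"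
  by (intro max_norm_leI)
    (auto simp: Im_vec_def intro: order_trans[OF abs_Im_le_cmod norm_nth_le_max_norm])

lemma cvec_add: "cvec (x + y) = cvec x + cvec y"
  and cvec_diff: "cvec (x - y) = cvec x - cvec y"
  and cvec_minus: "cvec (- x) = - cvec x"
  and cvec_0 [simp]: "cvec 0 = 0"
  and cvec_scaleR: "cvec (a *\<^sub>R x) = a *\<^sub>R cvec x"
  by (simp_all add: cvec_def vec_eq_iff scaleR_conv_of_real[where 'a=complex])

lemma Re_vec_cvec [simp]: "Re_vec (cvec x) = x"
  and Im_vec_cvec [simp]: "Im_vec (cvec x) = 0"
  by (simp_all add: cvec_def Re_vec_def Im_vec_def vec_eq_iff)

lemma cvec_nth [simp]: "cvec x $ i = complex_of_real (x $ i)"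
  by (simp add: cvec_def)

lemma cvec_Re_vec: "z \<in> range cvec \<Longrightarrow> cvec (Re_vec z) = z"
  by auto

lemma bounded_linear_cvec: "bounded_linear (cvec :: real^'n \<Rightarrow> complex^'n)"
proof (rule bounded_linear_intro[where K = "real CARD('n)"])
  show "norm (cvec x) \<le> norm x * real CARD('n)" for x :: "real^'n"
  proof -
    have "norm (cvec x) \<le> real CARD('n) * max_norm (cvec x)" by (rule norm_le_max_norm)
    also have "\<dots> \<le> real CARD('n) * norm x"
      using max_norm_le_norm[of x] by (intro mult_left_mono) simp_all
    finally show ?thesis by (simp add: mult.commute)
  qed
qed (simp_all add: cvec_add cvec_scaleR)

lemma bounded_linear_Re_vec: "bounded_linear (Re_vec :: complex^'n \<Rightarrow> real^'n)"
proof (rule bounded_linear_intro[where K = "real CARD('n)"])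
  show "norm (Re_vec z) \<le> norm z * real CARD('n)" for z :: "complex^'n"
  proof -
    have "norm (Re_vec z) \<le> real CARD('n) * max_norm (Re_vec z)" by (rule norm_le_max_norm)
    also have "\<dots> \<le> real CARD('n) * norm z"
      using max_norm_Re_vec[of z] max_norm_le_norm[of z] by (intro mult_left_mono) linarith+
    finally show ?thesis by (simp add: mult.commute)
  qed
qed (simp_all add: Re_vec_def vec_eq_iff)

lemma continuous_on_cvec [continuous_intros]:
  "continuous_on S f \<Longrightarrow> continuous_on S (\<lambda>x. cvec (f x))"
  by (rule bounded_linear.continuous_on[OF bounded_linear_cvec])

lemma bounded_linear_smult_left: "bounded_linear (\<lambda>a. a *s (x :: complex^'n))"
proof (rule bounded_linear_intro[where K = "real CARD('n) * max_norm x"])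
  show "norm (a *s x) \<le> norm a * (real CARD('n) * max_norm x)" for a
    using norm_le_max_norm[of "a *s x"] by (simp add: max_norm_smult mult_ac)
qed (simp_all add: vec_eq_iff algebra_simps)

lemma bounded_linear_max_normI:
  fixes T :: "complex^'n \<Rightarrow> complex^'m"
  assumes "\<And>x y. T (x + y) = T x + T y" "\<And>a x. T (a *s x) = a *s T x"
    "\<And>x. max_norm (T x) \<le> B * max_norm x" "B \<ge> 0"
  shows "bounded_linear T"
proof (rule bounded_linear_intro[where K = "real CARD('m) * B"])
  have scaleR: "r *\<^sub>R x = of_real r *s x" for r and x :: "complex^'k"
    by (simp add: vec_eq_iff scaleR_conv_of_real[where 'a=complex])
  show "T (r *\<^sub>R x) = r *\<^sub>R T x" for r x
    by (simp add: scaleR assms(2))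
  show "norm (T x) \<le> norm x * (real CARD('m) * B)" for x
  proof -
    have "norm (T x) \<le> real CARD('m) * max_norm (T x)" by (rule norm_le_max_norm)
    also have "\<dots> \<le> real CARD('m) * (B * norm x)"
      using assms(3)[of x] mult_left_mono[OF max_norm_le_norm[of x] assms(4)]
      by (intro mult_left_mono) linarith+
    finally show ?thesis by (simp add: mult_ac)
  qed
qed (fact assms(1))

lemma bounded_linear_smult_right: "bounded_linear (\<lambda>x. a *s (x :: complex^'n))"
  by (rule bounded_linear_max_normI[where B = "norm a"])
    (auto simp: vec_eq_iff algebra_simps max_norm_smult)

lemma has_sum_sum:
  fixes f :: "'k \<Rightarrow> 'j \<Rightarrow> 'a::{topological_comm_monoid_add}"
  assumes "\<And>k. k \<in> K \<Longrightarrow> (f k has_sum S k) A"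
  shows "((\<lambda>j. \<Sum>k\<in>K. f k j) has_sum (\<Sum>k\<in>K. S k)) A"
  using assms by (induction K rule: infinite_finite_induct) (auto intro!: has_sum_add)

text \<open>Equivalence of norms serves only to get summability. The bound on the sum itself is
  proved coordinatewise, so that no factor \<open>CARD('n)\<close> enters the estimates of the
  iteration.\<close>

lemma max_norm_summable:
  fixes f :: "'j \<Rightarrow> complex^'n"
  assumes "\<And>J. finite J \<Longrightarrow> (\<Sum>j\<in>J. max_norm (f j)) \<le> B"
  shows "(\<lambda>j. norm (f j)) summable_on UNIV" "f summable_on UNIV" "(\<lambda>j. max_norm (f j)) summable_on UNIV"
    "max_norm (infsum f UNIV) \<le> (\<Sum>\<^sub>\<infinity>j. max_norm (f j))" "(\<Sum>\<^sub>\<infinity>j. max_norm (f j)) \<le> B"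
proof -
  show *: "(\<lambda>j. norm (f j)) summable_on UNIV"
  proof (rule nonneg_bdd_above_summable_on)
    show "bdd_above (sum (\<lambda>x. norm (f x)) ` {F. F \<subseteq> UNIV \<and> finite F})"
    proof (rule bdd_aboveI2)
      fix F :: "'j set" assume "F \<in> {F. F \<subseteq> UNIV \<and> finite F}"
      then have "(\<Sum>x\<in>F. norm (f x)) \<le> (\<Sum>x\<in>F. real CARD('n) * max_norm (f x))"
        and "finite F"
        by (auto intro: sum_mono norm_le_max_norm)
      moreover have "(\<Sum>x\<in>F. real CARD('n) * max_norm (f x)) \<le> real CARD('n) * B"
        unfolding sum_distrib_left[symmetric] using assms \<open>finite F\<close> by (intro mult_left_mono) auto
      ultimately show "(\<Sum>x\<in>F. norm (f x)) \<le> real CARD('n) * B" by simp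
    qed
  qed simp
  then show s: "f summable_on UNIV" by (rule abs_summable_summable)
  show s1: "(\<lambda>j. max_norm (f j)) summable_on UNIV"
    using assms by (intro nonneg_bdd_above_summable_on bdd_aboveI2[where M = B]) auto
  show "(\<Sum>\<^sub>\<infinity>j. max_norm (f j)) \<le> B"
    using s1 assms by (intro infsum_le_finite_sums) auto
  show "max_norm (infsum f UNIV) \<le> (\<Sum>\<^sub>\<infinity>j. max_norm (f j))"
  proof (rule max_norm_leI)
    fix i
    have abs: "(\<lambda>j. norm (f j $ i)) summable_on UNIV"
      by (rule Infinite_Sum.abs_summable_on_comparison_test[OF *]) (simp add: Finite_Cartesian_Product.norm_nth_le)
    have "infsum f UNIV $ i = (\<Sum>\<^sub>\<infinity>j. f j $ i)"
      using has_sum_bounded_linear[OF bounded_linear_vec_nth has_sum_infsum[OF s]]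
      by (metis infsumI)
    also have "norm \<dots> \<le> (\<Sum>\<^sub>\<infinity>j. norm (f j $ i))" by (rule norm_infsum_bound[OF abs])
    also have "\<dots> \<le> (\<Sum>\<^sub>\<infinity>j. max_norm (f j))"
      by (intro infsum_mono abs s1 norm_nth_le_max_norm)
    finally show "norm (infsum f UNIV $ i) \<le> (\<Sum>\<^sub>\<infinity>j. max_norm (f j))" .
  qed
qed

section \<open>Exponential series\<close>

lemma sum_norm_nonneg [simp]: "0 \<le> sum_norm k"
  by (auto simp: sum_norm_def intro: sum_nonneg)

lemma sum_norm_eq_0: "sum_norm k = 0 \<longleftrightarrow> k = 0"
  by (simp add: sum_norm_def of_int_sum[symmetric] sum_nonneg_eq_0_iff vec_eq_iff del: of_int_sum)

lemma sum_norm_0 [simp]: "sum_norm 0 = 0"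
  by (simp add: sum_norm_eq_0)

lemma sum_norm_ge_1: "k \<noteq> 0 \<Longrightarrow> 1 \<le> sum_norm k"
  using sum_norm_nonneg[of k] sum_norm_eq_0[of k] unfolding sum_norm_def
  by (smt (verit) of_int_0_less_iff of_int_1_le_iff int_one_le_iff_zero_less of_int_le_0_iff)

lemma sum_norm_add: "sum_norm (k + l) \<le> sum_norm k + sum_norm l"
proof -
  have "(\<Sum>i\<in>UNIV. \<bar>(k + l) $ i\<bar>) \<le> (\<Sum>i\<in>UNIV. \<bar>k $ i\<bar> + \<bar>l $ i\<bar>)"
    by (intro sum_mono) (simp add: abs_triangle_ineq)
  then show ?thesis unfolding sum_norm_def
    by (metis of_int_add of_int_le_iff sum.distrib)
qed

lemma sum_norm_minus [simp]: "sum_norm (- k) = sum_norm k"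
  by (simp add: sum_norm_def)

lemma sum_norm_alt: "sum_norm k = (\<Sum>i\<in>UNIV. \<bar>of_int (k $ i)\<bar>)"
  by (simp add: sum_norm_def)

section \<open>Exponentials at complex angles and weighted coefficient bounds\<close>

definition cpair :: "int^'n \<Rightarrow> complex^'n \<Rightarrow> complex" where
  "cpair k z = (\<Sum>i\<in>UNIV. of_int (k $ i) * z $ i)"

lemma cpair_add: "cpair k (x + y) = cpair k x + cpair k y"
  and cpair_diff: "cpair k (x - y) = cpair k x - cpair k y"
  and cpair_smult: "cpair k (a *s x) = a * cpair k x"
  and cpair_add_left: "cpair (k + l) x = cpair k x + cpair l x"
  and cpair_0 [simp]: "cpair 0 x = 0" "cpair k 0 = 0"
  by (simp_all add: cpair_def algebra_simps sum.distrib sum_subtractf sum_negf sum_distrib_left)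

lemma cpair_cvec: "cpair k (cvec x) = of_real (pairing k x)"
  by (simp add: cpair_def pairing_def)

lemma norm_cpair_le: "norm (cpair k z) \<le> sum_norm k * max_norm z"
  unfolding cpair_def sum_norm_alt sum_distrib_right
  by (intro order_trans[OF norm_sum] sum_mono) (simp add: norm_mult mult_left_mono norm_nth_le_max_norm)

lemma Im_cpair: "Im (cpair k z) = pairing k (Im_vec z)"
  by (simp add: cpair_def pairing_def Im_vec_def)

lemma abs_Im_cpair_le: "\<bar>Im (cpair k z)\<bar> \<le> sum_norm k * max_norm (Im_vec z)"
  using norm_cpair_le[of k "cvec (Im_vec z)"] by (simp add: Im_cpair cpair_cvec)

lemma norm_exp_cpair_le: "norm (exp (\<i> * cpair k z)) \<le> exp (max_norm (Im_vec z) * sum_norm k)"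
  using abs_Im_cpair_le[of k z] by (simp add: mult.commute)

definition wser :: "(int^'n \<Rightarrow> complex^'n) \<Rightarrow> complex^'n \<Rightarrow> complex^'n" where
  "wser c z = (\<Sum>\<^sub>\<infinity>k. exp (\<i> * cpair k z) *s c k)"

text \<open>A bound on all finite partial sums instead of on an infinite sum: it carries summability
  with it, stays within the reals, and passes to coefficientwise limits.\<close>

definition wbd :: "real \<Rightarrow> (int^'n \<Rightarrow> complex^'n) \<Rightarrow> real \<Rightarrow> bool" where
  "wbd s c M \<longleftrightarrow> (\<forall>K. finite K \<longrightarrow> (\<Sum>k\<in>K. max_norm (c k) * exp (s * sum_norm k)) \<le> M)"

lemma wbdD: "wbd s c M \<Longrightarrow> finite K \<Longrightarrow> (\<Sum>k\<in>K. max_norm (c k) * exp (s * sum_norm k)) \<le> M"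
  by (simp add: wbd_def)

lemma wbd_nonneg: "wbd s c M \<Longrightarrow> 0 \<le> M"
  using wbdD[of s c M "{}"] by simp

lemma wbd_nth: "wbd s c M \<Longrightarrow> max_norm (c k) * exp (s * sum_norm k) \<le> M"
  using wbdD[of s c M "{k}"] by simp

text \<open>Termwise domination. Cauchy estimates, small divisors and the damping of high
  frequencies are all instances of it.\<close>

lemma wbd_compare:
  fixes c c' :: "int^'n \<Rightarrow> complex^'n"
  assumes c: "wbd s c M" and a: "0 \<le> a" "a * M \<le> M'"
    and le: "\<And>k. max_norm (c' k) * exp (s' * sum_norm k) \<le> a * (max_norm (c k) * exp (s * sum_norm k))"
  shows "wbd s' c' M'"
  unfolding wbd_def
proof safe
  fix K :: "(int^'n) set" assume K: "finite K"
  have "(\<Sum>k\<in>K. max_norm (c' k) * exp (s' * sum_norm k))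
      \<le> a * (\<Sum>k\<in>K. max_norm (c k) * exp (s * sum_norm k))"
    unfolding sum_distrib_left by (intro sum_mono le)
  also have "\<dots> \<le> a * M" by (intro mult_left_mono wbdD[OF c K] a)
  finally show "(\<Sum>k\<in>K. max_norm (c' k) * exp (s' * sum_norm k)) \<le> M'" using a by linarith
qed

lemma wbd_mono:
  fixes c c' :: "int^'n \<Rightarrow> complex^'n"
  assumes "wbd s c M" "s' \<le> s" "M \<le> M'" "\<And>k. max_norm (c' k) \<le> max_norm (c k)"
  shows "wbd s' c' M'"
proof (rule wbd_compare[OF assms(1), of 1])
  show "max_norm (c' k) * exp (s' * sum_norm k) \<le> 1 * (max_norm (c k) * exp (s * sum_norm k))" for k
    unfolding mult_1 using assms by (intro mult_mono) (auto intro: mult_right_mono)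
qed (use assms in auto)

lemma wbd_add:
  assumes "wbd s c M" "wbd s d N" "\<And>k. e k = c k + d k"
  shows "wbd s e (M + N)"
  unfolding wbd_def
proof safe
  fix K :: "(int^'a) set" assume "finite K"
  have "(\<Sum>k\<in>K. max_norm (e k) * exp (s * sum_norm k))
      \<le> (\<Sum>k\<in>K. max_norm (c k) * exp (s * sum_norm k) + max_norm (d k) * exp (s * sum_norm k))"
    unfolding assms(3) by (intro sum_mono) (simp add: distrib_right[symmetric] max_norm_add)
  also have "\<dots> \<le> M + N"
    using assms(1,2) \<open>finite K\<close> by (simp add: sum.distrib add_mono wbd_def)
  finally show "(\<Sum>k\<in>K. max_norm (e k) * exp (s * sum_norm k)) \<le> M + N" .
qed

lemma wser_summable:
  assumes "wbd s c M" "max_norm (Im_vec z) \<le> s"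
  shows "(\<lambda>k. exp (\<i> * cpair k z) *s c k) summable_on UNIV"
    "max_norm (wser c z) \<le> M"
proof -
  have *: "max_norm (exp (\<i> * cpair k z) *s c k) \<le> max_norm (c k) * exp (s * sum_norm k)" for k
  proof -
    have "exp (max_norm (Im_vec z) * sum_norm k) \<le> exp (s * sum_norm k)"
      by (simp add: assms(2) mult_right_mono)
    then show ?thesis
      unfolding max_norm_smult using norm_exp_cpair_le[of k z]
      by (subst mult.commute) (intro mult_left_mono; force)
  qed
  have **: "(\<Sum>k\<in>K. max_norm (exp (\<i> * cpair k z) *s c k)) \<le> M" if "finite K" for K
    using sum_mono[of K "\<lambda>k. max_norm (exp (\<i> * cpair k z) *s c k)", OF *] wbdD[OF assms(1) that] by linarith
  show "(\<lambda>k. exp (\<i> * cpair k z) *s c k) summable_on UNIV"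
    by (rule max_norm_summable(2)[OF **])
  show "max_norm (wser c z) \<le> M"
    unfolding wser_def using max_norm_summable(4,5)[OF **] by linarith
qed

lemma wser_summable_real:
  assumes "wbd s c M" "0 \<le> s"
  shows "(\<lambda>k. exp (\<i> * cpair k (cvec x)) *s c k) summable_on UNIV"
    "max_norm (wser c (cvec x)) \<le> M"
  using wser_summable[OF assms(1), of "cvec x"] assms(2) by simp_all

text \<open>Functions on the real torus are majorised through their exponential expansions only, so
  that products and compositions never leave the real torus.\<close>

definition wiener :: "real \<Rightarrow> (real^'n \<Rightarrow> complex^'n) \<Rightarrow> real \<Rightarrow> bool" where
  "wiener s f M \<longleftrightarrow> (\<exists>c. wbd s c M \<and> (\<forall>\<theta>. f \<theta> = wser c (cvec \<theta>)))"

lemma wienerI: "wbd s c M \<Longrightarrow> (\<And>\<theta>. f \<theta> = wser c (cvec \<theta>)) \<Longrightarrow> wiener s f M"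
  unfolding wiener_def by blast

lemma wiener_nonneg: "wiener s f M \<Longrightarrow> 0 \<le> M"
  using wbd_nonneg wiener_def by blast

lemma wiener_max_norm_le: "wiener s f M \<Longrightarrow> 0 \<le> s \<Longrightarrow> max_norm (f \<theta>) \<le> M"
  using wser_summable_real(2) wiener_def by metis

lemma wiener_mono: "wiener s f M \<Longrightarrow> s' \<le> s \<Longrightarrow> M \<le> M' \<Longrightarrow> wiener s' f M'"
  unfolding wiener_def using wbd_mono by (metis order_refl)

lemma wiener_add:
  assumes "wiener s f M" "wiener s g N" "0 \<le> s"
  shows "wiener s (\<lambda>\<theta>. f \<theta> + g \<theta>) (M + N)"
proof -
  obtain c d where c: "wbd s c M" "\<And>\<theta>. f \<theta> = wser c (cvec \<theta>)"
    and d: "wbd s d N" "\<And>\<theta>. g \<theta> = wser d (cvec \<theta>)"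
    using assms(1,2) unfolding wiener_def by blast
  show ?thesis
  proof (rule wienerI)
    show "wbd s (\<lambda>k. c k + d k) (M + N)" by (rule wbd_add[OF c(1) d(1)]) simp
    show "f \<theta> + g \<theta> = wser (\<lambda>k. c k + d k) (cvec \<theta>)" for \<theta>
      unfolding c d wser_def vector_add_ldistrib
      by (rule infsum_add[symmetric]) (rule wser_summable_real[OF c(1) assms(3)]
          wser_summable_real[OF d(1) assms(3)])+
  qed
qed

text \<open>The coefficients of the sum are the sums of the coefficients; absolute convergence of
  the double family allows the two summations to be exchanged. Products, exponentials and
  compositions are all reduced to this lemma by expanding one of the functions involved.\<close>

lemma wiener_infsum:
  fixes g :: "'j \<Rightarrow> real^'n \<Rightarrow> complex^'n"
  assumes g: "\<And>j. wiener s (g j) (M j)" and s: "0 \<le> s"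
    and M: "\<And>J. finite J \<Longrightarrow> sum M J \<le> B"
  shows "wiener s (\<lambda>\<theta>. \<Sum>\<^sub>\<infinity>j. g j \<theta>) B"
proof -
  obtain c where c: "\<And>j. wbd s (c j) (M j)" "\<And>j \<theta>. g j \<theta> = wser (c j) (cvec \<theta>)"
    using g unfolding wiener_def by metis
  have c_le: "max_norm (c j k) \<le> M j" for j k
  proof -
    have "max_norm (c j k) * 1 \<le> max_norm (c j k) * exp (s * sum_norm k)"
      using s by (intro mult_left_mono) auto
    then show ?thesis using wbd_nth[OF c(1), of j k] by linarith
  qed
  have cs: "(\<Sum>j\<in>J. max_norm (c j k)) \<le> B" if "finite J" for J k
    using sum_mono[of J, OF c_le] M[OF that] by (meson order_trans)
  note cs = max_norm_summable[OF cs]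
  show ?thesis
  proof (rule wienerI)
    show "wbd s (\<lambda>k. \<Sum>\<^sub>\<infinity>j. c j k) B"
      unfolding wbd_def
    proof safe
      fix K :: "(int^'n) set" assume K: "finite K"
      have "(\<Sum>k\<in>K. max_norm (\<Sum>\<^sub>\<infinity>j. c j k) * exp (s * sum_norm k))
        \<le> (\<Sum>k\<in>K. (\<Sum>\<^sub>\<infinity>j. max_norm (c j k)) * exp (s * sum_norm k))"
        by (intro sum_mono mult_right_mono cs(4)) auto
      also have "\<dots> = (\<Sum>k\<in>K. (\<Sum>\<^sub>\<infinity>j. max_norm (c j k) * exp (s * sum_norm k)))"
        by (intro sum.cong refl infsum_cmult_left[symmetric] cs(3))
      also have "\<dots> = (\<Sum>\<^sub>\<infinity>j. \<Sum>k\<in>K. max_norm (c j k) * exp (s * sum_norm k))"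
        using has_sum_sum[OF has_sum_infsum[OF summable_on_cmult_left[OF cs(3)]], of K]
        by (rule infsumI[symmetric])
      also have "\<dots> \<le> B"
      proof (rule infsum_le_finite_sums)
        show "(\<lambda>j. \<Sum>k\<in>K. max_norm (c j k) * exp (s * sum_norm k)) summable_on UNIV"
          by (intro has_sum_imp_summable[OF has_sum_sum[OF has_sum_infsum]] summable_on_cmult_left cs(3))
        fix F :: "'j set" assume F: "finite F"
        have "(\<Sum>j\<in>F. \<Sum>k\<in>K. max_norm (c j k) * exp (s * sum_norm k)) \<le> sum M F"
          using c(1) K by (intro sum_mono) (auto simp: wbd_def)
        then show "(\<Sum>j\<in>F. \<Sum>k\<in>K. max_norm (c j k) * exp (s * sum_norm k)) \<le> B"
          using M[OF F] by linarith
      qed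
      finally show "(\<Sum>k\<in>K. max_norm (\<Sum>\<^sub>\<infinity>j. c j k) * exp (s * sum_norm k)) \<le> B" .
    qed
    show "(\<Sum>\<^sub>\<infinity>j. g j \<theta>) = wser (\<lambda>k. \<Sum>\<^sub>\<infinity>j. c j k) (cvec \<theta>)" for \<theta>
    proof -
      let ?f = "\<lambda>(j, k). exp (\<i> * cpair k (cvec \<theta>)) *s c j k"
      have mx: "max_norm (?f p) = max_norm (c (fst p) (snd p))" for p
        by (cases p) (simp add: max_norm_smult cpair_cvec)
      have "?f summable_on UNIV"
      proof (rule max_norm_summable(2)[where B = B])
        fix P :: "('j \<times> (int^'n)) set" assume P: "finite P"
        \<comment> \<open>A finite set of pairs is enlarged to the product of its projections, where
          the sum can be taken over \<open>k\<close> first and is bounded by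
          \<open>M j\<close>.\<close>
        have "(\<Sum>p\<in>P. max_norm (?f p)) \<le> (\<Sum>p\<in>fst ` P \<times> snd ` P. max_norm (?f p))"
          using P by (intro sum_mono2) (auto simp: image_iff Bex_def intro: prod.collapse[symmetric])
        also have "\<dots> = (\<Sum>j\<in>fst ` P. \<Sum>k\<in>snd ` P. max_norm (c j k))"
          unfolding mx by (simp add: sum.cartesian_product case_prod_unfold)
        also have "\<dots> \<le> (\<Sum>j\<in>fst ` P. M j)"
        proof (rule sum_mono)
          fix j
          have "(\<Sum>k\<in>snd ` P. max_norm (c j k))
            \<le> (\<Sum>k\<in>snd ` P. max_norm (c j k) * exp (s * sum_norm k))"
            using s by (intro sum_mono) (metis max_norm_nonneg mult.right_neutral
                mult_left_mono one_le_exp_iff mult_nonneg_nonneg sum_norm_nonneg)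
          then show "(\<Sum>k\<in>snd ` P. max_norm (c j k)) \<le> M j"
            using wbdD[OF c(1), of "snd ` P" j] P by simp
        qed
        also have "\<dots> \<le> B" using P by (intro M) auto
        finally show "(\<Sum>p\<in>P. max_norm (?f p)) \<le> B" .
      qed
      then have sm: "?f summable_on UNIV \<times> UNIV" by simp
      have "(\<Sum>\<^sub>\<infinity>j. g j \<theta>) = (\<Sum>\<^sub>\<infinity>j. \<Sum>\<^sub>\<infinity>k. exp (\<i> * cpair k (cvec \<theta>)) *s c j k)"
        by (simp add: c(2) wser_def)
      also have "\<dots> = (\<Sum>\<^sub>\<infinity>k. \<Sum>\<^sub>\<infinity>j. exp (\<i> * cpair k (cvec \<theta>)) *s c j k)"
        by (rule infsum_swap_banach[OF sm])
      also have "\<dots> = (\<Sum>\<^sub>\<infinity>k. exp (\<i> * cpair k (cvec \<theta>)) *s (\<Sum>\<^sub>\<infinity>j. c j k))"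
        by (intro infsum_cong infsumI has_sum_bounded_linear[OF bounded_linear_smult_right]
            has_sum_infsum cs(2))
      finally show ?thesis by (simp add: wser_def)
    qed
  qed
qed

lemma wiener_linear:
  fixes T :: "complex^'n \<Rightarrow> complex^'n"
  assumes "wiener s f M" "0 \<le> s" "0 \<le> B"
    and T: "\<And>x y. T (x + y) = T x + T y" "\<And>a x. T (a *s x) = a *s T x"
      "\<And>x. max_norm (T x) \<le> B * max_norm x"
  shows "wiener s (\<lambda>\<theta>. T (f \<theta>)) (B * M)"
proof -
  obtain c where c: "wbd s c M" "\<And>\<theta>. f \<theta> = wser c (cvec \<theta>)"
    using assms(1) unfolding wiener_def by blast
  show ?thesis
  proof (rule wienerI)
    show "wbd s (\<lambda>k. T (c k)) (B * M)"
      by (rule wbd_compare[OF c(1) assms(3) order_refl])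
        (simp add: mult.assoc[symmetric] mult_right_mono T(3))
    show "T (f \<theta>) = wser (\<lambda>k. T (c k)) (cvec \<theta>)" for \<theta>
      using infsumI[OF has_sum_bounded_linear[OF bounded_linear_max_normI[OF T assms(3)]
            has_sum_infsum[OF wser_summable_real(1)[OF c(1) assms(2)]]], of \<theta>]
      by (simp add: c(2) wser_def T(2))
  qed
qed

text \<open>Multiplication by a character shifts the coefficients by \<open>k\<close>, and
  subadditivity of the sum norm bounds the change of weight by
  \<open>exp (s * sum_norm k)\<close>.\<close>

lemma wiener_exp_times:
  assumes "wiener s f M" "0 \<le> s"
  shows "wiener s (\<lambda>\<theta>. exp (\<i> * cpair k (cvec \<theta>)) *s f \<theta>) (exp (s * sum_norm k) * M)"
proof -
  obtain c where c: "wbd s c M" "\<And>\<theta>. f \<theta> = wser c (cvec \<theta>)"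
    using assms(1) unfolding wiener_def by blast
  show ?thesis
  proof (rule wienerI)
    show "wbd s (\<lambda>l. c (l - k)) (exp (s * sum_norm k) * M)"
      unfolding wbd_def
    proof safe
      fix K :: "(int^'a) set" assume K: "finite K"
      have "(\<Sum>l\<in>K. max_norm (c (l - k)) * exp (s * sum_norm l))
        \<le> (\<Sum>l\<in>K. exp (s * sum_norm k) * (max_norm (c (l - k)) * exp (s * sum_norm (l - k))))"
      proof (rule sum_mono)
        fix l
        have "s * sum_norm l \<le> s * sum_norm k + s * sum_norm (l - k)"
          using sum_norm_add[of "l - k" k] assms(2)
          by (simp add: distrib_left[symmetric] mult_left_mono)
        then have *: "exp (s * sum_norm l) \<le> exp (s * sum_norm k) * exp (s * sum_norm (l - k))"
          by (simp add: exp_add[symmetric])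
        show "max_norm (c (l - k)) * exp (s * sum_norm l)
           \<le> exp (s * sum_norm k) * (max_norm (c (l - k)) * exp (s * sum_norm (l - k)))"
          using mult_left_mono[OF *, of "max_norm (c (l - k))"] by (simp add: mult_ac)
      qed
      also have "\<dots> = exp (s * sum_norm k) *
          (\<Sum>l\<in>(\<lambda>l. l - k) ` K. max_norm (c l) * exp (s * sum_norm l))"
        by (simp add: sum_distrib_left sum.reindex inj_on_def)
      also have "\<dots> \<le> exp (s * sum_norm k) * M"
        using K by (intro mult_left_mono wbdD[OF c(1)]) auto
      finally show "(\<Sum>l\<in>K. max_norm (c (l - k)) * exp (s * sum_norm l)) \<le> exp (s * sum_norm k) * M" .
    qed
    show "exp (\<i> * cpair k (cvec \<theta>)) *s f \<theta> = wser (\<lambda>l. c (l - k)) (cvec \<theta>)" for \<theta>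
    proof -
      have "exp (\<i> * cpair k (cvec \<theta>)) *s f \<theta>
        = (\<Sum>\<^sub>\<infinity>l. exp (\<i> * cpair k (cvec \<theta>)) *s (exp (\<i> * cpair l (cvec \<theta>)) *s c l))"
        unfolding c wser_def
        by (intro infsumI[symmetric] has_sum_bounded_linear[OF bounded_linear_smult_right]
            has_sum_infsum wser_summable_real[OF c(1) assms(2)])
      also have "\<dots> = (\<Sum>\<^sub>\<infinity>l. exp (\<i> * cpair (l + k) (cvec \<theta>)) *s c ((l + k) - k))"
        by (intro infsum_cong) (simp add: cpair_add_left vector_smult_assoc exp_add[symmetric] algebra_simps)
      also have "\<dots> = (\<Sum>\<^sub>\<infinity>l. exp (\<i> * cpair l (cvec \<theta>)) *s c (l - k))"
        by (rule infsum_reindex_bij_betw[of "\<lambda>l. l + k"]) (auto intro!: bij_betwI[of _ _ _ "\<lambda>l. l - k"])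
      finally show ?thesis by (simp add: wser_def)
    qed
  qed
qed

lemma wser_single:
  "wser (\<lambda>l. if l = k then x else 0) z = exp (\<i> * cpair k z) *s x"
proof -
  have "((\<lambda>l. exp (\<i> * cpair l z) *s (if l = k then x else 0)) has_sum
      (exp (\<i> * cpair k z) *s x)) UNIV"
    by (rule has_sum_finite_neutralI[of "{k}"]) auto
  then show ?thesis unfolding wser_def by (rule infsumI)
qed

lemma wbd_single: "wbd s (\<lambda>l. if l = k then x else 0) (max_norm x * exp (s * sum_norm k))"
  unfolding wbd_def
proof safe
  fix K :: "(int^'a) set" assume K: "finite K"
  have "(\<Sum>l\<in>K. max_norm (if l = k then x else 0) * exp (s * sum_norm l))
    = (\<Sum>l\<in>K. if l = k then max_norm x * exp (s * sum_norm k) else 0)"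
    by (intro sum.cong) auto
  also have "\<dots> \<le> max_norm x * exp (s * sum_norm k)" using K by (simp add: sum.delta)
  finally show "(\<Sum>l\<in>K. max_norm (if l = k then x else 0) * exp (s * sum_norm l))
    \<le> max_norm x * exp (s * sum_norm k)" .
qed

lemma wiener_const: "wiener s (\<lambda>_. x) (max_norm x)"
  using wienerI[OF wbd_single[of s 0 x], of "\<lambda>_. x"] by (simp add: wser_single)

text \<open>Only the first factor is expanded; each of its terms is a character times a fixed linear
  image of the second factor. The product is the coordinatewise one, so scalar factors are written
  as constant vectors \<open>vec a\<close>.\<close>

lemma wiener_times:
  assumes "wiener s f M" "wiener s g N" "0 \<le> s"
  shows "wiener s (\<lambda>\<theta>. f \<theta> * g \<theta>) (M * N)"
proof -
  obtain c where c: "wbd s c M" "\<And>\<theta>. f \<theta> = wser c (cvec \<theta>)"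
    using assms(1) unfolding wiener_def by blast
  have bl: "bounded_linear (\<lambda>x. x * y)" for y :: "complex^'a"
    by (rule bounded_linear_max_normI[where B = "max_norm y"])
      (auto simp: algebra_simps vec_eq_iff max_norm_times mult.commute[of "max_norm y"])
  have "f \<theta> * g \<theta> = (\<Sum>\<^sub>\<infinity>k. exp (\<i> * cpair k (cvec \<theta>)) *s (c k * g \<theta>))" for \<theta>
  proof -
    have "f \<theta> * g \<theta> = (\<Sum>\<^sub>\<infinity>k. exp (\<i> * cpair k (cvec \<theta>)) *s c k * g \<theta>)"
      unfolding c wser_def
      by (intro infsumI[symmetric] has_sum_bounded_linear[OF bl]
            has_sum_infsum wser_summable_real[OF c(1) assms(3)])
    then show ?thesis by (simp add: vec_eq_iff times_vec_def mult.assoc vector_scalar_mult_def)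
  qed
  moreover have "wiener s (\<lambda>\<theta>. \<Sum>\<^sub>\<infinity>k. exp (\<i> * cpair k (cvec \<theta>)) *s (c k * g \<theta>)) (M * N)"
  proof (rule wiener_infsum)
    show "wiener s (\<lambda>\<theta>. exp (\<i> * cpair k (cvec \<theta>)) *s (c k * g \<theta>))
       (exp (s * sum_norm k) * (max_norm (c k) * N))" for k
      using assms
      by (intro wiener_exp_times wiener_linear)
        (auto simp: algebra_simps vec_eq_iff max_norm_times)
    fix K :: "(int^'a) set" assume K: "finite K"
    have "(\<Sum>k\<in>K. exp (s * sum_norm k) * (max_norm (c k) * N))
      = (\<Sum>k\<in>K. max_norm (c k) * exp (s * sum_norm k)) * N"
      by (subst sum_distrib_right) (simp add: mult_ac)
    also have "\<dots> \<le> M * N"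
      using wbdD[OF c(1) K] wiener_nonneg[OF assms(2)] by (rule mult_right_mono)
    finally show "(\<Sum>k\<in>K. exp (s * sum_norm k) * (max_norm (c k) * N)) \<le> M * N" .
  qed (fact assms)
  ultimately show ?thesis by simp
qed

section \<open>Powers and exponentials of majorised functions\<close>

lemma has_sum_vecI:
  fixes f :: "'j \<Rightarrow> 'a::{comm_monoid_add,topological_space}^'n"
  assumes "\<And>i. ((\<lambda>j. f j $ i) has_sum (S $ i)) A"
  shows "(f has_sum S) A"
  using assms unfolding has_sum_def by (intro vec_tendstoI) (simp add: sum_component)

lemma has_sum_diff:
  fixes f :: "'j \<Rightarrow> 'a::real_normed_vector"
  assumes "(f has_sum S) A" "(g has_sum T) A"
  shows "((\<lambda>j. f j - g j) has_sum (S - T)) A"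
proof -
  have "((\<lambda>j. - g j) has_sum - T) A" using assms(2) by (simp add: has_sum_uminus)
  from has_sum_add[OF assms(1) this] show ?thesis by simp
qed

lemma infsum_diff:
  fixes f :: "'j \<Rightarrow> 'a::real_normed_vector"
  assumes "f summable_on A" "g summable_on A"
  shows "infsum (\<lambda>j. f j - g j) A = infsum f A - infsum g A"
  by (intro infsumI has_sum_diff has_sum_infsum assms)

lemma vec_power_component: "((x :: complex^'n) ^ n) $ i = x $ i ^ n"
  by (induction n) (simp_all add: times_vec_def)

lemma max_norm_1 [simp]: "max_norm (1 :: complex^'n) = 1"
  by (simp add: max_norm_def)

lemma wiener_power:
  assumes "wiener s g m" "0 \<le> s"
  shows "wiener s (\<lambda>\<theta>. g \<theta> ^ n) (m ^ n)"
proof (induction n)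
  case 0
  then show ?case using wiener_const[of s 1] by simp
next
  case (Suc n)
  then show ?case using wiener_times[OF assms(1) _ assms(2)] by simp
qed

text \<open>The exponential series has positive coefficients, so it is majorised by its own value at
  \<open>m\<close>. The constant term is dropped before majorising, which keeps the bound small when
  \<open>m\<close> is small.\<close>

lemma wiener_expm1:
  assumes "wiener s g m" "0 \<le> s"
  shows "wiener s (\<lambda>\<theta>. (\<chi> i. exp (g \<theta> $ i)) - 1) (exp m - 1)"
proof -
  have hs: "((\<lambda>n. inverse (fact (Suc n)) * x ^ Suc n) has_sum (exp x - 1)) UNIV" for x :: complex
  proof (rule norm_summable_imp_has_sum)
    have *: "(\<lambda>n. inverse (fact n) * x ^ n) sums exp x"
      using exp_converges[of x] by (simp add: scaleR_conv_of_real)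
    show "(\<lambda>n. inverse (fact (Suc n)) * x ^ Suc n) sums (exp x - 1)"
      using * by (subst sums_Suc_iff) simp
    have "summable (\<lambda>n. norm (inverse (fact n) * x ^ n))"
      using summable_norm_exp[of x] by (simp add: scaleR_conv_of_real)
    then show "summable (\<lambda>n. norm (inverse (fact (Suc n)) * x ^ Suc n))"
      by (subst summable_Suc_iff)
  qed
  have eq: "(\<chi> i. exp (x $ i)) - 1 = (\<Sum>\<^sub>\<infinity>n. inverse (fact (Suc n)) *s x ^ Suc n)" for x :: "complex^'n"
    by (rule infsumI[symmetric], rule has_sum_vecI) (use hs in \<open>simp add: vec_power_component times_vec_def\<close>)
  show ?thesis
    unfolding eq
  proof (rule wiener_infsum[OF _ assms(2)])
    show "wiener s (\<lambda>\<theta>. inverse (fact (Suc n)) *s g \<theta> ^ Suc n) (inverse (fact (Suc n)) * m ^ Suc n)" for n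
    proof (rule wiener_linear[OF wiener_power[OF assms, of "Suc n"] assms(2)])
      show "max_norm (inverse (fact (Suc n)) *s x) \<le> inverse (fact (Suc n)) * max_norm x"
        for x :: "complex^'a"
        by (simp only: max_norm_smult norm_inverse norm_fact)
    qed (auto simp: vec_eq_iff algebra_simps)
    fix J :: "nat set" assume J: "finite J"
    have m: "0 \<le> m" using assms(1) by (rule wiener_nonneg)
    have *: "(\<lambda>n. inverse (fact n) * m ^ n) sums exp m"
      using exp_converges[of m] by simp
    then have **: "(\<lambda>n. inverse (fact (Suc n)) * m ^ Suc n) sums (exp m - 1)"
      by (subst sums_Suc_iff) simp
    show "(\<Sum>n\<in>J. inverse (fact (Suc n)) * m ^ Suc n) \<le> exp m - 1"
      using sum_le_suminf[OF sums_summable[OF **] J] m sums_unique[OF **] by simp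
  qed
qed

lemma wiener_cpair:
  fixes F :: "real^'a \<Rightarrow> complex^'a"
  assumes "wiener s F f" "0 \<le> s"
  shows "wiener s (\<lambda>\<theta>. vec (a * cpair k (F \<theta>))) (norm a * sum_norm k * f)"
proof (rule wiener_linear[OF assms])
  show "max_norm (vec (a * cpair k x)) \<le> norm a * sum_norm k * max_norm x" for x
    using mult_left_mono[OF norm_cpair_le[of k x], of "norm a"] by (simp add: norm_mult)
qed (auto simp: cpair_add cpair_smult vec_eq_iff algebra_simps)

lemma wiener_exp_cpair_m1:
  fixes F :: "real^'a \<Rightarrow> complex^'a"
  assumes "wiener s F f" "0 \<le> s"
  shows "wiener s (\<lambda>\<theta>. vec (exp (\<i> * cpair k (F \<theta>)) - 1)) (exp (sum_norm k * f) - 1)"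
proof -
  have "(\<chi> i. exp (vec (\<i> * cpair k (F \<theta>)) $ i)) - 1 =
    (vec (exp (\<i> * cpair k (F \<theta>)) - 1) :: complex^'a)" for \<theta>
    by (simp add: vec_eq_iff)
  then show ?thesis
    using wiener_expm1[OF wiener_cpair[OF assms, of \<i> k] assms(2)] by (simp del: vec_component)
qed

lemma wiener_exp_cpair:
  fixes F :: "real^'a \<Rightarrow> complex^'a"
  assumes "wiener s F f" "0 \<le> s"
  shows "wiener s (\<lambda>\<theta>. vec (exp (\<i> * cpair k (F \<theta>)))) (exp (sum_norm k * f))"
proof -
  have "vec (exp (\<i> * cpair k (F \<theta>)) - 1) + 1 = (vec (exp (\<i> * cpair k (F \<theta>))) :: complex^'a)" for \<theta>
    by (simp add: vec_eq_iff)
  then show ?thesis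
    using wiener_add[OF wiener_exp_cpair_m1[OF assms, of k] wiener_const[of s 1] assms(2)] by simp
qed

section \<open>Composition with maps close to the identity\<close>

lemma shifted_Im_le:
  fixes F :: "real^'a \<Rightarrow> complex^'a"
  assumes "wiener s F f" "0 \<le> s"
  shows "max_norm (Im_vec (cvec \<theta> + F \<theta>)) \<le> f"
proof -
  have "Im_vec (cvec \<theta> + F \<theta>) = Im_vec (F \<theta>)" by (simp add: Im_vec_def vec_eq_iff)
  then show ?thesis
    using wiener_max_norm_le[OF assms, of \<theta>] max_norm_Im_vec[of "F \<theta>"] by simp
qed

text \<open>Each exponential of the outer series splits into a character, which costs
  \<open>exp (s * sum_norm k)\<close>, and the exponential of a small function, which costs
  \<open>exp (sum_norm k * f)\<close>. Together they ask for the outer coefficients at width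
  \<open>s + f\<close>, which replaces any discussion of domains and images.\<close>

lemma wiener_compose:
  fixes F :: "real^'a \<Rightarrow> complex^'a"
  assumes F: "wiener s F f" and s: "0 \<le> s" and c: "wbd (s + f) c M"
  shows "wiener s (\<lambda>\<theta>. wser c (cvec \<theta> + F \<theta>)) M"
proof -
  have eq: "wser c (cvec \<theta> + F \<theta>) =
    (\<Sum>\<^sub>\<infinity>k. exp (\<i> * cpair k (cvec \<theta>)) *s (c k * vec (exp (\<i> * cpair k (F \<theta>)))))" for \<theta>
    unfolding wser_def
    by (intro infsum_cong) (simp add: vec_eq_iff times_vec_def cpair_add exp_add distrib_left)
  show ?thesis
    unfolding eq
  proof (rule wiener_infsum[OF _ s])
    show "wiener s (\<lambda>\<theta>. exp (\<i> * cpair k (cvec \<theta>)) *s (c k * vec (exp (\<i> * cpair k (F \<theta>)))))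
      (exp (s * sum_norm k) * (max_norm (c k) * exp (sum_norm k * f)))" for k
      by (intro wiener_exp_times wiener_times wiener_const wiener_exp_cpair F s)
    fix K :: "(int^'a) set" assume K: "finite K"
    have "(\<Sum>k\<in>K. exp (s * sum_norm k) * (max_norm (c k) * exp (sum_norm k * f)))
      = (\<Sum>k\<in>K. max_norm (c k) * exp ((s + f) * sum_norm k))"
      by (intro sum.cong) (auto simp: exp_add algebra_simps)
    then show "(\<Sum>k\<in>K. exp (s * sum_norm k) * (max_norm (c k) * exp (sum_norm k * f))) \<le> M"
      using wbdD[OF c K] by simp
  qed
qed

text \<open>The bound on the weighted coefficients is left as a hypothesis because it is obtained in
  two ways: from the derivative bound when the outer function is the embedding, and from a loss of
  width when it is the defect.\<close>

lemma wiener_compose_diff: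
  fixes F :: "real^'a \<Rightarrow> complex^'a"
  assumes F: "wiener s F f" and s: "0 \<le> s" and c: "wbd (s + f) c M"
    and B: "wbd s (\<lambda>k. (exp (sum_norm k * f) - 1) *\<^sub>R c k) B"
  shows "wiener s (\<lambda>\<theta>. wser c (cvec \<theta> + F \<theta>) - wser c (cvec \<theta>)) B"
proof -
  have f: "0 \<le> f" using F by (rule wiener_nonneg)
  have eq: "wser c (cvec \<theta> + F \<theta>) - wser c (cvec \<theta>) =
    (\<Sum>\<^sub>\<infinity>k. exp (\<i> * cpair k (cvec \<theta>)) *s (c k * vec (exp (\<i> * cpair k (F \<theta>)) - 1)))" for \<theta>
  proof -
    have "(\<lambda>k. exp (\<i> * cpair k (cvec \<theta> + F \<theta>)) *s c k) summable_on UNIV"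
      using shifted_Im_le[OF F s, of \<theta>] s
      by (intro wser_summable(1)[OF c]) linarith
    moreover have "(\<lambda>k. exp (\<i> * cpair k (cvec \<theta>)) *s c k) summable_on UNIV"
      using s f by (intro wser_summable_real(1)[OF c]) linarith
    ultimately have "wser c (cvec \<theta> + F \<theta>) - wser c (cvec \<theta>) =
      (\<Sum>\<^sub>\<infinity>k. exp (\<i> * cpair k (cvec \<theta> + F \<theta>)) *s c k - exp (\<i> * cpair k (cvec \<theta>)) *s c k)"
      unfolding wser_def by (rule infsum_diff[symmetric])
    also have "\<dots> = (\<Sum>\<^sub>\<infinity>k. exp (\<i> * cpair k (cvec \<theta>)) *s (c k * vec (exp (\<i> * cpair k (F \<theta>)) - 1)))"
      by (intro infsum_cong) (simp add: vec_eq_iff times_vec_def cpair_add exp_add algebra_simps)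
    finally show ?thesis .
  qed
  show ?thesis
    unfolding eq
  proof (rule wiener_infsum[OF _ s])
    show "wiener s (\<lambda>\<theta>. exp (\<i> * cpair k (cvec \<theta>)) *s (c k * vec (exp (\<i> * cpair k (F \<theta>)) - 1)))
      (exp (s * sum_norm k) * (max_norm (c k) * (exp (sum_norm k * f) - 1)))" for k
      by (intro wiener_exp_times wiener_times wiener_const wiener_exp_cpair_m1 F s)
    fix K :: "(int^'a) set" assume K: "finite K"
    show "(\<Sum>k\<in>K. exp (s * sum_norm k) * (max_norm (c k) * (exp (sum_norm k * f) - 1))) \<le> B"
      using wbdD[OF B K] f by (simp add: max_norm_scaleR mult_ac)
  qed
qed

text \<open>The complex derivative of \<open>wser c\<close> at \<open>z\<close> in the direction
  \<open>v\<close>, taken term by term. Being again a \<open>wser\<close>, it inherits the bounds,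
  the reality criterion and the comparison of coefficients.\<close>

definition dser :: "(int^'n \<Rightarrow> complex^'n) \<Rightarrow> complex^'n \<Rightarrow> complex^'n \<Rightarrow> complex^'n" where
  "dser c z v = wser (\<lambda>k. (\<i> * cpair k v) *s c k) z"

text \<open>The direction may vary with the angle here. This is the form of the term
  \<open>(D u \<circ> (id + F)) V\<close> in the new defect.\<close>

lemma wiener_compose_dser:
  fixes F :: "real^'a \<Rightarrow> complex^'a"
  assumes F: "wiener s F f" and V: "wiener s V N" and s: "0 \<le> s"
    and c: "wbd (s + f) (\<lambda>k. sum_norm k *\<^sub>R c k) D"
  shows "wiener s (\<lambda>\<theta>. dser c (cvec \<theta> + F \<theta>) (V \<theta>)) (D * N)"
proof -
  have eq: "dser c (cvec \<theta> + F \<theta>) (V \<theta>) =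
    (\<Sum>\<^sub>\<infinity>k. exp (\<i> * cpair k (cvec \<theta>)) *s
      (c k * (vec (exp (\<i> * cpair k (F \<theta>))) * vec (\<i> * cpair k (V \<theta>)))))" for \<theta>
    unfolding wser_def dser_def
    by (intro infsum_cong) (simp add: vec_eq_iff times_vec_def cpair_add exp_add distrib_left)
  show ?thesis
    unfolding eq
  proof (rule wiener_infsum[OF _ s])
    show "wiener s (\<lambda>\<theta>. exp (\<i> * cpair k (cvec \<theta>)) *s
        (c k * (vec (exp (\<i> * cpair k (F \<theta>))) * vec (\<i> * cpair k (V \<theta>)))))
      (exp (s * sum_norm k) * (max_norm (c k) * (exp (sum_norm k * f) * (norm \<i> * sum_norm k * N))))" for k
      by (intro wiener_exp_times wiener_times wiener_const wiener_exp_cpair wiener_cpair F V s)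
    fix K :: "(int^'a) set" assume K: "finite K"
    have "(\<Sum>k\<in>K. exp (s * sum_norm k) * (max_norm (c k) * (exp (sum_norm k * f) * (norm \<i> * sum_norm k * N))))
      = (\<Sum>k\<in>K. max_norm (sum_norm k *\<^sub>R c k) * exp ((s + f) * sum_norm k)) * N"
      unfolding sum_distrib_right
      by (intro sum.cong) (auto simp: exp_add algebra_simps max_norm_scaleR)
    then show "(\<Sum>k\<in>K. exp (s * sum_norm k) * (max_norm (c k) * (exp (sum_norm k * f) * (norm \<i> * sum_norm k * N)))) \<le> D * N"
      using mult_right_mono[OF wbdD[OF c K] wiener_nonneg[OF V]] by simp
  qed
qed

lemma wbd_cpair_coeff:
  fixes c :: "int^'a \<Rightarrow> complex^'a"
  assumes "wbd s (\<lambda>k. sum_norm k *\<^sub>R c k) D"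
  shows "wbd s (\<lambda>k. (a * cpair k v) *s c k) (norm a * max_norm v * D)"
proof (rule wbd_compare[OF assms _ order_refl])
  fix k :: "int^'a"
  have "norm a * (norm (cpair k v) * (max_norm (c k) * exp (s * sum_norm k)))
    \<le> norm a * ((sum_norm k * max_norm v) * (max_norm (c k) * exp (s * sum_norm k)))"
    by (intro mult_left_mono mult_right_mono norm_cpair_le) auto
  then show "max_norm ((a * cpair k v) *s c k) * exp (s * sum_norm k)
    \<le> norm a * max_norm v * (max_norm (sum_norm k *\<^sub>R c k) * exp (s * sum_norm k))"
    by (simp add: max_norm_smult norm_mult max_norm_scaleR mult_ac)
qed simp

text \<open>The Cauchy estimate in terms of coefficients: \<open>x \<le> exp x\<close> with
  \<open>x = \<eta> * sum_norm k\<close> trades the factor \<open>sum_norm k\<close> for the width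
  \<open>\<eta>\<close>.\<close>

lemma wbd_diff_loss:
  fixes c :: "int^'a \<Rightarrow> complex^'a"
  assumes "wbd (s + \<eta>) c M" "\<eta> > 0"
  shows "wbd s (\<lambda>k. sum_norm k *\<^sub>R c k) (M / \<eta>)"
proof (rule wbd_compare[OF assms(1), of "1 / \<eta>"])
  fix k :: "int^'a"
  have "\<eta> * sum_norm k \<le> exp (\<eta> * sum_norm k)"
    using exp_ge_add_one_self[of "\<eta> * sum_norm k"] by linarith
  then have "sum_norm k * exp (s * sum_norm k) * max_norm (c k)
    \<le> exp (\<eta> * sum_norm k) / \<eta> * exp (s * sum_norm k) * max_norm (c k)"
    using assms(2) by (intro mult_right_mono) (auto simp: field_simps)
  then show "max_norm (sum_norm k *\<^sub>R c k) * exp (s * sum_norm k)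
    \<le> 1 / \<eta> * (max_norm (c k) * exp ((s + \<eta>) * sum_norm k))"
    by (simp add: max_norm_scaleR exp_add algebra_simps)
qed (use assms(2) in auto)

lemma dser_bound:
  fixes c :: "int^'a \<Rightarrow> complex^'a"
  assumes "wbd s (\<lambda>k. sum_norm k *\<^sub>R c k) D" "max_norm (Im_vec z) \<le> s"
  shows "max_norm (dser c z v) \<le> D * max_norm v"
  using wser_summable(2)[OF wbd_cpair_coeff[OF assms(1), of \<i> v] assms(2)]
  by (simp add: dser_def mult.commute)

lemma dser_linear:
  fixes c :: "int^'a \<Rightarrow> complex^'a"
  assumes "wbd s (\<lambda>k. sum_norm k *\<^sub>R c k) D" "max_norm (Im_vec z) \<le> s"
  shows "dser c z (v + w) = dser c z v + dser c z w" "dser c z (a *s v) = a *s dser c z v"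
proof -
  note sm = wser_summable(1)[OF wbd_cpair_coeff[OF assms(1), of \<i>] assms(2)]
  show "dser c z (v + w) = dser c z v + dser c z w"
    unfolding dser_def wser_def infsum_add[OF sm sm, symmetric]
    by (intro infsum_cong) (simp add: vec_eq_iff cpair_add algebra_simps)
  show "dser c z (a *s v) = a *s dser c z v"
    unfolding dser_def wser_def
    using infsumI[OF has_sum_bounded_linear[OF bounded_linear_smult_right has_sum_infsum[OF sm]], of a v]
    by (simp add: cpair_smult vector_smult_assoc mult_ac)
qed

lemma dser_bounded_linear:
  fixes c :: "int^'a \<Rightarrow> complex^'a"
  assumes "wbd s (\<lambda>k. sum_norm k *\<^sub>R c k) D" "max_norm (Im_vec z) \<le> s"
  shows "bounded_linear (dser c z)"
  by (rule bounded_linear_max_normI[where B = D])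
    (use dser_linear[OF assms] dser_bound[OF assms] wbd_nonneg[OF assms(1)] in auto)

section \<open>Differentiability, Lipschitz bounds and continuity of exponential series\<close>

lemma norm_exp_minus_linear_le:
  fixes w :: complex
  shows "norm (exp w - 1 - w) \<le> norm w ^ 2 * exp (norm w)"
proof -
  have "norm (exp w - (\<Sum>i\<le>1. w ^ i / fact i)) \<le> exp \<bar>Re w\<bar> * norm w ^ Suc 1 / fact 1"
    by (rule Taylor_exp)
  also have "\<dots> \<le> norm w ^ 2 * exp (norm w)"
    using abs_Re_le_cmod[of w] by (simp add: numeral_2_eq_2 mult.commute mult_right_mono)
  finally show ?thesis by (simp add: algebra_simps)
qed

lemma wser_has_derivative:
  fixes c :: "int^'a \<Rightarrow> complex^'a"
  assumes c: "wbd s c M" and z: "max_norm (Im_vec z) < s"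
  shows "(wser c has_derivative dser c z) (at z)"
proof -
  define b where "b = max_norm (Im_vec z)"
  \<comment> \<open>The gap between \<open>z\<close> and the edge of the strip is
    \<open>2 * \<eta>\<close>. One \<open>\<eta>\<close> pays for the first factor
    \<open>sum_norm k\<close>, half of the other for the second factor, and the last half absorbs
    \<open>exp (sum_norm k * max_norm v)\<close> for increments below
    \<open>\<eta> / 2\<close>.\<close>
  define \<eta> where "\<eta> = (s - b) / 2"
  have \<eta>: "\<eta> > 0" and bs: "b + \<eta> \<le> s" "b + \<eta> + \<eta> = s" and b0: "0 \<le> b"
    using z by (auto simp: \<eta>_def b_def field_simps)
  have d: "wbd (b + \<eta>) (\<lambda>k. sum_norm k *\<^sub>R c k) (M / \<eta>)"
    using wbd_diff_loss[of "b + \<eta>" \<eta> c M] c \<eta> bs by simp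
  have d2': "wbd (b + \<eta>/2) (\<lambda>k. sum_norm k *\<^sub>R (sum_norm k *\<^sub>R c k)) (M / \<eta> / (\<eta>/2))"
    by (rule wbd_diff_loss) (use d \<eta> in \<open>simp_all add: add.assoc\<close>)
  have bl: "bounded_linear (dser c z)"
    by (rule dser_bounded_linear[OF d]) (use \<eta> in \<open>simp add: b_def\<close>)
  let ?C = "M / \<eta> / (\<eta>/2)"
  have C: "?C \<ge> 0" using wbd_nonneg[OF d2'] .
  have rem: "max_norm (wser c (z + v) - wser c z - dser c z v) \<le> ?C * max_norm v ^ 2"
    if v: "max_norm v < \<eta> / 2" for v
  proof -
    let ?R = "\<lambda>k. exp (\<i> * cpair k (z + v)) *s c k - exp (\<i> * cpair k z) *s c k
       - exp (\<i> * cpair k z) *s ((\<i> * cpair k v) *s c k)"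
    have Im: "max_norm (Im_vec (z + v)) \<le> b + \<eta>"
    proof -
      have "Im_vec (z + v) = Im_vec z + Im_vec v" by (simp add: Im_vec_def vec_eq_iff)
      then show ?thesis
        using max_norm_add[of "Im_vec z" "Im_vec v"] max_norm_Im_vec[of v] v \<eta> by (simp add: b_def)
    qed
    have "wser c (z + v) - wser c z - dser c z v = infsum ?R UNIV"
      unfolding dser_def wser_def
      by (intro infsumI[symmetric] has_sum_diff has_sum_infsum wser_summable(1)[OF c]
          wser_summable(1)[OF wbd_cpair_coeff[OF d]])
        (use Im bs \<eta> in \<open>auto simp: b_def\<close>)
    moreover have "max_norm (infsum ?R UNIV) \<le> (?C * max_norm v ^ 2)"
    proof -
      have term_le: "max_norm (?R k) \<le> max_norm v ^ 2 *
        (max_norm (sum_norm k *\<^sub>R (sum_norm k *\<^sub>R c k)) * exp ((b + \<eta>/2) * sum_norm k))" for k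
      proof -
        let ?w = "\<i> * cpair k v"
        have "?R k = (exp (\<i> * cpair k z) * (exp ?w - 1 - ?w)) *s c k"
          by (simp add: vec_eq_iff cpair_add exp_add algebra_simps)
        then have "max_norm (?R k) = norm (exp (\<i> * cpair k z)) * norm (exp ?w - 1 - ?w) * max_norm (c k)"
          by (simp add: max_norm_smult norm_mult)
        also have "\<dots> \<le> exp (b * sum_norm k) *
            ((sum_norm k * max_norm v) ^ 2 * exp (\<eta>/2 * sum_norm k)) * max_norm (c k)"
        proof (intro mult_mono mult_nonneg_nonneg)
          show "norm (exp (\<i> * cpair k z)) \<le> exp (b * sum_norm k)"
            unfolding b_def by (rule norm_exp_cpair_le)
          have n: "norm ?w \<le> sum_norm k * max_norm v" using norm_cpair_le[of k v] by (simp add: norm_mult)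
          moreover have "sum_norm k * max_norm v \<le> \<eta>/2 * sum_norm k"
            using v by (subst mult.commute) (intro mult_right_mono; simp)
          ultimately have "norm ?w ^ 2 * exp (norm ?w) \<le> (sum_norm k * max_norm v) ^ 2 * exp (\<eta>/2 * sum_norm k)"
            by (intro mult_mono power_mono) auto
          then show "norm (exp ?w - 1 - ?w) \<le> (sum_norm k * max_norm v) ^ 2 * exp (\<eta>/2 * sum_norm k)"
            using norm_exp_minus_linear_le[of ?w] by linarith
        qed auto
        finally show ?thesis
          by (simp add: max_norm_scaleR power2_eq_square exp_add algebra_simps)
      qed
      have *: "(\<Sum>k\<in>K. max_norm (?R k)) \<le> ?C * max_norm v ^ 2" if K: "finite K" for K
      proof -
        have "(\<Sum>k\<in>K. max_norm (?R k)) \<le> (\<Sum>k\<in>K. max_norm v ^ 2 *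
          (max_norm (sum_norm k *\<^sub>R (sum_norm k *\<^sub>R c k)) * exp ((b + \<eta>/2) * sum_norm k)))"
          by (intro sum_mono term_le)
        also have "\<dots> \<le> max_norm v ^ 2 * ?C"
          unfolding sum_distrib_left[symmetric] by (intro mult_left_mono wbdD[OF d2' K]) auto
        finally show ?thesis by (simp add: mult.commute)
      qed
      show ?thesis using max_norm_summable(4,5)[OF *] by linarith
    qed
    ultimately show ?thesis by simp
  qed
  show ?thesis
    unfolding has_derivative_at
  proof (intro conjI bl)
    let ?K = "real CARD('a) * ?C"
    have K: "?K \<ge> 0" by (intro mult_nonneg_nonneg C) simp
    have "\<forall>\<^sub>F v in at 0. norm (norm (wser c (z + v) - wser c z - dser c z v) / norm v) \<le> ?K * norm v"
      unfolding eventually_at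
    proof (intro exI[of _ "\<eta>/2"] conjI ballI impI)
      fix v :: "complex^'a" assume "v \<noteq> 0 \<and> dist v 0 < \<eta> / 2"
      then have v: "norm v > 0" "norm v < \<eta>/2" by auto
      have mv: "max_norm v \<le> norm v" by (rule max_norm_le_norm)
      have "norm (wser c (z + v) - wser c z - dser c z v)
        \<le> real CARD('a) * max_norm (wser c (z + v) - wser c z - dser c z v)"
        by (rule norm_le_max_norm)
      also have "\<dots> \<le> real CARD('a) * (?C * max_norm v ^ 2)"
        using v mv by (intro mult_left_mono rem) auto
      also have "\<dots> \<le> real CARD('a) * (?C * norm v ^ 2)"
        using mv C by (intro mult_left_mono power_mono) auto
      finally have "norm (wser c (z + v) - wser c z - dser c z v) \<le> real CARD('a) * (?C * norm v ^ 2)" .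
      then have "norm (wser c (z + v) - wser c z - dser c z v) \<le> (?K * norm v) * norm v"
        by (simp only: power2_eq_square mult.assoc)
      then have "norm (wser c (z + v) - wser c z - dser c z v) / norm v \<le> ?K * norm v"
        unfolding pos_divide_le_eq[OF v(1)] .
      then show "norm (norm (wser c (z + v) - wser c z - dser c z v) / norm v) \<le> ?K * norm v"
        by (simp only: real_norm_def abs_divide abs_norm_cancel)
    qed (use \<eta> in simp)
    moreover have "((\<lambda>v. ?K * norm v) \<longlongrightarrow> 0) (at (0::complex^'a))"
      by (intro tendsto_mult_right_zero tendsto_norm_zero tendsto_ident_at)
    ultimately show "((\<lambda>h. norm (wser c (z + h) - wser c z - dser c z h) / norm h) \<longlongrightarrow> 0) (at 0)"
      by (rule Lim_null_comparison)
  qed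
qed

lemma norm_exp_diff_le:
  fixes u w :: complex
  assumes "Re u \<le> B" "Re w \<le> B"
  shows "norm (exp u - exp w) \<le> exp B * norm (u - w)"
proof (rule field_differentiable_bound[of "{z. Re z \<le> B}" exp exp])
  show "convex {z. Re z \<le> B}" by (rule convex_halfspace_Re_le)
qed (use assms in \<open>auto intro!: derivative_eq_intros\<close>)

text \<open>A mean value estimate for each exponential. The exponents stay in the half plane
  \<open>Re \<le> s * sum_norm k\<close>, which is convex, so the derivative bound is itself a
  Lipschitz constant on the whole closed strip.\<close>

lemma wser_lipschitz:
  fixes c :: "int^'a \<Rightarrow> complex^'a"
  assumes c: "wbd s c M" and d: "wbd s (\<lambda>k. sum_norm k *\<^sub>R c k) D"
    and z: "max_norm (Im_vec z) \<le> s" "max_norm (Im_vec w) \<le> s"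
  shows "max_norm (wser c z - wser c w) \<le> D * max_norm (z - w)"
proof -
  let ?R = "\<lambda>k. exp (\<i> * cpair k z) *s c k - exp (\<i> * cpair k w) *s c k"
  have "wser c z - wser c w = infsum ?R UNIV"
    unfolding wser_def
    by (intro infsum_diff[symmetric] wser_summable(1)[OF c] z)
  moreover have *: "(\<Sum>k\<in>K. max_norm (?R k)) \<le> D * max_norm (z - w)" if K: "finite K" for K
  proof -
    have "(\<Sum>k\<in>K. max_norm (?R k)) \<le> (\<Sum>k\<in>K. max_norm (z - w) *
          (max_norm (sum_norm k *\<^sub>R c k) * exp (s * sum_norm k)))"
    proof (rule sum_mono)
      fix k :: "int^'a"
      have "Re (\<i> * cpair k x) \<le> s * sum_norm k" if "max_norm (Im_vec x) \<le> s" for x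
        using abs_Im_cpair_le[of k x] mult_left_mono[OF that, of "sum_norm k"]
        by (simp add: mult.commute)
      then have "norm (exp (\<i> * cpair k z) - exp (\<i> * cpair k w))
        \<le> exp (s * sum_norm k) * norm (\<i> * cpair k z - \<i> * cpair k w)"
        using z by (intro norm_exp_diff_le) auto
      also have "norm (\<i> * cpair k z - \<i> * cpair k w) = norm (cpair k (z - w))"
        by (simp add: cpair_diff right_diff_distrib[symmetric] norm_mult)
      also have "exp (s * sum_norm k) * norm (cpair k (z - w))
          \<le> exp (s * sum_norm k) * (sum_norm k * max_norm (z - w))"
        by (intro mult_left_mono norm_cpair_le) auto
      finally have "norm (exp (\<i> * cpair k z) - exp (\<i> * cpair k w)) * max_norm (c k)
        \<le> exp (s * sum_norm k) * (sum_norm k * max_norm (z - w)) * max_norm (c k)"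
        by (intro mult_right_mono) auto
      moreover have "?R k = (exp (\<i> * cpair k z) - exp (\<i> * cpair k w)) *s c k"
        by (simp add: vec_eq_iff algebra_simps)
      ultimately show "max_norm (?R k) \<le> max_norm (z - w) *
          (max_norm (sum_norm k *\<^sub>R c k) * exp (s * sum_norm k))"
        by (simp only: max_norm_smult) (simp add: max_norm_scaleR mult_ac)
    qed
    also have "\<dots> \<le> max_norm (z - w) * D"
      unfolding sum_distrib_left[symmetric] by (intro mult_left_mono wbdD[OF d K]) auto
    finally show ?thesis by (simp add: mult.commute)
  qed
  ultimately show ?thesis using max_norm_summable(4,5)[OF *] by simp
qed

lemma wser_continuous_real:
  fixes c :: "int^'a \<Rightarrow> complex^'a"
  assumes "wbd s c M" "0 \<le> s"
  shows "continuous_on UNIV (\<lambda>\<theta>. wser c (cvec \<theta>))"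
proof -
  have sums: "(\<Sum>k\<in>K. max_norm (c k)) \<le> M" if "finite K" for K
    using wbdD[OF wbd_mono[OF assms order_refl, of c] that] by simp
  note sm = max_norm_summable[OF sums]
  let ?g = "\<lambda>k \<theta>. exp (\<i> * cpair k (cvec \<theta>)) *s c k"
  have ul: "uniform_limit UNIV (\<lambda>K \<theta>. \<Sum>k\<in>K. ?g k \<theta>) (\<lambda>\<theta>. \<Sum>\<^sub>\<infinity>k. ?g k \<theta>)
     (finite_subsets_at_top UNIV)"
    by (rule Weierstrass_m_test_general[where M = "\<lambda>k. real CARD('a) * max_norm (c k)"])
      (use summable_on_cmult_right[OF sm(3)] in \<open>auto intro!: order_trans[OF norm_le_max_norm] simp: max_norm_smult cpair_cvec\<close>)
  show ?thesis
    unfolding wser_def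
  proof (rule uniform_limit_theorem[OF _ ul])
    have "continuous_on UNIV (?g k)" for k
      by (intro bounded_linear.continuous_on[OF bounded_linear_smult_left] continuous_intros)
        (auto simp: cpair_def intro!: continuous_intros)
    then show "\<forall>\<^sub>F K in finite_subsets_at_top UNIV. continuous_on UNIV (\<lambda>\<theta>. \<Sum>k\<in>K. ?g k \<theta>)"
      by (intro always_eventually allI continuous_on_sum)
  qed simp
qed

section \<open>Fourier coefficients\<close>

abbreviation period_box :: "(real^'n) set" where
  "period_box \<equiv> cbox 0 (\<chi> i. 2 * pi)"

text \<open>The box is lengthened by \<open>t\<close> in direction \<open>j\<close> and cut once at
  \<open>t\<close> and once at \<open>2 * pi\<close>. The two short pieces are translates of each
  other by a period, so the two long pieces have equal integrals.\<close>

lemma integral_period_box_shift: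
  fixes f :: "real^'n \<Rightarrow> complex"
  assumes cont: "continuous_on UNIV f" and per: "\<And>x. f (x + axis j (2 * pi)) = f x"
    and t: "0 \<le> t" "t \<le> 2 * pi"
  shows "integral period_box (\<lambda>x. f (x + axis j t)) = integral period_box f"
proof -
  define p d q :: "real^'n" where "p = (\<chi> i. 2 * pi)" and "d = axis j t" and "q = axis j (2 * pi)"
  let ?C = "cbox 0 (p + d)"
  have int: "f integrable_on cbox a b" for a b
    by (rule integrable_continuous) (rule continuous_on_subset[OF cont], simp)
  have sp: "integral ?C f = integral (?C \<inter> {x. x $ j \<le> c}) f + integral (?C \<inter> {x. x $ j \<ge> c}) f" for c
    using integral_split[OF int, of "axis j 1" 0 "p + d" c] by (simp add: inner_axis axis_in_Basis_iff)
  have pd: "(p + d) $ i = (if i = j then 2 * pi + t else 2 * pi)" "d $ i = (if i = j then t else 0)"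
    "q $ i = (if i = j then 2 * pi else 0)" for i
    by (simp_all add: p_def d_def q_def axis_def)
  have box: "x \<in> cbox a b \<longleftrightarrow> (a $ j \<le> x $ j \<and> x $ j \<le> b $ j) \<and> (\<forall>i. i \<noteq> j \<longrightarrow> a $ i \<le> x $ i \<and> x $ i \<le> b $ i)"
    for x a b :: "real^'n"
    unfolding mem_box_cart by metis
  have 1: "?C \<inter> {x. x $ j \<ge> t} = cbox d (p + d)"
    using t by (auto simp: box pd simp del: vector_add_component)
  have 2: "?C \<inter> {x. x $ j \<le> 2 * pi} = cbox 0 p"
    using t by (auto simp: box pd p_def[symmetric] simp del: vector_add_component) (auto simp: p_def)
  have 3: "?C \<inter> {x. x $ j \<ge> 2 * pi} = cbox q (p + d)"
    using t by (auto simp: box pd simp del: vector_add_component)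
  have 4: "?C \<inter> {x. x $ j \<le> t} = cbox (q - q) (p + d - q)"
    using t by (auto simp: box pd simp del: vector_add_component)
  have "integral (cbox q (p + d)) f = integral (cbox (q - q) (p + d - q)) f"
    using integral_shift_cbox[of q q "p + d" f] per by (simp add: q_def)
  moreover have "integral (cbox d (p + d)) f = integral (cbox 0 p) (\<lambda>x. f (x + d))"
    using integral_shift_cbox[of d d "p + d" f] by simp
  ultimately show ?thesis
    using sp[of t] sp[of "2 * pi"] unfolding 1 2 3 4 by (simp add: p_def d_def)
qed

lemma pairing_axis: "pairing k (axis j t) = of_int (k $ j) * t"
proof -
  have "pairing k (axis j t) = (\<Sum>i\<in>UNIV. if i = j then of_int (k $ j) * t else 0)"
    unfolding pairing_def by (intro sum.cong) (auto simp: axis_def)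
  then show ?thesis by simp
qed

lemma pairing_add: "pairing k (x + y) = pairing k x + pairing k y"
  by (simp add: pairing_def distrib_left sum.distrib)

lemma pairing_add_left: "pairing (k + l) x = pairing k x + pairing l x"
  by (simp add: pairing_def algebra_simps sum.distrib)

lemma pairing_minus_left: "pairing (- k) x = - pairing k x"
  by (simp add: pairing_def sum_negf)

lemma pairing_0_left [simp]: "pairing 0 x = 0"
  by (simp add: pairing_def)

lemma continuous_on_pairing [continuous_intros]:
  "continuous_on S f \<Longrightarrow> continuous_on S (\<lambda>x. pairing k (f x))"
  unfolding pairing_def by (intro continuous_intros)

lemma exp_2pi_int: "exp (\<i> * of_real (of_int m * (2 * pi))) = 1"
  using exp_integer_2pi[of "of_int m"] by (simp add: mult_ac)

lemma exp_pairing_lattice: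
  "exp (\<i> * of_real (pairing k (lattice_vec m))) = 1"
proof -
  have "pairing k (lattice_vec m) = of_int (\<Sum>i\<in>UNIV. k $ i * m $ i) * (2 * pi)"
    by (simp add: pairing_def lattice_vec_def sum_distrib_left mult_ac)
  then show ?thesis by (simp only: exp_2pi_int)
qed

lemma content_period_box: "measure lborel (period_box :: (real^'n) set) = (2 * pi) ^ CARD('n)"
  by (subst content_cbox_if_cart) (auto simp: interval_eq_empty_cart not_less)

text \<open>For \<open>k \<noteq> 0\<close>, translating by half a wavelength in a coordinate with
  \<open>k $ j \<noteq> 0\<close> changes the sign of the character but not its integral, which must
  then vanish. This avoids iterated integrals.\<close>

lemma integral_exp_pairing:
  fixes k :: "int^'n"
  shows "integral period_box (\<lambda>x. exp (\<i> * of_real (pairing k x))) =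
    (if k = 0 then of_real ((2 * pi) ^ CARD('n)) else 0)"
proof (cases "k = 0")
  case True
  then show ?thesis
    by (simp add: content_period_box scaleR_conv_of_real)
next
  case False
  then obtain j where j: "k $ j \<noteq> 0" by (metis vec_eq_iff zero_index)
  define t where "t = pi / \<bar>of_int (k $ j)\<bar>"
  have kj: "\<bar>of_int (k $ j)\<bar> \<ge> (1::real)" using j by linarith
  then have "pi / \<bar>of_int (k $ j)\<bar> \<le> pi / 1" by (intro divide_left_mono) auto
  then have t: "0 \<le> t" "t \<le> 2 * pi" using pi_gt_zero unfolding t_def div_by_1
    by (simp, linarith)
  let ?I = "integral period_box (\<lambda>x. exp (\<i> * of_real (pairing k x)))"
  have "of_int (k $ j) * t = pi \<or> of_int (k $ j) * t = - pi"
    using kj by (auto simp: t_def abs_if)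
  then have m1: "exp (\<i> * of_real (of_int (k $ j) * t)) = -1"
    by (auto simp: exp_minus simp del: of_real_mult)
  have "?I = integral period_box (\<lambda>x. exp (\<i> * of_real (pairing k (x + axis j t))))"
  proof (rule integral_period_box_shift[symmetric])
    show "exp (\<i> * of_real (pairing k (x + axis j (2 * pi)))) = exp (\<i> * of_real (pairing k x))" for x
      unfolding pairing_add pairing_axis of_real_add distrib_left exp_add exp_2pi_int by simp
  qed (auto intro!: continuous_intros t)
  also have "\<dots> = integral period_box (\<lambda>x. - exp (\<i> * of_real (pairing k x)))"
    unfolding pairing_add pairing_axis of_real_add distrib_left exp_add m1 by simp
  also have "\<dots> = - ?I" by (rule integral_neg)
  finally show ?thesis using False by simp
qed

lemma lattice_reduce:
  fixes x :: "real^'n"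
  obtains y k where "y \<in> period_box" "x = y + lattice_vec k"
proof
  let ?k = "(\<chi> i. \<lfloor>x $ i / (2 * pi)\<rfloor>) :: int^'n"
  have *: "of_int \<lfloor>t / (2 * pi)\<rfloor> * (2 * pi) \<le> t" "t \<le> (of_int \<lfloor>t / (2 * pi)\<rfloor> + 1) * (2 * pi)" for t :: real
    using floor_correct[of "t / (2 * pi)"] pi_gt_zero
    by (simp_all only: pos_le_divide_eq[symmetric] pos_divide_le_eq[symmetric] mult_pos_pos
        zero_less_numeral less_imp_le of_int_add of_int_1)
  show "x - lattice_vec ?k \<in> period_box"
    using * by (auto simp: mem_box_cart lattice_vec_def algebra_simps)
  show "x = x - lattice_vec ?k + lattice_vec ?k" by simp
qed

text \<open>If all Fourier coefficients of \<open>f\<close> vanish, then \<open>f\<close> is orthogonal to all powers of the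
  trigonometric polynomial \<open>q\<close> below, which concentrate at the point \<open>a\<close>.\<close>

lemma fourier_unique_interior:
  fixes f :: "real^'n \<Rightarrow> complex"
  assumes cont: "continuous_on UNIV f"
    and zero: "\<And>k. integral period_box (\<lambda>x. exp (\<i> * of_real (pairing k x)) * f x) = 0"
    and a: "a \<in> box 0 (\<chi> i. 2 * pi)"
  shows "f a = 0"
proof (rule ccontr)
  assume fa: "f a \<noteq> 0"
  define n where "n = real CARD('n)"
  have n: "n > 0" by (simp add: n_def)
  define q :: "real^'n \<Rightarrow> real" where "q x = (\<Sum>i\<in>UNIV. 1 + cos (x $ i - a $ i)) / (2 * n)" for x
  have contq: "continuous_on S q" for S
    unfolding q_def using n by (intro continuous_intros) auto
  have q0: "0 \<le> q x" and q1: "q x \<le> 1" for x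
  proof -
    have "0 \<le> 1 + cos (x $ i - a $ i)" for i using cos_ge_minus_one[of "x $ i - a $ i"] by linarith
    then show "0 \<le> q x" unfolding q_def using n by (intro divide_nonneg_pos sum_nonneg) auto
    have "(\<Sum>i\<in>UNIV. 1 + cos (x $ i - a $ i)) \<le> (\<Sum>i\<in>(UNIV::'n set). 2)"
      by (intro sum_mono) (use cos_le_one in force)
    then show "q x \<le> 1" unfolding q_def using n by (simp add: n_def divide_le_eq)
  qed
  have intg: "(\<lambda>x. g x) integrable_on period_box" if "continuous_on UNIV g" for g :: "real^'n \<Rightarrow> complex"
    by (rule integrable_continuous) (rule continuous_on_subset[OF that], simp)
  \<comment> \<open>The frequency \<open>k\<close> is generalised in the induction: multiplication
    by \<open>q\<close>, an average of cosines, moves it by one unit along each axis.\<close>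
  have ortho: "integral period_box (\<lambda>x. exp (\<i> * of_real (pairing k x)) * f x * of_real (q x) ^ N) = 0" for k N
  proof (induction N arbitrary: k)
    case 0
    then show ?case using zero by simp
  next
    case (Suc N)
    let ?e = "\<lambda>k x. exp (\<i> * of_real (pairing k x)) * f x * of_real (q x) ^ N"
    let ?c = "1 / of_real (2 * n) :: complex"
    have ax: "exp (\<i> * of_real (pairing (k + axis i 1) x)) = exp (\<i> * of_real (pairing k x)) * exp (\<i> * of_real (x $ i))"
      "exp (\<i> * of_real (pairing (k + axis i (-1)) x)) = exp (\<i> * of_real (pairing k x)) * exp (- (\<i> * of_real (x $ i)))"
      for i x
    proof -
      have "pairing (axis i c) x = of_int c * x $ i" for c
      proof -
        have "pairing (axis i c) x = (\<Sum>j\<in>UNIV. if j = i then of_int c * x $ i else 0)"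
          unfolding pairing_def by (intro sum.cong) (auto simp: axis_def)
        then show ?thesis by simp
      qed
      then show "exp (\<i> * of_real (pairing (k + axis i 1) x)) = exp (\<i> * of_real (pairing k x)) * exp (\<i> * of_real (x $ i))"
      "exp (\<i> * of_real (pairing (k + axis i (-1)) x)) = exp (\<i> * of_real (pairing k x)) * exp (- (\<i> * of_real (x $ i)))"
        by (simp_all add: pairing_add_left exp_add[symmetric] algebra_simps)
    qed
    have cos_expand: "cos (u - v) = exp (- (\<i> * v)) / 2 * exp (\<i> * u) + exp (\<i> * v) / 2 * exp (- (\<i> * u))"
      for u v :: complex
    proof -
      have "\<i> * (u - v) = \<i> * u + (- (\<i> * v))" "- (\<i> * (u - v)) = \<i> * v + (- (\<i> * u))"
        by (simp_all add: algebra_simps)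
      then show ?thesis
        unfolding cos_exp_eq by (simp only: exp_add) (simp add: add_divide_distrib mult.commute)
    qed
    have expand: "c * (E * F * Q) * (1 + (A / 2 * B + A' / 2 * B'))
      = c * (E * F * Q) + c * A / 2 * (E * B * F * Q) + c * A' / 2 * (E * B' * F * Q)"
      for c E F Q A B A' B' :: complex
      by (simp add: algebra_simps)
    have "?e k x * of_real (q x) = (\<Sum>i\<in>UNIV. ?c * ?e k x
       + ?c * exp (- (\<i> * of_real (a $ i))) / 2 * ?e (k + axis i 1) x
       + ?c * exp (\<i> * of_real (a $ i)) / 2 * ?e (k + axis i (-1)) x)" for x
    proof -
      have qx: "of_real (q x) = (\<Sum>i\<in>UNIV. ?c * (1 + cos (of_real (x $ i) - of_real (a $ i))))"
        unfolding q_def by (simp add: sum_distrib_left cos_of_real[symmetric] sum_divide_distrib)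
      have "?e k x * of_real (q x) = ?e k x * (\<Sum>i\<in>UNIV. ?c * (1 + cos (of_real (x $ i) - of_real (a $ i))))"
        by (rule arg_cong[OF qx])
      also have "\<dots> = (\<Sum>i\<in>UNIV. ?c * ?e k x * (1 + cos (of_real (x $ i) - of_real (a $ i))))"
        unfolding sum_distrib_left by (intro sum.cong refl) (simp add: mult_ac)
      also have "\<dots> = (\<Sum>i\<in>UNIV. ?c * ?e k x
       + ?c * exp (- (\<i> * of_real (a $ i))) / 2 * ?e (k + axis i 1) x
       + ?c * exp (\<i> * of_real (a $ i)) / 2 * ?e (k + axis i (-1)) x)"
        unfolding ax cos_expand by (intro sum.cong refl) (rule expand)
      finally show ?thesis .
    qed
    then have "(\<lambda>x. exp (\<i> * of_real (pairing k x)) * f x * of_real (q x) ^ Suc N) =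
       (\<lambda>x. \<Sum>i\<in>UNIV. ?c * ?e k x
       + ?c * exp (- (\<i> * of_real (a $ i))) / 2 * ?e (k + axis i 1) x
       + ?c * exp (\<i> * of_real (a $ i)) / 2 * ?e (k + axis i (-1)) x)"
      by (simp add: fun_eq_iff mult_ac)
    moreover have "(?e k has_integral 0) period_box" for k
    proof -
      have "?e k integrable_on period_box"
        by (intro intg continuous_intros cont contq)
      then show ?thesis using Suc.IH[of k] by (simp add: has_integral_integral)
    qed
    then have "((\<lambda>x. \<Sum>i\<in>UNIV. ?c * ?e k x
       + ?c * exp (- (\<i> * of_real (a $ i))) / 2 * ?e (k + axis i 1) x
       + ?c * exp (\<i> * of_real (a $ i)) / 2 * ?e (k + axis i (-1)) x) has_integral
       (\<Sum>i\<in>(UNIV::'n set). ?c * 0 + ?c * exp (- (\<i> * of_real (a $ i))) / 2 * 0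
        + ?c * exp (\<i> * of_real (a $ i)) / 2 * 0)) period_box"
      by (intro has_integral_sum has_integral_add has_integral_mult_right) auto
    ultimately show ?case by (simp add: integral_unique)
  qed
  \<comment> \<open>Rotating \<open>f\<close> so that its value at \<open>a\<close> becomes positive
    reduces the contradiction to a real inequality.\<close>
  define g where "g x = Re (cnj (f a) * f x)" for x
  have contg: "continuous_on S g" for S
    unfolding g_def by (intro continuous_intros continuous_on_subset[OF cont]) auto
  have g0: "((\<lambda>x. g x * q x ^ N) has_integral 0) period_box" for N
  proof -
    have "(\<lambda>x. f x * of_real (q x) ^ N) integrable_on period_box"
      by (intro intg continuous_intros cont contq)
    then have "((\<lambda>x. f x * of_real (q x) ^ N) has_integral 0) period_box"
      using ortho[of 0 N] by (simp add: has_integral_integral)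
    then have "((\<lambda>x. Re (cnj (f a) * (f x * of_real (q x) ^ N))) has_integral Re (cnj (f a) * 0)) period_box"
      by (intro has_integral_Re has_integral_mult_right)
    moreover have "Re (cnj (f a) * (f x * of_real (q x) ^ N)) = g x * q x ^ N" for x
      by (simp add: g_def mult.assoc[symmetric] of_real_power[symmetric] del: of_real_power)
    ultimately show ?thesis by simp
  qed
  define c where "c = (norm (f a))\<^sup>2 / 2"
  have c: "c > 0" using fa by (simp add: c_def)
  have ga: "g a = 2 * c" unfolding g_def c_def cmod_power2 by (simp add: power2_eq_square)
  have nh: "\<exists>d>0. \<forall>x. dist x a < d \<longrightarrow> y < h x"
    if "continuous_on UNIV h" "y < h a" for h :: "real^'n \<Rightarrow> real" and y
  proof -
    have "open {x. y < h x}"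
      using that(1) by (intro open_Collect_less continuous_on_const) auto
    then show ?thesis using that(2) by (auto simp: open_dist)
  qed
  obtain d1 where d1: "d1 > 0" "\<And>x. dist x a < d1 \<Longrightarrow> c < g x"
    using nh[OF contg, of c] ga c by auto
  let ?S = "period_box - ball a d1"
  have comp: "compact ?S" by (intro compact_diff compact_cbox open_ball)
  \<comment> \<open>On the compact remainder \<open>q\<close> attains its maximum, and the value 1
    would force every cosine to be 1.\<close>
  have "\<exists>\<rho>. 0 \<le> \<rho> \<and> \<rho> < 1 \<and> (\<forall>x\<in>?S. q x \<le> \<rho>)"
  proof (cases "?S = {}")
    case True
    then show ?thesis by (intro exI[of _ 0]) auto
  next
    case False
    obtain y where y: "y \<in> ?S" "\<And>x. x \<in> ?S \<Longrightarrow> q x \<le> q y"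
      using continuous_attains_sup[OF comp False contq] by blast
    have "q y \<noteq> 1"
    proof
      assume "q y = 1"
      then have "(\<Sum>i\<in>UNIV. 1 - cos (y $ i - a $ i)) = 0"
        using n by (simp add: q_def n_def sum.distrib sum_subtractf field_simps)
      then have "\<forall>i\<in>UNIV. 1 - cos (y $ i - a $ i) = 0"
        by (subst (asm) sum_nonneg_eq_0_iff) (auto simp: cos_le_one)
      then have cs: "cos (y $ i - a $ i) = 1" for i by auto
      \<comment> \<open>Since \<open>a\<close> is an interior point, no coordinate of
        \<open>y - a\<close> reaches \<open>2 * pi\<close> in modulus; on the boundary a lattice
        translate of \<open>a\<close> could lie in the same box.\<close>
      have "y $ i = a $ i" for i
      proof -
        have b: "0 \<le> y $ i" "y $ i \<le> 2 * pi" "0 < a $ i" "a $ i < 2 * pi"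
          using y(1) a by (auto simp: mem_box_cart)
        obtain m :: int where m: "y $ i - a $ i = of_int m * 2 * pi"
          using cs[of i] cos_one_2pi_int by metis
        have "\<bar>of_int m * (2 * pi)\<bar> < 1 * (2 * pi)" using m b by linarith
        then have "\<bar>of_int m\<bar> < (1::real)" unfolding abs_mult using pi_gt_zero by simp
        then have "m = 0" by linarith
        then show ?thesis using m by simp
      qed
      then have "y = a" by (simp add: vec_eq_iff)
      then show False using y(1) d1(1) by simp
    qed
    then show ?thesis using y(2) q0[of y] q1[of y] by (intro exI[of _ "q y"]) auto
  qed
  then obtain \<rho> where \<rho>: "0 \<le> \<rho>" "\<rho> < 1" "\<And>x. x \<in> ?S \<Longrightarrow> q x \<le> \<rho>" by blast
  \<comment> \<open>A level strictly between \<open>\<rho>\<close> and 1: near \<open>a\<close> the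
    powers of \<open>q\<close> exceed \<open>\<sigma> ^ N\<close>, far away they are below
    \<open>\<rho> ^ N\<close>, and \<open>(\<rho> / \<sigma>) ^ N\<close> tends to 0.\<close>
  define \<sigma> where "\<sigma> = (1 + \<rho>) / 2"
  have \<sigma>: "\<rho> < \<sigma>" "\<sigma> < 1" "0 < \<sigma>" using \<rho> by (auto simp: \<sigma>_def)
  have "q a = 1" using n by (simp add: q_def n_def)
  then obtain d2 where d2: "d2 > 0" "\<And>x. dist x a < d2 \<Longrightarrow> \<sigma> < q x"
    using nh[OF contq, of \<sigma>] \<sigma> by auto
  obtain d3 where d3: "d3 > 0" "ball a d3 \<subseteq> box 0 (\<chi> i. 2 * pi)"
    using a open_box open_contains_ball by metis
  define d where "d = min d1 (min d2 d3)"
  have d: "d > 0" using d1 d2 d3 by (simp add: d_def)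
  obtain u v where uv: "a \<in> box u v" "cbox u v \<subseteq> ball a d"
    using d by (metis open_ball open_contains_cbox centre_in_ball)
  have uvB: "cbox u v \<subseteq> period_box"
    using uv(2) d3(2) box_subset_cbox[of 0 "(\<chi> i. 2 * pi) :: real^'n"] by (force simp: d_def)
  have "bounded (g ` period_box)"
    by (intro compact_imp_bounded compact_continuous_image contg compact_cbox)
  then obtain C where C: "\<And>x. x \<in> period_box \<Longrightarrow> \<bar>g x\<bar> \<le> C"
    unfolding bounded_iff by auto
  \<comment> \<open>The integral of \<open>g * q ^ N\<close> is 0. It is bounded below by the mass
    on a small box around \<open>a\<close> minus the worst case elsewhere; in the intermediate ring
    \<open>g\<close> is still positive and does no harm.\<close>
  have ineq: "c * \<sigma> ^ N * measure lborel (cbox u v) \<le> C * \<rho> ^ N * measure lborel (period_box :: (real^'n) set)" for N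
  proof -
    have C0: "0 \<le> C" using C[of a] a box_subset_cbox by (metis abs_ge_zero in_mono order_trans)
    have 1: "((\<lambda>x. c * \<sigma> ^ N * indicator (cbox u v) x - C * \<rho> ^ N) has_integral
       c * \<sigma> ^ N * measure lborel (cbox u v) - measure lborel (period_box :: (real^'n) set) *\<^sub>R (C * \<rho> ^ N)) period_box"
    proof (intro has_integral_diff has_integral_const has_integral_mult_right)
      have "((\<lambda>x. 1::real) has_integral measure lborel (cbox u v)) (cbox u v)"
        using has_integral_const[of "1::real" u v] by simp
      then have "((\<lambda>x. if x \<in> cbox u v then 1 else 0::real) has_integral measure lborel (cbox u v)) period_box"
        using has_integral_restrict[OF uvB, of "\<lambda>x. 1::real"] by simp
      then show "(indicat_real (cbox u v) has_integral measure lborel (cbox u v)) period_box"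
        by (rule has_integral_eq[rotated]) simp
    qed
    have "c * \<sigma> ^ N * measure lborel (cbox u v) - measure lborel (period_box :: (real^'n) set) *\<^sub>R (C * \<rho> ^ N) \<le> 0"
    proof (rule has_integral_le[OF 1 g0[of N]])
      fix x :: "real^'n" assume x: "x \<in> period_box"
      have Cr: "0 \<le> C * \<rho> ^ N" using C0 \<rho> by simp
      show "c * \<sigma> ^ N * indicator (cbox u v) x - C * \<rho> ^ N \<le> g x * q x ^ N"
      proof (cases "x \<in> cbox u v")
        case True
        then have dx: "dist x a < d" using uv(2) by (auto simp: dist_commute)
        then have "c \<le> g x" "\<sigma> \<le> q x" using d1(2)[of x] d2(2)[of x] by (auto simp: d_def)
        then have "c * \<sigma> ^ N \<le> g x * q x ^ N"
          using c \<sigma> by (intro mult_mono power_mono) auto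
        then show ?thesis using True Cr by simp
      next
        case False
        show ?thesis
        proof (cases "dist x a < d1")
          case True
          then have "0 \<le> g x * q x ^ N" using d1(2)[of x] c q0[of x] by simp
          then show ?thesis using False Cr by simp
        next
          case far: False
          then have "q x \<le> \<rho>" using x by (intro \<rho>(3)) (auto simp: dist_commute)
          then have "\<bar>g x * q x ^ N\<bar> \<le> C * \<rho> ^ N"
            using q0[of x] C[OF x] unfolding abs_mult by (intro mult_mono) (auto intro: power_mono)
          then show ?thesis using False by simp
        qed
      qed
    qed
    then show ?thesis by (simp add: mult_ac)
  qed
  have "measure lborel (cbox u v) > 0"
    using uv(1) by (subst content_pos_lt_eq) (auto simp: box_def)
  then have cv: "c * measure lborel (cbox u v) > 0" using c by simp
  have "((\<lambda>N. C * measure lborel (period_box :: (real^'n) set) * (\<rho> / \<sigma>) ^ N) \<longlonglongrightarrow>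
      C * measure lborel (period_box :: (real^'n) set) * 0)"
    using \<sigma> \<rho> by (intro tendsto_mult tendsto_const LIMSEQ_realpow_zero) auto
  moreover have "c * measure lborel (cbox u v) \<le> C * measure lborel (period_box :: (real^'n) set) * (\<rho> / \<sigma>) ^ N" for N
    using ineq[of N] \<sigma> by (simp add: power_divide field_simps)
  ultimately have "c * measure lborel (cbox u v) \<le> 0"
    by (intro LIMSEQ_le_const) auto
  then show False using cv by simp
qed

text \<open>Continuity extends the interior case to the closed period box, and periodicity extends
  it from there to the whole space.\<close>

lemma fourier_unique:
  fixes f :: "real^'n \<Rightarrow> complex"
  assumes cont: "continuous_on UNIV f" and per: "\<And>x k. f (x + lattice_vec k) = f x"
    and zero: "\<And>k. integral period_box (\<lambda>x. exp (\<i> * of_real (pairing k x)) * f x) = 0"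
  shows "f x = 0"
proof -
  have box: "f y = 0" if "y \<in> box 0 (\<chi> i. 2 * pi)" for y
    by (rule fourier_unique_interior[OF cont zero that])
  have ne: "box 0 (\<chi> i. 2 * pi) \<noteq> ({} :: (real^'n) set)"
    by (simp add: interval_eq_empty_cart not_le)
  obtain y k where y: "y \<in> period_box" "x = y + lattice_vec k" by (rule lattice_reduce)
  have "f y = 0"
    by (rule continuous_constant_on_closure[of "box 0 (\<chi> i. 2 * pi)"])
      (use y box ne in \<open>auto intro: continuous_on_subset[OF cont] simp: closure_box\<close>)
  then show ?thesis using per y by simp
qed

section \<open>Coefficients of exponential series and Fourier inversion\<close>

lemma exp_cpair_lattice:
  "exp (\<i> * cpair k (z + cvec (lattice_vec m))) = exp (\<i> * cpair k z)"
  using exp_pairing_lattice[of k m] by (simp add: cpair_add cpair_cvec distrib_left exp_add)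

lemma wser_lattice: "wser c (z + cvec (lattice_vec m)) = wser c z"
  by (simp add: wser_def exp_cpair_lattice)

lemma fourier_coeff_nth:
  fixes f :: "real^'n \<Rightarrow> complex^'n"
  assumes "continuous_on UNIV f"
  shows "fourier_coeff f k $ i = (1 / (2 * pi) ^ CARD('n)) *\<^sub>R
    integral period_box (\<lambda>\<theta>. exp (- \<i> * of_real (pairing k \<theta>)) * f \<theta> $ i)"
proof -
  have "(\<lambda>\<theta>. exp (- \<i> * of_real (pairing k \<theta>)) *s f \<theta>) integrable_on period_box"
    by (rule integrable_continuous, rule continuous_on_subset[of UNIV])
      (auto simp: vector_scalar_mult_def intro!: continuous_intros assms)
  then have "integral period_box (\<lambda>\<theta>. exp (- \<i> * of_real (pairing k \<theta>)) *s f \<theta>) $ i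
    = integral period_box (\<lambda>\<theta>. (exp (- \<i> * of_real (pairing k \<theta>)) *s f \<theta>) $ i)"
    using integral_linear[OF _ bounded_linear_vec_nth[of i]] by (fastforce simp: o_def)
  then show ?thesis by (simp add: fourier_coeff_def)
qed

text \<open>Partial sums converge uniformly at real angles, so integration commutes with the limit.
  This is the uniqueness statement by which coefficients are compared in equations between
  series.\<close>

lemma fourier_coeff_wser:
  fixes c :: "int^'n \<Rightarrow> complex^'n"
  assumes c: "wbd s c M" "0 \<le> s"
  shows "fourier_coeff (\<lambda>\<theta>. wser c (cvec \<theta>)) k = c k"
proof -
  have sums: "(\<Sum>k\<in>K. max_norm (c k)) \<le> M" if "finite K" for K
    using wbdD[OF wbd_mono[OF c order_refl, of c] that] by simp
  note sm = max_norm_summable[OF sums]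
  let ?f = "\<lambda>\<theta>. wser c (cvec \<theta>)"
  let ?w = "(2 * pi) ^ CARD('n)"
  let ?T = "\<lambda>K \<theta>. \<Sum>l\<in>K. exp (\<i> * cpair l (cvec \<theta>)) *s c l"
  have ul: "uniform_limit UNIV ?T ?f (finite_subsets_at_top UNIV)"
    unfolding wser_def
    by (rule Weierstrass_m_test_general[where M = "\<lambda>k. real CARD('n) * max_norm (c k)"])
      (use summable_on_cmult_right[OF sm(3)] in \<open>auto intro!: order_trans[OF norm_le_max_norm] simp: max_norm_smult cpair_cvec\<close>)
  have contf: "continuous_on UNIV ?f" by (rule wser_continuous_real[OF c])
  have fin: "((\<lambda>\<theta>. exp (- \<i> * of_real (pairing k \<theta>)) * ?T K \<theta> $ i) has_integral of_real ?w * c k $ i) period_box"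
    if K: "finite K" "k \<in> K" for K i
  proof -
    have 1: "((\<lambda>\<theta>. exp (\<i> * of_real (pairing (l - k) \<theta>)) * c l $ i) has_integral
        (if l = k then of_real ?w else 0) * c l $ i) period_box" for l
    proof (intro has_integral_mult_left)
      have "(\<lambda>x. exp (\<i> * of_real (pairing (l - k) x))) integrable_on period_box"
        by (intro integrable_continuous continuous_intros)
      then show "((\<lambda>x. exp (\<i> * of_real (pairing (l - k) x))) has_integral
          (if l = k then of_real ?w else 0)) period_box"
        using integral_exp_pairing[of "l - k"] by (simp add: has_integral_integral split: if_splits)
    qed
    have "((\<lambda>\<theta>. \<Sum>l\<in>K. exp (\<i> * of_real (pairing (l - k) \<theta>)) * c l $ i) has_integral
        (\<Sum>l\<in>K. (if l = k then of_real ?w else 0) * c l $ i)) period_box"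
      by (intro has_integral_sum K 1)
    moreover have "(\<Sum>l\<in>K. (if l = k then of_real ?w else 0) * c l $ i) = (of_real ?w * c k $ i :: complex)"
      using K by (subst sum.remove[of _ k]) (auto intro!: sum.neutral)
    moreover have "exp (- \<i> * of_real (pairing k \<theta>)) * ?T K \<theta> $ i =
        (\<Sum>l\<in>K. exp (\<i> * of_real (pairing (l - k) \<theta>)) * c l $ i)" for \<theta>
    proof -
      have "exp (- \<i> * of_real (pairing k \<theta>)) * (exp (\<i> * of_real (pairing l \<theta>)) * c l $ i)
        = exp (\<i> * of_real (pairing (l - k) \<theta>)) * c l $ i" for l
        using pairing_add_left[of l "- k" \<theta>]
        by (simp only: mult.assoc[symmetric] exp_add[symmetric])
          (simp add: pairing_minus_left right_diff_distrib)
      then show ?thesis by (simp only: sum_component sum_distrib_left cpair_cvec vector_smult_component)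
    qed
    ultimately show ?thesis by simp
  qed
  have "fourier_coeff ?f k $ i = c k $ i" for i
  proof -
    let ?I = "integral period_box (\<lambda>\<theta>. exp (- \<i> * of_real (pairing k \<theta>)) * ?f \<theta> $ i)"
    have "(\<lambda>\<theta>. exp (- \<i> * of_real (pairing k \<theta>)) * ?f \<theta> $ i) integrable_on period_box"
      by (rule integrable_continuous, rule continuous_on_subset[of UNIV])
        (auto intro!: continuous_intros contf)
    then have I: "((\<lambda>\<theta>. exp (- \<i> * of_real (pairing k \<theta>)) * ?f \<theta> $ i) has_integral ?I) period_box"
      by (rule integrable_integral)
    have *: "norm (?I - of_real ?w * c k $ i) \<le> e * ?w" if e: "e > 0" for e
    proof -
      have "\<forall>\<^sub>F K in finite_subsets_at_top UNIV. \<forall>\<theta>\<in>UNIV. dist (?T K \<theta>) (?f \<theta>) < e"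
        using uniform_limitD[OF ul e] .
      then obtain K0 where K0: "finite K0"
        "\<And>K. finite K \<Longrightarrow> K0 \<subseteq> K \<Longrightarrow> (\<forall>\<theta>. dist (?T K \<theta>) (?f \<theta>) < e)"
        unfolding eventually_finite_subsets_at_top by auto
      \<comment> \<open>Once the finite index set contains \<open>k\<close>, the integral of the
        partial sum already equals the coefficient exactly, and only the uniform error
        remains.\<close>
      define K where "K = insert k K0"
      have K: "finite K" "k \<in> K" "\<And>\<theta>. dist (?T K \<theta>) (?f \<theta>) < e"
        using K0 by (auto simp: K_def)
      have "norm (?I - of_real ?w * c k $ i) \<le> e * measure lborel (period_box :: (real^'n) set)"
      proof (rule has_integral_bound[OF _ has_integral_diff[OF I fin[OF K(1,2)]]])
        fix \<theta> :: "real^'n"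
        have "norm (exp (- \<i> * of_real (pairing k \<theta>)) * ?f \<theta> $ i - exp (- \<i> * of_real (pairing k \<theta>)) * ?T K \<theta> $ i)
          = norm ((?f \<theta> - ?T K \<theta>) $ i)"
          by (simp add: right_diff_distrib[symmetric] norm_mult del: sum_component)
        also have "\<dots> \<le> norm (?f \<theta> - ?T K \<theta>)" by (rule Finite_Cartesian_Product.norm_nth_le)
        finally show "norm (exp (- \<i> * of_real (pairing k \<theta>)) * ?f \<theta> $ i
            - exp (- \<i> * of_real (pairing k \<theta>)) * ?T K \<theta> $ i) \<le> e"
          using K(3)[of \<theta>] by (simp add: dist_norm norm_minus_commute)
      qed (use e in simp)
      then show ?thesis by (simp add: content_period_box)
    qed
    then have "norm (?I - of_real ?w * c k $ i) \<le> 0 + e" if "e > 0" for e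
    proof -
      have w: "?w > 0" by simp
      show ?thesis using *[OF divide_pos_pos[OF that w]] w by simp
    qed
    then have "norm (?I - of_real ?w * c k $ i) \<le> 0" by (rule field_le_epsilon)
    then have "?I = of_real ?w * c k $ i" by simp
    then show ?thesis
      by (subst fourier_coeff_nth[OF contf]) (simp add: scaleR_conv_of_real)
  qed
  then show ?thesis by (simp add: vec_eq_iff)
qed

text \<open>The function and its Fourier series are both continuous and periodic and have the same
  coefficients, so uniqueness applies to their difference.\<close>

lemma fourier_inversion:
  fixes f :: "real^'n \<Rightarrow> complex^'n"
  assumes cont: "continuous_on UNIV f" and per: "\<And>x k. f (x + lattice_vec k) = f x"
    and bd: "wbd s (fourier_coeff f) M" "0 \<le> s"
  shows "f \<theta> = wser (fourier_coeff f) (cvec \<theta>)"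
proof -
  let ?g = "\<lambda>\<theta>. wser (fourier_coeff f) (cvec \<theta>)"
  have contg: "continuous_on UNIV ?g" by (rule wser_continuous_real[OF bd])
  have "(f \<theta> - ?g \<theta>) $ i = 0" for i
  proof (rule fourier_unique)
    show "continuous_on UNIV (\<lambda>\<theta>. (f \<theta> - ?g \<theta>) $ i)"
      by (intro continuous_intros cont contg)
    show "(f (x + lattice_vec k) - ?g (x + lattice_vec k)) $ i = (f x - ?g x) $ i" for x k
      by (simp add: per cvec_add wser_lattice)
    show "integral period_box (\<lambda>x. exp (\<i> * of_real (pairing k x)) * (f x - ?g x) $ i) = 0" for k
    proof -
      have int: "(\<lambda>x. exp (\<i> * of_real (pairing k x)) * h x $ i) integrable_on period_box"
        if "continuous_on UNIV h" for h :: "real^'n \<Rightarrow> complex^'n"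
        by (rule integrable_continuous, rule continuous_on_subset[of UNIV])
          (auto intro!: continuous_intros that)
      \<comment> \<open>The sign is reversed because \<open>fourier_unique\<close> tests against
        \<open>exp (\<i> * pairing)\<close>, whereas coefficients are formed with the conjugate
        exponential.\<close>
      have "fourier_coeff f (- k) $ i = fourier_coeff ?g (- k) $ i"
        by (simp add: fourier_coeff_wser[OF bd])
      then have "integral period_box (\<lambda>x. exp (\<i> * of_real (pairing k x)) * f x $ i)
        = integral period_box (\<lambda>x. exp (\<i> * of_real (pairing k x)) * ?g x $ i)"
        by (simp add: fourier_coeff_nth[OF cont] fourier_coeff_nth[OF contg] pairing_minus_left)
      then show ?thesis
        by (simp add: right_diff_distrib integral_diff int[OF cont] int[OF contg])
    qed
  qed
  then show ?thesis by (simp add: vec_eq_iff)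
qed

text \<open>The bridge between the extended nonnegative weighted norm of the statement and the real
  partial sums used in the estimates.\<close>

lemma wbd_iff_infsum:
  "wbd s c M \<longleftrightarrow> (\<Sum>\<^sub>\<infinity>k. ennreal (max_norm (c k) * exp (sum_norm k * s))) \<le> ennreal M \<and> 0 \<le> M"
proof -
  let ?g = "\<lambda>k. max_norm (c k) * exp (sum_norm k * s)"
  have "(\<Sum>\<^sub>\<infinity>k. ennreal (?g k)) \<le> ennreal M \<longleftrightarrow> (\<forall>K. finite K \<longrightarrow> (\<Sum>k\<in>K. ennreal (?g k)) \<le> ennreal M)"
    by (subst nonneg_infsum_complete) (auto simp: SUP_le_iff)
  moreover have "0 \<le> M \<Longrightarrow> (\<Sum>k\<in>K. ennreal (?g k)) \<le> ennreal M \<longleftrightarrow> sum ?g K \<le> M" for K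
    by (subst sum_ennreal) (auto simp: ennreal_le_iff)
  ultimately show ?thesis
    using wbd_nonneg[of s c M] unfolding wbd_def by (auto simp: mult.commute)
qed

lemma weighted_norm_leD:
  assumes "weighted_norm s W F \<le> ennreal M" "0 \<le> M" "\<omega> \<in> W"
  shows "wbd s (fourier_coeff (\<lambda>\<theta>. F \<theta> \<omega>)) M"
  using assms unfolding weighted_norm_def wbd_iff_infsum SUP_le_iff by blast

lemma weighted_norm_leI:
  assumes "\<And>\<omega>. \<omega> \<in> W \<Longrightarrow> wbd s (fourier_coeff (\<lambda>\<theta>. F \<theta> \<omega>)) M"
  shows "weighted_norm s W F \<le> ennreal M"
  using assms unfolding weighted_norm_def wbd_iff_infsum SUP_le_iff by blast

section \<open>Dependence on the parameter\<close>

text \<open>Joint continuity of the derivative is what differentiation under the integral sign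
  requires. \<open>F\<close> at two nearby parameters differs uniformly little on a disc, by
  compactness, and the Cauchy inequality carries this over to the derivatives.\<close>

lemma continuous_on_deriv_parametric:
  fixes F :: "complex \<Rightarrow> 'a::metric_space \<Rightarrow> complex"
  assumes U: "open U" and S: "compact S" and cont: "continuous_on (U \<times> S) (\<lambda>(z, t). F z t)"
    and hol: "\<And>t. t \<in> S \<Longrightarrow> (\<lambda>z. F z t) holomorphic_on U"
  shows "continuous_on (U \<times> S) (\<lambda>(z, t). deriv (\<lambda>z. F z t) z)"
  unfolding continuous_on_iff
proof (intro ballI allI impI)
  fix p and e :: real assume p: "p \<in> U \<times> S" and e: "e > 0"
  then obtain z0 t0 where p_eq: "p = (z0, t0)" and z0: "z0 \<in> U" and t0: "t0 \<in> S" by auto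
  obtain r0 where r0: "r0 > 0" "cball z0 r0 \<subseteq> U" using U z0 open_contains_cball by blast
  \<comment> \<open>Half the radius, so that the discs used around all nearby centres stay inside
    the one disc on which uniform continuity is known.\<close>
  define r where "r = r0 / 2"
  have r: "r > 0" using r0 by (simp add: r_def)
  have sub: "cball z r \<subseteq> cball z0 r0" if "dist z z0 < r" for z
  proof
    fix w assume "w \<in> cball z r"
    then have "dist z0 w \<le> r + r"
      using that dist_triangle[of z0 w z] by (simp add: dist_commute)
    then show "w \<in> cball z0 r0" by (simp add: r_def)
  qed
  have uc: "uniformly_continuous_on (cball z0 r0 \<times> S) (\<lambda>(z, t). F z t)"
    using r0(2) S by (intro compact_uniformly_continuous continuous_on_subset[OF cont] compact_Times) auto
  have "e * r / 4 > 0" using e r by simp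
  then obtain d1 where d1: "d1 > 0"
    "\<And>p q. p \<in> cball z0 r0 \<times> S \<Longrightarrow> q \<in> cball z0 r0 \<times> S \<Longrightarrow> dist q p < d1 \<Longrightarrow>
      dist (case q of (z, t) \<Rightarrow> F z t) (case p of (z, t) \<Rightarrow> F z t) < e * r / 4"
    using uc unfolding uniformly_continuous_on_def by meson
  have "continuous_on U (deriv (\<lambda>z. F z t0))"
    using holomorphic_deriv[OF hol[OF t0] U] holomorphic_on_imp_continuous_on by blast
  then obtain d2 where d2: "d2 > 0"
    "\<And>z. z \<in> U \<Longrightarrow> dist z z0 < d2 \<Longrightarrow> dist (deriv (\<lambda>z. F z t0) z) (deriv (\<lambda>z. F z t0) z0) < e / 2"
    using z0 half_gt_zero[OF e] unfolding continuous_on_iff by meson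
  show "\<exists>d>0. \<forall>x'\<in>U \<times> S. dist x' p < d \<longrightarrow>
      dist (case x' of (z, t) \<Rightarrow> deriv (\<lambda>z. F z t) z) (case p of (z, t) \<Rightarrow> deriv (\<lambda>z. F z t) z) < e"
  proof (intro exI[of _ "min r (min d1 d2)"] conjI ballI impI)
    fix x' assume "x' \<in> U \<times> S" and x': "dist x' p < min r (min d1 d2)"
    then obtain z t where zt: "x' = (z, t)" "z \<in> U" "t \<in> S" by auto
    have dz: "dist z z0 < r" "dist z z0 < d2" and dt: "dist t t0 < d1"
      using x' dist_fst_le[of x' "(z0, t0)"] dist_snd_le[of x' "(z0, t0)"] by (auto simp: zt p_eq)
    have zU: "cball z r \<subseteq> U" using sub[OF dz(1)] r0 by blast
    let ?g = "\<lambda>w. F w t - F w t0"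
    have holg: "?g holomorphic_on U" using hol zt t0 by (intro holomorphic_intros) auto
    have "norm ((deriv ^^ 1) ?g z) \<le> fact 1 * (e * r / 4) / r ^ 1"
    proof (rule Cauchy_inequality)
      show "?g holomorphic_on ball z r" using holg zU by (meson ball_subset_cball holomorphic_on_subset order_trans)
      show "continuous_on (cball z r) ?g"
        using holg zU holomorphic_on_imp_continuous_on holomorphic_on_subset by blast
      fix w assume "norm (z - w) = r"
      then have "w \<in> cball z0 r0" using sub[OF dz(1)] by (auto simp: dist_norm)
      then have "dist (F w t) (F w t0) < e * r / 4"
        using d1(2)[of "(w, t0)" "(w, t)"] zt t0 dt by (simp add: dist_Pair_Pair)
      then show "norm (F w t - F w t0) \<le> e * r / 4" by (simp add: dist_norm)
    qed (fact r)
    moreover have "deriv ?g z = deriv (\<lambda>z. F z t) z - deriv (\<lambda>z. F z t0) z"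
      using hol[OF zt(3)] hol[OF t0] U zt(2)
      by (intro deriv_diff) (auto simp: holomorphic_on_open field_differentiable_def)
    ultimately have "dist (deriv (\<lambda>z. F z t) z) (deriv (\<lambda>z. F z t0) z) \<le> e / 4"
      using r by (simp add: dist_norm)
    moreover have "dist (deriv (\<lambda>z. F z t0) z) (deriv (\<lambda>z. F z t0) z0) < e / 2"
      using d2 zt dz by auto
    ultimately have "dist (deriv (\<lambda>z. F z t) z) (deriv (\<lambda>z. F z t0) z0) < e"
      using dist_triangle[of "deriv (\<lambda>z. F z t) z" "deriv (\<lambda>z. F z t0) z0" "deriv (\<lambda>z. F z t0) z"] e
      by linarith
    then show "dist (case x' of (z, t) \<Rightarrow> deriv (\<lambda>z. F z t) z) (case p of (z, t) \<Rightarrow> deriv (\<lambda>z. F z t) z) < e"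
      by (simp add: zt p_eq)
  qed (use r d1 d2 in auto)
qed

lemma fourier_coeff_holomorphic:
  fixes g :: "complex \<Rightarrow> real^'n \<Rightarrow> complex^'n"
  assumes U: "open U" "convex U" and cont: "continuous_on (U \<times> UNIV) (\<lambda>(z, \<theta>). g z \<theta>)"
    and hol: "\<And>\<theta> i. (\<lambda>z. g z \<theta> $ i) holomorphic_on U"
  shows "(\<lambda>z. fourier_coeff (g z) k $ i) holomorphic_on U"
proof -
  let ?B = "period_box :: (real^'n) set"
  let ?F = "\<lambda>z \<theta>. exp (- \<i> * of_real (pairing k \<theta>)) * g z \<theta> $ i"
  have cz: "continuous_on UNIV (g z)" if "z \<in> U" for z
    by (rule continuous_on_compose2[OF cont, of _ "\<lambda>\<theta>. (z, \<theta>)", simplified])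
      (use that in \<open>auto intro!: continuous_intros\<close>)
  have contF: "continuous_on (U \<times> ?B) (\<lambda>(z, \<theta>). ?F z \<theta>)"
  proof -
    have "continuous_on (U \<times> ?B) (\<lambda>p. g (fst p) (snd p))"
      using continuous_on_subset[OF cont, of "U \<times> ?B"] by (auto simp: split_beta)
    then show ?thesis
      unfolding split_beta by (intro continuous_intros)
  qed
  have holF: "(\<lambda>z. ?F z \<theta>) holomorphic_on U" for \<theta>
    by (intro holomorphic_intros hol)
  have "(\<lambda>z. integral ?B (?F z)) holomorphic_on U"
  proof (rule leibniz_rule_holomorphic[where fx = "\<lambda>z \<theta>. deriv (\<lambda>z. ?F z \<theta>) z"])
    show "((\<lambda>z. ?F z \<theta>) has_field_derivative deriv (\<lambda>z. ?F z \<theta>) z) (at z within U)"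
      if "z \<in> U" for z \<theta>
      using holomorphic_derivI[OF holF U(1) that] by (rule has_field_derivative_at_within)
    show "?F z integrable_on ?B" if "z \<in> U" for z
      by (rule integrable_continuous, rule continuous_on_subset[of UNIV])
        (auto intro!: continuous_intros cz that)
    show "continuous_on (U \<times> ?B) (\<lambda>(z, \<theta>). deriv (\<lambda>z. ?F z \<theta>) z)"
      by (rule continuous_on_deriv_parametric[OF U(1) compact_cbox contF holF])
  qed (fact U)
  then have "(\<lambda>z. of_real (1 / (2 * pi) ^ CARD('n)) * integral ?B (?F z)) holomorphic_on U"
    by (intro holomorphic_intros)
  then show ?thesis
    by (rule holomorphic_transform) (simp only: fourier_coeff_nth[OF cz] scaleR_conv_of_real)
qed

text \<open>The Cauchy estimate for the weighted norm: it is applied to a scalar combination of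
  finitely many coefficients that realises the norm of the difference.\<close>

lemma fourier_coeff_lipschitz:
  fixes g :: "complex \<Rightarrow> real^'n \<Rightarrow> complex^'n"
  assumes U: "open U" "convex U" and cont: "continuous_on (U \<times> UNIV) (\<lambda>(z, \<theta>). g z \<theta>)"
    and hol: "\<And>\<theta> i. (\<lambda>z. g z \<theta> $ i) holomorphic_on U"
    and R: "R > 0" "\<And>z. z \<in> closed_segment 0 1 \<Longrightarrow> cball z R \<subseteq> U"
    and bd: "\<And>z. z \<in> U \<Longrightarrow> wbd s (fourier_coeff (g z)) M"
  shows "wbd s (\<lambda>k. fourier_coeff (g 1) k - fourier_coeff (g 0) k) (M / R)"
  unfolding wbd_def
proof safe
  fix K :: "(int^'n) set" assume K: "finite K"
  let ?d = "\<lambda>k. fourier_coeff (g 1) k - fourier_coeff (g 0) k"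
  have "\<forall>k. \<exists>i. max_norm (?d k) = norm (?d k $ i)" using max_norm_attained by metis
  then obtain i where i: "\<And>k. max_norm (?d k) = norm (?d k $ i k)" by metis
  define u where "u k = cnj (sgn (?d k $ i k))" for k
  have u: "norm (u k) \<le> 1" for k by (simp add: u_def norm_sgn)
  have ud: "u k * ?d k $ i k = of_real (max_norm (?d k))" for k
  proof -
    have "cnj (sgn w) * w = of_real (norm w)" for w :: complex
      using complex_norm_square[of w] by (cases "w = 0") (simp_all add: sgn_eq power2_eq_square field_simps)
    then show ?thesis by (simp only: u_def i)
  qed
  define G where "G z = (\<Sum>k\<in>K. of_real (exp (s * sum_norm k)) * (u k * fourier_coeff (g z) k $ i k))" for z
  have holG: "G holomorphic_on U"
    unfolding G_def by (intro holomorphic_intros fourier_coeff_holomorphic U cont hol)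
  have normG: "norm (G z) \<le> M" if "z \<in> U" for z
  proof -
    have "norm (G z) \<le> (\<Sum>k\<in>K. max_norm (fourier_coeff (g z) k) * exp (s * sum_norm k))"
      unfolding G_def
    proof (intro order_trans[OF norm_sum] sum_mono)
      fix k
      have "norm (u k) * norm (fourier_coeff (g z) k $ i k) \<le> 1 * max_norm (fourier_coeff (g z) k)"
        by (intro mult_mono u norm_nth_le_max_norm) auto
      then show "norm (of_real (exp (s * sum_norm k)) * (u k * fourier_coeff (g z) k $ i k))
        \<le> max_norm (fourier_coeff (g z) k) * exp (s * sum_norm k)"
        by (simp add: norm_mult mult.commute)
    qed
    then show ?thesis using wbdD[OF bd[OF that] K] by linarith
  qed
  have "norm (G 1 - G 0) \<le> M / R * norm (1 - 0 :: complex)"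
  proof (rule field_differentiable_bound)
    show "convex (closed_segment (0::complex) 1)" by (rule convex_closed_segment)
    fix z :: complex assume z: "z \<in> closed_segment 0 1"
    have zU: "cball z R \<subseteq> U" by (rule R(2)[OF z])
    then have zin: "z \<in> U" using R(1) by auto
    show "(G has_field_derivative deriv G z) (at z within closed_segment 0 1)"
      using holomorphic_derivI[OF holG U(1) zin] by (rule has_field_derivative_at_within)
    have "norm ((deriv ^^ 1) G z) \<le> fact 1 * M / R ^ 1"
    proof (rule Cauchy_inequality)
      show "G holomorphic_on ball z R"
        using holG zU by (meson ball_subset_cball holomorphic_on_subset order_trans)
      show "continuous_on (cball z R) G"
        using holG zU holomorphic_on_imp_continuous_on holomorphic_on_subset by blast
      show "norm (G w) \<le> M" if "norm (z - w) = R" for w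
        using zU that by (intro normG) (auto simp: dist_norm)
    qed (fact R)
    then show "norm (deriv G z) \<le> M / R" by simp
  qed auto
  moreover have "G 1 - G 0 = of_real (\<Sum>k\<in>K. max_norm (?d k) * exp (s * sum_norm k))"
  proof -
    have "G 1 - G 0 = (\<Sum>k\<in>K. of_real (exp (s * sum_norm k)) * (u k * ?d k $ i k))"
      unfolding G_def sum_subtractf[symmetric] by (intro sum.cong) (simp_all add: algebra_simps)
    then show ?thesis unfolding ud by (simp add: mult.commute)
  qed
  moreover have "(\<Sum>k\<in>K. max_norm (?d k) * exp (s * sum_norm k)) \<ge> 0" by (intro sum_nonneg) auto
  ultimately show "(\<Sum>k\<in>K. max_norm (?d k) * exp (s * sum_norm k)) \<le> M / R"
    by (simp del: of_real_sum)
qed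

section \<open>The perturbation as a parametrised family of exponential series\<close>

lemma cvec_in_strip: "0 < s \<Longrightarrow> cvec \<theta> \<in> strip s"
  by (simp add: strip_def)

context
  fixes s h \<epsilon> :: real and W :: "(complex^'n) set" and P :: "complex^'n \<Rightarrow> complex^'n \<Rightarrow> complex^'n"
    and \<omega> :: "real^'n"
  assumes s: "s > 0" and ball: "\<And>\<mu>. max_norm (\<mu> - cvec \<omega>) < h \<Longrightarrow> \<mu> \<in> W"
    and fam: "real_analytic_family s W (\<lambda>\<theta> \<omega>. \<omega> + P \<theta> \<omega>)"
    and \<epsilon>: "\<epsilon> \<ge> 0" and norm: "weighted_norm s W (\<lambda>\<theta> \<omega>. P (cvec \<theta>) \<omega>) \<le> ennreal \<epsilon>"
begin

lemma family_has_derivative: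
  assumes "\<mu> \<in> W"
  shows "\<exists>(A :: complex^'n^'n) (B :: complex^'n^'n).
    ((\<lambda>(\<theta>, \<omega>). \<omega> + P \<theta> \<omega>) has_derivative (\<lambda>(u, v). A *v u + B *v v)) (at (cvec \<theta>, \<mu>))"
proof -
  have "\<forall>z\<in>strip s \<times> W. \<exists>(A :: complex^'n^'n) (B :: complex^'n^'n).
    ((\<lambda>(\<theta>, \<omega>). \<omega> + P \<theta> \<omega>) has_derivative (\<lambda>(u, v). A *v u + B *v v)) (at z)"
    using fam unfolding real_analytic_family_def holo_vec2_on_def by (elim conjE)
  then show ?thesis by (rule bspec) (simp add: assms cvec_in_strip[OF s])
qed

lemma perturbation_continuous:
  "continuous_on (UNIV \<times> W) (\<lambda>(\<theta>, \<mu>). P (cvec \<theta>) \<mu>)"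
proof -
  have "continuous (at (cvec \<theta>, \<mu>)) (\<lambda>(\<theta>, \<omega>). \<omega> + P \<theta> \<omega>)" if "\<mu> \<in> W" for \<theta> :: "real^'n" and \<mu>
    using family_has_derivative[OF that] has_derivative_continuous by blast
  then have "continuous_on (range cvec \<times> W) (\<lambda>(\<theta>, \<omega>). \<omega> + P \<theta> \<omega>)"
    by (auto intro!: continuous_at_imp_continuous_on)
  then have "continuous_on (UNIV \<times> W) (\<lambda>p. (\<lambda>(\<theta>, \<omega>). \<omega> + P \<theta> \<omega>) (cvec (fst p), snd p))"
    by (rule continuous_on_compose2) (auto intro!: continuous_intros)
  then have "continuous_on (UNIV \<times> W) (\<lambda>p. snd p + P (cvec (fst p)) (snd p))"
    by (simp add: split_beta)
  from continuous_on_diff[OF this continuous_on_snd[OF continuous_on_id]]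
  show ?thesis by (simp add: split_beta)
qed

lemma perturbation_continuous1:
  assumes "\<mu> \<in> W" shows "continuous_on UNIV (\<lambda>\<theta>. P (cvec \<theta>) \<mu>)"
  by (rule continuous_on_compose2[OF perturbation_continuous, of _ "\<lambda>\<theta>. (\<theta>, \<mu>)", simplified])
    (use assms in \<open>auto intro!: continuous_intros\<close>)

abbreviation (input) pcoeff :: "complex^'n \<Rightarrow> int^'n \<Rightarrow> complex^'n" where
  "pcoeff \<mu> \<equiv> fourier_coeff (\<lambda>\<theta>. P (cvec \<theta>) \<mu>)"

lemma perturbation_wbd: "\<mu> \<in> W \<Longrightarrow> wbd s (pcoeff \<mu>) \<epsilon>"
  using weighted_norm_leD[OF norm \<epsilon>] by simp

text \<open>From here on the perturbation is handled through its coefficients. Its periodicity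
  follows from that of the whole vector field because the constant part does not depend on the
  angle.\<close>

lemma perturbation_series:
  assumes "\<mu> \<in> W" shows "P (cvec \<theta>) \<mu> = wser (pcoeff \<mu>) (cvec \<theta>)"
proof (rule fourier_inversion[OF perturbation_continuous1[OF assms] _ perturbation_wbd[OF assms]])
  show "P (cvec (\<theta> + lattice_vec k)) \<mu> = P (cvec \<theta>) \<mu>" for \<theta> k
  proof -
    have "\<forall>\<theta>\<in>strip s. \<forall>\<omega>\<in>W. \<forall>k. \<omega> + P (\<theta> + cvec (lattice_vec k)) \<omega> = \<omega> + P \<theta> \<omega>"
      using fam unfolding real_analytic_family_def by (elim conjE)
    then have "\<mu> + P (cvec \<theta> + cvec (lattice_vec k)) \<mu> = \<mu> + P (cvec \<theta>) \<mu>"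
      using assms cvec_in_strip[OF s] by blast
    then show ?thesis by (simp add: cvec_add)
  qed
qed (use s in simp)

lemma perturbation_real:
  assumes "cvec \<mu> \<in> W" shows "P (cvec \<theta>) (cvec \<mu>) \<in> range cvec"
proof -
  have "cvec \<mu> + P (cvec \<theta>) (cvec \<mu>) \<in> range cvec"
  proof -
    have "\<forall>\<theta> \<omega>. cvec \<theta> \<in> strip s \<and> cvec \<omega> \<in> W \<longrightarrow> cvec \<omega> + P (cvec \<theta>) (cvec \<omega>) \<in> range cvec"
      using fam unfolding real_analytic_family_def by (elim conjE)
    then show ?thesis using assms cvec_in_strip[OF s] by blast
  qed
  then obtain x where "cvec \<mu> + P (cvec \<theta>) (cvec \<mu>) = cvec x" by auto
  then have "P (cvec \<theta>) (cvec \<mu>) = cvec (x - \<mu>)" by (simp add: cvec_diff eq_diff_eq add.commute)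
  then show ?thesis by simp
qed

text \<open>Both parameters are joined by a complex line. Around each point of the real segment
  there is room \<open>3 * h / 4\<close>, since \<open>h / 8 + 3 * h / 4 < h\<close>. The Cauchy
  estimate then gives \<open>\<epsilon> / (3 * h / 4) \<le> 1 / 12\<close> per unit of parameter
  distance.\<close>

lemma perturbation_lipschitz:
  assumes \<mu>: "max_norm (\<mu>0 - \<omega>) \<le> h / 8" "max_norm (\<mu>1 - \<omega>) \<le> h / 8" and \<epsilon>h: "\<epsilon> \<le> h / 16" and h: "h > 0"
  shows "wbd s (\<lambda>k. pcoeff (cvec \<mu>1) k - pcoeff (cvec \<mu>0) k) (max_norm (\<mu>1 - \<mu>0) / 12)"
proof (cases "\<mu>0 = \<mu>1")
  case True
  then show ?thesis by (simp add: wbd_def)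
next
  case False
  define d where "d = max_norm (\<mu>1 - \<mu>0)"
  have d: "d > 0" using False max_norm_nonneg[of "\<mu>1 - \<mu>0"] by (simp add: d_def less_le)
  define v where "v = cvec (\<mu>1 - \<mu>0)"
  define m where "m z = cvec \<mu>0 + z *s v" for z
  have m01: "m 0 = cvec \<mu>0" "m 1 = cvec \<mu>1" by (auto simp: m_def v_def cvec_diff)
  have m_aff: "m (z + w) = m z + w *s v" for z w by (simp add: m_def vec_eq_iff algebra_simps)
  have contm: "continuous_on S m" for S
    unfolding m_def by (intro continuous_intros bounded_linear.continuous_on[OF bounded_linear_smult_left])
  define U where "U = {z. max_norm (m z - cvec \<omega>) < h}"
  define R where "R = 3 * h / 4 / d"
  have mW: "m z \<in> W" if "z \<in> U" for z using that ball by (simp add: U_def)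
  have oU: "open U"
    unfolding U_def by (intro open_Collect_less continuous_intros contm)
  have mconv: "max_norm (m (a *\<^sub>R x + b *\<^sub>R y) - cvec \<omega>) \<le> a * max_norm (m x - cvec \<omega>) + b * max_norm (m y - cvec \<omega>)"
    if "a \<ge> 0" "b \<ge> 0" "a + b = 1" for a b x y
  proof -
    have "m (a *\<^sub>R x + b *\<^sub>R y) - cvec \<omega> = a *\<^sub>R (m x - cvec \<omega>) + b *\<^sub>R (m y - cvec \<omega>)"
    proof -
      have b: "b = 1 - a" using that by simp
      show ?thesis unfolding b
        by (simp add: m_def vec_eq_iff scaleR_conv_of_real[where 'a = complex] algebra_simps)
    qed
    then show ?thesis using max_norm_add[of "a *\<^sub>R (m x - cvec \<omega>)" "b *\<^sub>R (m y - cvec \<omega>)"] that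
      by (simp add: max_norm_scaleR)
  qed
  have cU: "convex U"
  proof (rule convexI)
    fix x y and a b :: real assume xy: "x \<in> U" "y \<in> U" and ab: "0 \<le> a" "0 \<le> b" "a + b = 1"
    have "a * max_norm (m x - cvec \<omega>) + b * max_norm (m y - cvec \<omega>) < h"
      using xy ab by (intro convex_bound_lt) (auto simp: U_def)
    then show "a *\<^sub>R x + b *\<^sub>R y \<in> U" using mconv[OF ab, of x y] by (simp add: U_def)
  qed
  have end8: "max_norm (m 0 - cvec \<omega>) \<le> h / 8" "max_norm (m 1 - cvec \<omega>) \<le> h / 8"
    using \<mu> by (simp_all add: m01 cvec_diff[symmetric])
  have "wbd s (\<lambda>k. pcoeff (m 1) k - pcoeff (m 0) k) (\<epsilon> / R)"
  proof (rule fourier_coeff_lipschitz[OF oU cU])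
    show "R > 0" using h d by (simp add: R_def)
    show "cball z R \<subseteq> U" if z: "z \<in> closed_segment 0 1" for z
    proof
      fix w assume w: "w \<in> cball z R"
      obtain u where u: "0 \<le> u" "u \<le> 1" "z = (1 - u) *\<^sub>R 0 + u *\<^sub>R 1"
        using z by (auto simp: closed_segment_def)
      have "max_norm (m z - cvec \<omega>) \<le> (1 - u) * max_norm (m 0 - cvec \<omega>) + u * max_norm (m 1 - cvec \<omega>)"
        unfolding u(3) using u by (intro mconv) auto
      also have "\<dots> \<le> h / 8" using u end8 by (intro convex_bound_le) auto
      finally have 1: "max_norm (m z - cvec \<omega>) \<le> h / 8" .
      have "norm (w - z) * d \<le> R * d"
        using w d by (intro mult_right_mono) (auto simp: dist_norm norm_minus_commute)
      then have 2: "max_norm ((w - z) *s v) \<le> 3 * h / 4"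
        using d unfolding max_norm_smult v_def max_norm_cvec d_def[symmetric] by (simp add: R_def)
      have mw: "m w - cvec \<omega> = (m z - cvec \<omega>) + (w - z) *s v" using m_aff[of z "w - z"] by simp
      have "max_norm (m w - cvec \<omega>) \<le> h / 8 + 3 * h / 4"
        unfolding mw using max_norm_add[of "m z - cvec \<omega>" "(w - z) *s v"] 1 2 by linarith
      then show "w \<in> U" using h by (simp add: U_def)
    qed
    show "continuous_on (U \<times> UNIV) (\<lambda>(z, \<theta>). P (cvec \<theta>) (m z))"
      unfolding split_beta
      by (rule continuous_on_compose2[OF perturbation_continuous, of _ "\<lambda>p. (snd p, m (fst p))", simplified split_beta fst_conv snd_conv])
        (auto intro!: continuous_intros continuous_on_compose2[OF contm[of UNIV]] mW)
    show "(\<lambda>z. P (cvec \<theta>) (m z) $ i) holomorphic_on U" for \<theta> i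
      unfolding holomorphic_on_open[OF oU]
    proof (intro ballI)
      fix z assume z: "z \<in> U"
      obtain A B :: "complex^'n^'n" where AB:
        "((\<lambda>(\<theta>, \<omega>). \<omega> + P \<theta> \<omega>) has_derivative (\<lambda>(u, v). A *v u + B *v v)) (at (cvec \<theta>, m z))"
        using family_has_derivative[OF mW[OF z]] by blast
      have dm: "(m has_derivative (\<lambda>w. w *s v)) (at z)"
        unfolding m_def
        by (auto intro!: derivative_eq_intros bounded_linear.has_derivative[OF bounded_linear_smult_left])
      then have "((\<lambda>z. (cvec \<theta>, m z)) has_derivative (\<lambda>w. (0, w *s v))) (at z)"
        by (intro has_derivative_Pair has_derivative_const)
      from has_derivative_compose[OF this AB]
      have "((\<lambda>z. m z + P (cvec \<theta>) (m z)) has_derivative (\<lambda>w. B *v (w *s v))) (at z)"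
        by simp
      from has_derivative_diff[OF this dm]
      have "((\<lambda>z. P (cvec \<theta>) (m z)) has_derivative (\<lambda>w. B *v (w *s v) - w *s v)) (at z)" by simp
      from bounded_linear.has_derivative[OF bounded_linear_vec_nth this, of i]
      have D: "((\<lambda>z. P (cvec \<theta>) (m z) $ i) has_derivative (\<lambda>w. (B *v (w *s v) - w *s v) $ i)) (at z)" .
      \<comment> \<open>Complex linearity of the Jacobian turns the total derivative along the line
        into multiplication by one complex number, that is, into a complex derivative.\<close>
      have eq: "(\<lambda>w. (B *v (w *s v) - w *s v) $ i) = (*) ((B *v v - v) $ i)"
        unfolding vector_scalar_commute by (rule ext) (simp add: algebra_simps)
      show "\<exists>f'. ((\<lambda>z. P (cvec \<theta>) (m z) $ i) has_field_derivative f') (at z)"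
        unfolding has_field_derivative_def using D unfolding eq by (rule exI)
    qed
    show "wbd s (pcoeff (m z)) \<epsilon>" if "z \<in> U" for z by (rule perturbation_wbd[OF mW[OF that]])
  qed
  then have "wbd s (\<lambda>k. pcoeff (m 1) k - pcoeff (m 0) k) (max_norm (\<mu>1 - \<mu>0) / 12)"
  proof (rule wbd_mono[OF _ order_refl _ order_refl])
    have "\<epsilon> / R \<le> (h / 16) / R" using \<epsilon>h h d by (intro divide_right_mono) (auto simp: R_def)
    also have "\<dots> = d / 12" using h d by (simp add: R_def)
    finally show "\<epsilon> / R \<le> max_norm (\<mu>1 - \<mu>0) / 12" by (simp add: d_def)
  qed
  then show ?thesis unfolding m01 .
qed

end

section \<open>Approximation functions\<close>

lemma has_integral_inverse_square:
  fixes a :: real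
  assumes "a > 0"
  shows "a \<le> b \<Longrightarrow> ((\<lambda>t. 1 / t\<^sup>2) has_integral (1 / a - 1 / b)) {a..b}"
    and "((\<lambda>t. 1 / t\<^sup>2) has_integral (1 / a)) {a..}"
proof -
  have *: "((\<lambda>t. 1 / t\<^sup>2) has_integral (1 / a - 1 / b)) {a..b}" if "a \<le> b" for b
  proof -
    have "((\<lambda>t. 1 / t\<^sup>2) has_integral (- (1 / b) - - (1 / a))) {a..b}"
    proof (rule fundamental_theorem_of_calculus[OF that])
      show "((\<lambda>t. - (1 / t)) has_vector_derivative 1 / x\<^sup>2) (at x within {a..b})" if "x \<in> {a..b}" for x
        using that assms
        by (auto simp: has_real_derivative_iff_has_vector_derivative[symmetric] power2_eq_square
            intro!: derivative_eq_intros)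
    qed
    then show ?thesis by simp
  qed
  then show "a \<le> b \<Longrightarrow> ((\<lambda>t. 1 / t\<^sup>2) has_integral (1 / a - 1 / b)) {a..b}" .
  show "((\<lambda>t. 1 / t\<^sup>2) has_integral (1 / a)) {a..}"
  proof (rule has_integral_to_inf)
    show "(\<lambda>t. 1 / t\<^sup>2) integrable_on {a..y}" for y
      using * by (cases "a \<le> y") (auto simp: integrable_on_def)
    have "((\<lambda>y. 1 / a - 1 / y) \<longlongrightarrow> 1 / a - 0) at_top"
      by (intro tendsto_intros tendsto_divide_0[OF tendsto_const] filterlim_at_top_imp_at_infinity filterlim_ident)
    then have lim: "((\<lambda>y. 1 / a - 1 / y) \<longlongrightarrow> 1 / a) at_top" by simp
    show "((\<lambda>y. integral {a..y} (\<lambda>t. 1 / t\<^sup>2)) \<longlongrightarrow> 1 / a) at_top"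
      by (rule Lim_transform_eventually[OF lim])
        (use * in \<open>auto intro!: eventually_mono[OF eventually_ge_at_top[of a]] integral_unique[symmetric]\<close>)
  qed simp
qed

lemma has_integral_ln_over_square:
  fixes a :: real
  assumes "a \<ge> 1"
  shows "((\<lambda>t. ln t / t\<^sup>2) has_integral ((ln a + 1) / a)) {a..}"
proof (rule has_integral_to_inf)
  have *: "((\<lambda>t. ln t / t\<^sup>2) has_integral ((ln a + 1) / a - (ln b + 1) / b)) {a..b}" if "a \<le> b" for b
  proof -
    have "((\<lambda>t. ln t / t\<^sup>2) has_integral (- ((ln b + 1) / b) - - ((ln a + 1) / a))) {a..b}"
    proof (rule fundamental_theorem_of_calculus[OF that])
      show "((\<lambda>t. - ((ln t + 1) / t)) has_vector_derivative ln x / x\<^sup>2) (at x within {a..b})" if "x \<in> {a..b}" for x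
        using that assms
        by (auto simp: has_real_derivative_iff_has_vector_derivative[symmetric] power2_eq_square
            intro!: derivative_eq_intros)
    qed
    then show ?thesis by simp
  qed
  show "(\<lambda>t. ln t / t\<^sup>2) integrable_on {a..y}" for y
    using * by (cases "a \<le> y") (auto simp: integrable_on_def)
  have "((\<lambda>y::real. ln y / y + 1 / y) \<longlongrightarrow> 0 + 0) at_top"
    by (intro tendsto_add ln_x_over_x_tendsto_0 tendsto_divide_0[OF tendsto_const]
        filterlim_at_top_imp_at_infinity filterlim_ident)
  then have "((\<lambda>y::real. (ln y + 1) / y) \<longlongrightarrow> 0) at_top" by (simp add: add_divide_distrib)
  then have "((\<lambda>y. (ln a + 1) / a - (ln y + 1) / y) \<longlongrightarrow> (ln a + 1) / a - 0) at_top"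
    by (intro tendsto_intros)
  then have lim: "((\<lambda>y. (ln a + 1) / a - (ln y + 1) / y) \<longlongrightarrow> (ln a + 1) / a) at_top" by simp
  show "((\<lambda>y. integral {a..y} (\<lambda>t. ln t / t\<^sup>2)) \<longlongrightarrow> (ln a + 1) / a) at_top"
    by (rule Lim_transform_eventually[OF lim])
      (use * in \<open>auto intro!: eventually_mono[OF eventually_ge_at_top[of a]] integral_unique[symmetric]\<close>)
  show "ln t / t\<^sup>2 \<ge> 0" if "t \<ge> a" for t using that assms by simp
qed

context
  fixes \<Delta> :: "real \<Rightarrow> real"
  assumes \<Delta>: "ruessmann \<Delta>"
begin

lemma ruessmann_ge_1: "t \<ge> 1 \<Longrightarrow> \<Delta> t \<ge> 1"
  using \<Delta> unfolding ruessmann_def by auto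

lemma ruessmann_mono: "1 \<le> t \<Longrightarrow> t \<le> u \<Longrightarrow> \<Delta> t \<le> \<Delta> u"
  using \<Delta> unfolding ruessmann_def by (auto intro: mono_onD)

lemma Lam_ge: "t \<ge> 1 \<Longrightarrow> t \<le> Lam \<Delta> t"
  using ruessmann_ge_1[of t] mult_left_mono[of 1 "\<Delta> t" t] by (simp add: Lam_def)

lemma Lam_ge_1: "t \<ge> 1 \<Longrightarrow> 1 \<le> Lam \<Delta> t"
  using Lam_ge[of t] by simp

lemma Delta_le_Lam: "t \<ge> 1 \<Longrightarrow> \<Delta> t \<le> Lam \<Delta> t"
  using ruessmann_ge_1[of t] mult_right_mono[of 1 t "\<Delta> t"] by (simp add: Lam_def)

lemma Lam_mono: "1 \<le> t \<Longrightarrow> t \<le> u \<Longrightarrow> Lam \<Delta> t \<le> Lam \<Delta> u"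
  unfolding Lam_def using ruessmann_ge_1[of t] by (intro mult_mono ruessmann_mono) auto

text \<open>The intermediate value theorem on \<open>{1..y}\<close>, as
  \<open>Lam \<Delta> 1 = 1\<close> and \<open>Lam \<Delta> y \<ge> y\<close>. It allows cut-offs at
  which \<open>Lam \<Delta>\<close> is exactly doubled.\<close>

lemma Lam_surj:
  assumes "y \<ge> 1"
  shows "\<exists>t\<ge>1. Lam \<Delta> t = y"
proof -
  have "\<exists>t. 1 \<le> t \<and> t \<le> y \<and> Lam \<Delta> t = y"
  proof (rule IVT')
    show "Lam \<Delta> 1 \<le> y" using \<Delta> assms by (simp add: Lam_def ruessmann_def)
    show "y \<le> Lam \<Delta> y" using assms by (rule Lam_ge)
    show "continuous_on {1..y} (Lam \<Delta>)"
      unfolding Lam_def using \<Delta> unfolding ruessmann_def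
      by (intro continuous_intros) (auto intro: continuous_on_subset)
  qed (fact assms)
  then show ?thesis by blast
qed

abbreviation (input) "lint a \<equiv> integral {a..} (\<lambda>t. ln (Lam \<Delta> t) / t\<^sup>2)"

lemma ln_Lam_integrable:
  assumes "a \<ge> 1"
  shows "(\<lambda>t. ln (Lam \<Delta> t) / t\<^sup>2) integrable_on {a..}"
proof -
  have "(\<lambda>t. ln t / t\<^sup>2) integrable_on {1::real..}"
    unfolding integrable_on_def using has_integral_ln_over_square[OF order_refl] by blast
  moreover have "(\<lambda>t. ln (\<Delta> t) / t\<^sup>2) integrable_on {1..}"
    using \<Delta> unfolding ruessmann_def by (elim conjE)
  ultimately have "(\<lambda>t. ln t / t\<^sup>2 + ln (\<Delta> t) / t\<^sup>2) integrable_on {1..}"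
    by (rule integrable_add)
  moreover have "ln t / t\<^sup>2 + ln (\<Delta> t) / t\<^sup>2 = ln (Lam \<Delta> t) / t\<^sup>2" if "t \<in> {1..}" for t
    using that ruessmann_ge_1[of t] by (simp add: Lam_def ln_mult add_divide_distrib)
  ultimately have i1: "(\<lambda>t. ln (Lam \<Delta> t) / t\<^sup>2) integrable_on {1..}"
    by (rule integrable_eq) simp_all
  then have "(\<lambda>t. ln (Lam \<Delta> t) / t\<^sup>2) absolutely_integrable_on {1..}"
    using Lam_ge_1 by (intro nonnegative_absolutely_integrable_1) auto
  then have "(\<lambda>t. ln (Lam \<Delta> t) / t\<^sup>2) absolutely_integrable_on {a..}"
    by (rule set_integrable_subset) (use assms in auto)
  then show ?thesis by (rule set_lebesgue_integral_eq_integral(1))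
qed

lemma lint_nonneg: "a \<ge> 1 \<Longrightarrow> 0 \<le> lint a"
  using Lam_ge_1 by (intro integral_nonneg ln_Lam_integrable) auto

lemma lint_ge_ln_Lam: "a \<ge> 1 \<Longrightarrow> ln (Lam \<Delta> a) / a \<le> lint a"
proof -
  assume a: "a \<ge> 1"
  have "((\<lambda>t. ln (Lam \<Delta> a) * (1 / t\<^sup>2)) has_integral (ln (Lam \<Delta> a) * (1 / a))) {a..}"
    using a by (intro has_integral_mult_right has_integral_inverse_square(2)) simp
  then have "ln (Lam \<Delta> a) * (1 / a) \<le> lint a"
  proof (rule has_integral_le[OF _ integrable_integral[OF ln_Lam_integrable[OF a]]])
    show "ln (Lam \<Delta> a) * (1 / t\<^sup>2) \<le> ln (Lam \<Delta> t) / t\<^sup>2" if "t \<in> {a..}" for t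
      using that a Lam_mono[of a t] Lam_ge_1[of a] by (simp add: divide_right_mono)
  qed
  then show ?thesis by simp
qed

text \<open>Comparing with \<open>ln t\<close> instead of the constant
  \<open>ln (Lam \<Delta> a)\<close> keeps a positive bound even at \<open>a = 1\<close>, where that
  constant is 0. The loss of width at the first cut-off is paid from here.\<close>

lemma lint_ge_inverse:
  assumes a: "a \<ge> 1" shows "1 / a \<le> lint a"
proof -
  have "(ln a + 1) / a \<le> lint a"
  proof (rule has_integral_le[OF has_integral_ln_over_square[OF a] integrable_integral[OF ln_Lam_integrable[OF a]]])
    show "ln t / t\<^sup>2 \<le> ln (Lam \<Delta> t) / t\<^sup>2" if "t \<in> {a..}" for t
      using that a Lam_ge[of t] Lam_ge_1[of t] by (intro divide_right_mono) auto
  qed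
  moreover have "1 / a \<le> (ln a + 1) / a" using a by (intro divide_right_mono) auto
  ultimately show ?thesis by linarith
qed

text \<open>One rectangle of the lower sum: the integrand is bounded below on \<open>{a..b}\<close>
  by its numerator at the left end.\<close>

lemma lint_split:
  assumes a: "1 \<le> a" "a \<le> b"
  shows "ln (Lam \<Delta> a) * (1 / a - 1 / b) + lint b \<le> lint a"
proof -
  let ?f = "\<lambda>t. ln (Lam \<Delta> t) / t\<^sup>2"
  have ia: "?f integrable_on {a..}" and ib: "?f integrable_on {b..}"
    using a by (auto intro: ln_Lam_integrable)
  have iab: "?f integrable_on {a..b}"
    by (rule integrable_on_subinterval[OF ia]) auto
  have "((\<lambda>t. ln (Lam \<Delta> a) * (1 / t\<^sup>2)) has_integral (ln (Lam \<Delta> a) * (1 / a - 1 / b))) {a..b}"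
    using a by (intro has_integral_mult_right has_integral_inverse_square(1)) auto
  then have "ln (Lam \<Delta> a) * (1 / a - 1 / b) \<le> integral {a..b} ?f"
  proof (rule has_integral_le[OF _ integrable_integral[OF iab]])
    show "ln (Lam \<Delta> a) * (1 / t\<^sup>2) \<le> ln (Lam \<Delta> t) / t\<^sup>2" if "t \<in> {a..b}" for t
      using that a Lam_mono[of a t] Lam_ge_1[of a] by (simp add: divide_right_mono)
  qed
  moreover have "integral ({a..b} \<union> {b..}) ?f = integral {a..b} ?f + integral {b..} ?f"
  proof (rule integral_Un[OF iab ib])
    have "{a..b} \<inter> {b..} = {b}" using a by auto
    then show "negligible ({a..b} \<inter> {b..})" by simp
  qed
  moreover have "{a..b} \<union> {b..} = {a..}" using a by auto
  ultimately show ?thesis by simp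
qed

text \<open>The cut-offs of the iteration double \<open>\<Lambda>\<close> in every step. Abel summation turns the sum of
  their inverses into a lower sum of the integral of \<open>ln \<Lambda> / t\<^sup>2\<close>.\<close>

lemma cutoffs_exist:
  assumes \<tau>: "\<tau> \<ge> 1"
  obtains T :: "nat \<Rightarrow> real" where "T 0 = \<tau>" "\<And>\<nu>. T \<nu> \<ge> 1" "\<And>\<nu>. Lam \<Delta> (T \<nu>) = 2 ^ \<nu> * Lam \<Delta> \<tau>"
    "\<And>m. (\<Sum>\<nu><m. 3 / T \<nu>) \<le> 8 * lint \<tau>"
proof -
  have "\<exists>t\<ge>1. Lam \<Delta> t = 2 ^ \<nu> * Lam \<Delta> \<tau>" for \<nu> :: nat
    using Lam_ge_1[OF \<tau>] mult_mono[of 1 "2 ^ \<nu> :: real" 1 "Lam \<Delta> \<tau>"] by (intro Lam_surj) simp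
  then obtain T0 where T0: "\<And>\<nu> :: nat. T0 \<nu> \<ge> 1" "\<And>\<nu>. Lam \<Delta> (T0 \<nu>) = 2 ^ \<nu> * Lam \<Delta> \<tau>" by metis
  \<comment> \<open>The first cut-off is set to \<open>\<tau>\<close> outright instead of to some
    preimage of \<open>Lam \<Delta> \<tau>\<close>.\<close>
  define T where "T \<nu> = (if \<nu> = 0 then \<tau> else T0 \<nu>)" for \<nu>
  have T: "T \<nu> \<ge> 1" "Lam \<Delta> (T \<nu>) = 2 ^ \<nu> * Lam \<Delta> \<tau>" for \<nu>
    using T0 \<tau> by (auto simp: T_def)
  have le: "T \<nu> \<le> T (Suc \<nu>)" for \<nu>
  proof (rule ccontr)
    assume "\<not> T \<nu> \<le> T (Suc \<nu>)"
    then have "Lam \<Delta> (T (Suc \<nu>)) \<le> Lam \<Delta> (T \<nu>)" using T by (intro Lam_mono) auto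
    then show False unfolding T using Lam_ge_1[OF \<tau>] by (simp add: not_le)
  qed
  \<comment> \<open>The term \<open>ln (Lam \<Delta> (T \<nu>)) / T \<nu>\<close> is the boundary
    term of the Abel summation. Passing to the next cut-off raises the logarithm by
    \<open>ln 2\<close>, which releases one summand.\<close>
  have step: "ln (Lam \<Delta> (T \<nu>)) / T \<nu> + (\<Sum>j<m. ln 2 / T (\<nu> + Suc j)) \<le> lint (T \<nu>)" for \<nu> m
  proof (induction m arbitrary: \<nu>)
    case 0
    then show ?case using lint_ge_ln_Lam[OF T(1)] by simp
  next
    case (Suc m)
    have "Lam \<Delta> (T (Suc \<nu>)) = 2 * Lam \<Delta> (T \<nu>)" by (simp add: T)
    then have ln2: "ln (Lam \<Delta> (T (Suc \<nu>))) = ln 2 + ln (Lam \<Delta> (T \<nu>))"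
      using Lam_ge_1[OF T(1), of \<nu>] by (simp add: ln_mult)
    have "(\<Sum>j<Suc m. ln 2 / T (\<nu> + Suc j)) = ln 2 / T (Suc \<nu>) + (\<Sum>j<m. ln 2 / T (Suc \<nu> + Suc j))"
      by (subst sum.lessThan_Suc_shift) simp
    moreover have "ln (Lam \<Delta> (T (Suc \<nu>))) / T (Suc \<nu>) = ln 2 / T (Suc \<nu>) + ln (Lam \<Delta> (T \<nu>)) / T (Suc \<nu>)"
      by (simp add: ln2 add_divide_distrib)
    moreover have "ln (Lam \<Delta> (T \<nu>)) * (1 / T \<nu> - 1 / T (Suc \<nu>)) =
        ln (Lam \<Delta> (T \<nu>)) / T \<nu> - ln (Lam \<Delta> (T \<nu>)) / T (Suc \<nu>)"
      by (simp add: right_diff_distrib)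
    ultimately show ?case
      using lint_split[OF T(1) le, of \<nu>] Suc.IH[of "Suc \<nu>"] by linarith
  qed
  have "(\<Sum>\<nu><m. 3 / T \<nu>) \<le> 8 * lint \<tau>" for m
  proof (cases m)
    case 0
    then show ?thesis using lint_nonneg[OF \<tau>] by simp
  next
    case (Suc l)
    have "0 \<le> ln (Lam \<Delta> (T 0)) / T 0" using Lam_ge_1[OF T(1), of 0] T(1)[of 0] by simp
    then have "(\<Sum>j<l. ln 2 / T (Suc j)) \<le> lint \<tau>"
      using step[of 0 l] by (simp add: T_def)
    moreover have "(\<Sum>j<l. (2/3) / T (Suc j)) \<le> (\<Sum>j<l. ln 2 / T (Suc j))"
    proof (rule sum_mono)
      fix j
      have "0 \<le> T (Suc j)" using T(1)[of "Suc j"] by linarith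
      then show "(2/3) / T (Suc j) \<le> ln 2 / T (Suc j)"
        by (rule divide_right_mono[OF ln2_ge_two_thirds])
    qed
    moreover have "(\<Sum>j<l. (2/3) / T (Suc j)) = (2/9) * (\<Sum>j<l. 3 / T (Suc j))"
      by (simp add: sum_distrib_left)
    \<comment> \<open>With \<open>ln 2 \<ge> 2 / 3\<close> the later cut-offs cost at most
      \<open>9 / 2\<close> times the integral. The first one costs \<open>3 / \<tau>\<close>, at
      most 3 times the integral, and \<open>15 / 2 \<le> 8\<close>.\<close>
    ultimately have "(\<Sum>j<l. 3 / T (Suc j)) \<le> 9/2 * lint \<tau>" by linarith
    moreover have "(\<Sum>\<nu><m. 3 / T \<nu>) = 3 * (1 / \<tau>) + (\<Sum>j<l. 3 / T (Suc j))"
      unfolding Suc by (subst sum.lessThan_Suc_shift) (simp add: T_def)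
    ultimately show ?thesis using lint_ge_inverse[OF \<tau>] lint_nonneg[OF \<tau>] by linarith
  qed
  moreover have "T 0 = \<tau>" by (simp add: T_def)
  ultimately show thesis using that[of T] T by blast
qed

text \<open>The loss of one small divisor against the width \<open>8 * lint \<tau>\<close>. Up to
  \<open>\<tau>\<close> monotonicity suffices; beyond it \<open>ln (Lam \<Delta> k) / k\<close> is
  at most the integral from \<open>k\<close> on, hence at most \<open>lint \<tau>\<close>, and the
  product is even at most 1.\<close>

lemma Delta_exp_le_Lam:
  assumes \<tau>: "\<tau> \<ge> 1" and k: "k \<ge> 1"
  shows "\<Delta> k * exp (- (8 * lint \<tau>) * k) \<le> Lam \<Delta> \<tau>"
proof (cases "k \<le> \<tau>")
  case True
  have "\<Delta> k * exp (- (8 * lint \<tau>) * k) \<le> \<Delta> k * 1"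
    using lint_nonneg[OF \<tau>] ruessmann_ge_1[OF k] k by (intro mult_left_mono) auto
  also have "\<dots> \<le> \<Delta> \<tau>" using ruessmann_mono[OF k True] by simp
  also have "\<dots> \<le> Lam \<Delta> \<tau>" by (rule Delta_le_Lam[OF \<tau>])
  finally show ?thesis .
next
  case False
  have "ln (Lam \<Delta> k) / k \<le> lint k" by (rule lint_ge_ln_Lam[OF k])
  also have "\<dots> \<le> lint \<tau>"
  proof -
    have "0 \<le> ln (Lam \<Delta> \<tau>) * (1 / \<tau> - 1 / k)"
      using False \<tau> Lam_ge_1[OF \<tau>] by (intro mult_nonneg_nonneg) (auto simp: frac_le)
    then show ?thesis using lint_split[OF \<tau>, of k] False by linarith
  qed
  finally have "ln (Lam \<Delta> k) \<le> lint \<tau> * k" using k by (simp add: divide_le_eq)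
  moreover have "ln (\<Delta> k) \<le> ln (Lam \<Delta> k)"
    using Delta_le_Lam[OF k] ruessmann_ge_1[OF k] by simp
  moreover have "0 \<le> lint \<tau> * k" using lint_nonneg[OF \<tau>] k by simp
  ultimately have "ln (\<Delta> k) \<le> 8 * lint \<tau> * k" by simp
  then have "\<Delta> k \<le> exp (8 * lint \<tau> * k)"
    using ruessmann_ge_1[OF k] by (metis exp_ge_zero exp_le_cancel_iff exp_ln less_le_trans zero_less_one)
  then have "\<Delta> k * exp (- (8 * lint \<tau>) * k) \<le> exp (8 * lint \<tau> * k) * exp (- (8 * lint \<tau>) * k)"
    by (rule mult_right_mono) simp
  also have "\<dots> = 1" by (simp add: exp_add[symmetric])
  finally show ?thesis using Lam_ge_1[OF \<tau>] by linarith
qed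

end

section \<open>Real functions\<close>

definition vcnj :: "complex^'n \<Rightarrow> complex^'n" where
  "vcnj x = (\<chi> i. cnj (x $ i))"

text \<open>The symmetry of the coefficients of a function that is real at real angles. As a closed
  condition on each pair of coefficients it survives the limit of the iteration.\<close>

definition csym :: "(int^'n \<Rightarrow> complex^'n) \<Rightarrow> bool" where
  "csym c \<longleftrightarrow> (\<forall>k. vcnj (c (- k)) = c k)"

lemma vcnj_smult: "vcnj (a *s x) = cnj a *s vcnj x"
  by (simp add: vcnj_def vec_eq_iff)

lemma max_norm_vcnj [simp]: "max_norm (vcnj x) = max_norm x"
  by (simp add: vcnj_def max_norm_def)

lemma range_cvec_iff: "z \<in> range cvec \<longleftrightarrow> vcnj z = z"
proof
  show "z \<in> range cvec \<Longrightarrow> vcnj z = z" by (auto simp: vcnj_def vec_eq_iff)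
  assume "vcnj z = z"
  then have "cnj (z $ i) = z $ i" for i by (auto simp: vcnj_def vec_eq_iff)
  then have "z = cvec (Re_vec z)"
    by (simp add: vec_eq_iff Re_vec_def complex_eq_iff)
  then show "z \<in> range cvec" by (metis rangeI)
qed

lemma bounded_linear_vcnj: "bounded_linear (vcnj :: complex^'n \<Rightarrow> complex^'n)"
proof (rule bounded_linear_intro[where K = "real CARD('n)"])
  show "norm (vcnj x) \<le> norm x * real CARD('n)" for x :: "complex^'n"
  proof -
    have "norm (vcnj x) \<le> real CARD('n) * max_norm x" using norm_le_max_norm[of "vcnj x"] by simp
    also have "\<dots> \<le> real CARD('n) * norm x" by (intro mult_left_mono max_norm_le_norm) simp
    finally show ?thesis by (simp add: mult.commute)
  qed
qed (simp_all add: vcnj_def vec_eq_iff)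

lemma wser_vcnj:
  fixes c :: "int^'n \<Rightarrow> complex^'n"
  assumes "wbd s c M" "0 \<le> s"
  shows "vcnj (wser c (cvec \<theta>)) = wser (\<lambda>k. vcnj (c (- k))) (cvec \<theta>)"
proof -
  have "vcnj (wser c (cvec \<theta>)) = (\<Sum>\<^sub>\<infinity>k. vcnj (exp (\<i> * cpair k (cvec \<theta>)) *s c k))"
    unfolding wser_def
    by (intro infsumI[symmetric] has_sum_bounded_linear[OF bounded_linear_vcnj] has_sum_infsum
        wser_summable_real[OF assms])
  also have "\<dots> = (\<Sum>\<^sub>\<infinity>k. vcnj (exp (\<i> * cpair (- k) (cvec \<theta>)) *s c (- k)))"
    by (rule infsum_reindex_bij_betw[symmetric]) (auto intro!: bij_betwI[of _ _ _ uminus])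
  also have "\<dots> = wser (\<lambda>k. vcnj (c (- k))) (cvec \<theta>)"
    unfolding wser_def vcnj_smult
    by (intro infsum_cong) (simp add: cpair_cvec pairing_minus_left exp_cnj)
  finally show ?thesis .
qed

text \<open>Conjugating the series term by term reverses the frequencies; the converse direction
  rests on the uniqueness of the coefficients.\<close>

lemma csym_iff_real:
  fixes c :: "int^'n \<Rightarrow> complex^'n"
  assumes c: "wbd s c M" "0 \<le> s"
  shows "csym c \<longleftrightarrow> (\<forall>\<theta>. wser c (cvec \<theta>) \<in> range cvec)"
proof
  show "csym c \<Longrightarrow> \<forall>\<theta>. wser c (cvec \<theta>) \<in> range cvec"
    using wser_vcnj[OF c] by (simp add: range_cvec_iff csym_def)
  assume *: "\<forall>\<theta>. wser c (cvec \<theta>) \<in> range cvec"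
  let ?c = "\<lambda>k. vcnj (c (- k))"
  have d: "wbd s ?c M"
    unfolding wbd_def
  proof safe
    fix K :: "(int^'n) set" assume K: "finite K"
    have "(\<Sum>k\<in>K. max_norm (?c k) * exp (s * sum_norm k))
        = (\<Sum>k\<in>uminus ` K. max_norm (c k) * exp (s * sum_norm k))"
      by (simp add: sum.reindex)
    then show "(\<Sum>k\<in>K. max_norm (?c k) * exp (s * sum_norm k)) \<le> M"
      using wbdD[OF c(1), of "uminus ` K"] K by simp
  qed
  have "wser ?c (cvec \<theta>) = wser c (cvec \<theta>)" for \<theta>
    using * wser_vcnj[OF c, of \<theta>] by (simp add: range_cvec_iff)
  then have "?c k = c k" for k
    using fourier_coeff_wser[OF c, of k] fourier_coeff_wser[OF d c(2), of k] by simp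
  then show "csym c" by (simp add: csym_def)
qed

lemma csym_D: "csym c \<Longrightarrow> vcnj (c (- k)) = c k"
  by (simp add: csym_def)

lemma csym_dser:
  assumes "csym c" shows "csym (\<lambda>k. (\<i> * cpair k (cvec v)) *s c k)"
  unfolding csym_def by (simp only: vcnj_smult csym_D[OF assms]) (simp add: cpair_cvec pairing_minus_left)

lemma wser_add:
  fixes c :: "int^'n \<Rightarrow> complex^'n"
  assumes "wbd s c M" "wbd s d N" "max_norm (Im_vec z) \<le> s"
  shows "wser (\<lambda>k. c k + d k) z = wser c z + wser d z"
  unfolding wser_def vector_add_ldistrib
  by (intro infsum_add wser_summable(1)[OF assms(1,3)] wser_summable(1)[OF assms(2,3)])

lemma wser_diff:
  fixes c :: "int^'n \<Rightarrow> complex^'n"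
  assumes "wbd s c M" "wbd s d N" "max_norm (Im_vec z) \<le> s"
  shows "wser (\<lambda>k. c k - d k) z = wser c z - wser d z"
  unfolding wser_def vector_sub_rdistrib[symmetric] infsum_diff[OF wser_summable(1)[OF assms(1,3)]
      wser_summable(1)[OF assms(2,3)], symmetric]
  by (intro infsum_cong) (simp add: vec_eq_iff algebra_simps)

lemma wiener_minus:
  fixes f :: "real^'n \<Rightarrow> complex^'n"
  assumes "wiener s f M" "0 \<le> s" shows "wiener s (\<lambda>\<theta>. - f \<theta>) M"
  using wiener_linear[OF assms, of 1 uminus] by (simp add: vec_eq_iff)

lemma wser_has_derivative_real:
  fixes c :: "int^'n \<Rightarrow> complex^'n"
  assumes c: "wbd s c M" and s: "0 < s"
  shows "((\<lambda>\<theta>. wser c (cvec \<theta>)) has_derivative (\<lambda>v. dser c (cvec \<theta>) (cvec v))) (at \<theta>)"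
  using has_derivative_compose[OF bounded_linear_imp_has_derivative[OF bounded_linear_cvec]
      wser_has_derivative[OF c, of "cvec \<theta>"]] s by simp

lemma expm1_le: "exp x - 1 \<le> x * exp (x::real)"
  using mult_left_mono[OF exp_ge_add_one_self[of "- x"], of "exp x"]
  by (simp add: exp_minus algebra_simps)

text \<open>The damping of frequencies above the cut-off \<open>T \<nu>\<close> when the width drops
  by \<open>3 / T \<nu>\<close>.\<close>

lemma exp_neg_3_le: "exp (- 3) \<le> (1 / 16 :: real)"
proof -
  have "(13/8 :: real) \<le> exp (1/2)" using exp_lower_Taylor_quadratic[of "1/2"] by (simp add: power2_eq_square)
  then have "(13/8 :: real) ^ 6 \<le> exp (1/2) ^ 6" by (rule power_mono) simp
  also have "exp (1/2) ^ 6 = (exp 3 :: real)" by (simp add: exp_of_nat_mult[symmetric])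
  finally have "16 \<le> (exp 3 :: real)" by (simp add: eval_nat_numeral)
  then show ?thesis by (simp add: exp_minus field_simps)
qed

section \<open>The iteration\<close>

text \<open>The problem for one frequency: the perturbation survives only as coefficient sequences
  at real parameters, with a bound, reality and a Lipschitz estimate. The Lipschitz estimate is
  asked for within \<open>h / 8\<close>, a ball that the parameters never leave because
  \<open>2 * \<epsilon> < h / 8\<close>.\<close>

locale kam_setup =
  fixes \<omega> :: "real^'n" and s h \<epsilon> \<alpha> \<tau> r :: real and \<Delta> :: "real \<Rightarrow> real"
    and p :: "real^'n \<Rightarrow> int^'n \<Rightarrow> complex^'n" and T :: "nat \<Rightarrow> real"
  assumes \<alpha>: "\<alpha> > 0" and h: "h > 0" and \<epsilon>: "0 \<le> \<epsilon>" "\<epsilon> < h / 16"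
    and \<Delta>: "ruessmann \<Delta>"
    and dioph: "\<And>k. k \<noteq> 0 \<Longrightarrow> \<alpha> / \<Delta> (sum_norm k) \<le> \<bar>pairing k \<omega>\<bar>"
    and p_wbd: "\<And>\<mu>. max_norm (\<mu> - \<omega>) < h \<Longrightarrow> wbd s (p \<mu>) \<epsilon>"
    and p_real: "\<And>\<mu> \<theta>. max_norm (\<mu> - \<omega>) < h \<Longrightarrow> wser (p \<mu>) (cvec \<theta>) \<in> range cvec"
    and p_lipschitz: "\<And>\<mu> \<nu>. max_norm (\<mu> - \<omega>) \<le> h / 8 \<Longrightarrow> max_norm (\<nu> - \<omega>) \<le> h / 8 \<Longrightarrow>
      wbd s (\<lambda>k. p \<nu> k - p \<mu> k) (max_norm (\<nu> - \<mu>) / 12)"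
    and \<tau>: "\<tau> \<ge> 1" and h_le: "h / 16 \<le> \<alpha> / (32 * Lam \<Delta> \<tau>)"
    and T: "\<And>\<nu>. T \<nu> \<ge> 1" "\<And>\<nu>. Lam \<Delta> (T \<nu>) = 2 ^ \<nu> * Lam \<Delta> \<tau>" "\<And>m. (\<Sum>\<nu><m. 3 / T \<nu>) \<le> r"
    and r: "r < s"
begin

definition width :: "nat \<Rightarrow> real" where
  "width \<nu> = s - (\<Sum>j<\<nu>. 3 / T j)"

definition err :: "nat \<Rightarrow> real" where
  "err \<nu> = \<epsilon> / 4 ^ \<nu>"

text \<open>The embedding \<open>\<theta> + u(\<theta>)\<close> conjugates the vector field at the parameter \<open>lam\<close> to \<open>\<omega>\<close> if and only
  if its defect vanishes.\<close>

definition defect :: "(int^'n \<Rightarrow> complex^'n) \<Rightarrow> real^'n \<Rightarrow> real^'n \<Rightarrow> complex^'n" where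
  "defect u lam \<theta> = cvec lam + wser (p lam) (cvec \<theta> + wser u (cvec \<theta>)) - cvec \<omega>
     - dser u (cvec \<theta>) (cvec \<omega>)"

text \<open>The embedding is bounded by exactly the width used up so far, so \<open>id + u\<close>
  on width \<open>width \<nu>\<close> can be inserted into the perturbation, which is controlled at
  width \<open>s\<close>. The derivative bound and the parameter bound are written as partial sums
  of geometric series, so that each step only has to fit its own increment.\<close>

definition kam_inv :: "nat \<Rightarrow> (int^'n \<Rightarrow> complex^'n) \<Rightarrow> real^'n \<Rightarrow> bool" where
  "kam_inv \<nu> u lam \<longleftrightarrow> csym u \<and> wbd (width \<nu>) u (s - width \<nu>) \<and>
     wbd (width \<nu>) (\<lambda>k. sum_norm k *\<^sub>R u k) ((1 - 1 / 2 ^ \<nu>) / 15) \<and>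
     max_norm (lam - \<omega>) \<le> 2 * \<epsilon> - 2 * err \<nu> \<and> wiener (width \<nu>) (defect u lam) (err \<nu>)"

lemma width_Suc: "width (Suc \<nu>) = width \<nu> - 3 / T \<nu>"
  by (simp add: width_def)

lemma width_ge: "s - r \<le> width \<nu>"
  using T(3)[of \<nu>] by (simp add: width_def)

lemma width_pos: "0 < width \<nu>"
  using width_ge[of \<nu>] r by linarith

lemma err_nonneg: "0 \<le> err \<nu>"
  using \<epsilon> by (simp add: err_def)

lemma err_Suc: "err (Suc \<nu>) = err \<nu> / 4"
  by (simp add: err_def)

lemma max_norm_le_h8: "max_norm (lam - \<omega>) \<le> 2 * \<epsilon> - 2 * err \<nu> \<Longrightarrow> max_norm (lam - \<omega>) \<le> h / 8"
  using err_nonneg[of \<nu>] \<epsilon> by linarith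

lemma kam_inv_0: "kam_inv 0 (\<lambda>_. 0) \<omega>"
proof -
  have z: "wser (\<lambda>_. 0) z = 0" for z :: "complex^'n" by (simp add: wser_def)
  have "wiener s (defect (\<lambda>_. 0) \<omega>) \<epsilon>"
    by (rule wienerI[OF p_wbd[of \<omega>]]) (use h in \<open>simp_all add: defect_def dser_def z\<close>)
  then show ?thesis
    by (simp add: kam_inv_def csym_def wbd_def width_def err_def vcnj_def vec_eq_iff)
qed

text \<open>The size of the correction in units of \<open>1 / T \<nu>\<close>, which is also the
  scale of its derivative after a loss of that width. Here \<open>Lam \<Delta> (T \<nu>)\<close> has
  grown like \<open>2 ^ \<nu>\<close> against a defect of order \<open>4 ^ - \<nu>\<close>.\<close>

lemma correction_small:
  "\<Delta> (T \<nu>) / \<alpha> * err \<nu> * T \<nu> \<le> 1 / 2 ^ \<nu> / 32"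
proof -
  have L: "Lam \<Delta> \<tau> > 0" using Lam_ge_1[OF \<Delta> \<tau>] by simp
  have "\<epsilon> \<le> \<alpha> / (32 * Lam \<Delta> \<tau>)" using \<epsilon> h_le by linarith
  then have "\<epsilon> * Lam \<Delta> \<tau> / \<alpha> \<le> 1 / 32" using L \<alpha> by (simp add: field_simps)
  have "\<Delta> (T \<nu>) / \<alpha> * err \<nu> * T \<nu> = Lam \<Delta> (T \<nu>) * err \<nu> / \<alpha>" by (simp add: Lam_def)
  also have "\<dots> = \<epsilon> * Lam \<Delta> \<tau> / \<alpha> * (2 ^ \<nu> / 4 ^ \<nu>)" by (simp add: T err_def mult_ac)
  also have "2 ^ \<nu> / 4 ^ \<nu> = (1 / 2 ^ \<nu> :: real)"
    unfolding power_divide[symmetric] by (simp add: power_one_over)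
  also have "\<epsilon> * Lam \<Delta> \<tau> / \<alpha> * (1 / 2 ^ \<nu>) \<le> 1 / 32 * (1 / 2 ^ \<nu>)"
    by (intro mult_right_mono) (fact, simp)
  finally show ?thesis by simp
qed

text \<open>Write \<open>E\<close> for the defect of \<open>u\<close>, \<open>[E]\<close> for its mean value, and let \<open>F\<close> solve
  \<open>\<partial> F = E - [E]\<close>, with \<open>\<partial>\<close> the derivative along \<open>\<omega>\<close>, up to the frequency cut-off. Moving the parameter by \<open>- [E]\<close> and composing
  \<open>id + u\<close> with \<open>id + F\<close> leaves a defect of four terms: \<open>E \<circ> (id + F) - E\<close>, the high frequencies
  of \<open>E\<close>, the change of \<open>P\<close> with the parameter, and \<open>- (D u \<circ> (id + F)) (\<partial> F)\<close>. Since \<open>D u\<close> stays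
  below \<open>1 / 15\<close>, each is a small multiple of \<open>E\<close>; the last one need not be quadratic.\<close>

lemma kam_step:
  assumes inv: "kam_inv \<nu> u lam"
  shows "\<exists>u' lam'. kam_inv (Suc \<nu>) u' lam' \<and> wbd (s - r) (\<lambda>k. u' k - u k) (1 / 2 ^ \<nu>) \<and>
    max_norm (lam' - lam) \<le> err \<nu>"
proof -
  define \<sigma> where "\<sigma> = width \<nu>"
  define t where "t = T \<nu>"
  define \<sigma>' where "\<sigma>' = width (Suc \<nu>)"
  define b where "b = (1 - 1 / 2 ^ \<nu>) / (15 :: real)"
  have \<sigma>'_eq: "\<sigma>' = \<sigma> - 3 / t" by (simp add: \<sigma>'_def \<sigma>_def t_def width_Suc)
  have t: "t \<ge> 1" using T(1) by (simp add: t_def)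
  have \<sigma>: "0 < \<sigma>" "0 < \<sigma>'" by (simp_all only: \<sigma>_def \<sigma>'_def width_pos)
  have \<sigma>'_le: "\<sigma>' \<le> \<sigma>" using t by (simp add: \<sigma>'_eq)
  have b: "0 \<le> b" "b \<le> 1 / 15" by (simp_all add: b_def)
  have u: "csym u" "wbd \<sigma> u (s - \<sigma>)" "wbd \<sigma> (\<lambda>k. sum_norm k *\<^sub>R u k) b"
    and lam: "max_norm (lam - \<omega>) \<le> 2 * \<epsilon> - 2 * err \<nu>"
    using inv by (auto simp: kam_inv_def \<sigma>_def b_def)
  obtain e where e: "wbd \<sigma> e (err \<nu>)" and defect_e: "\<And>\<theta>. defect u lam \<theta> = wser e (cvec \<theta>)"
    using inv by (auto simp: kam_inv_def wiener_def \<sigma>_def)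
  have lamh: "max_norm (lam - \<omega>) < h" using max_norm_le_h8[OF lam] h by linarith

  have u_real: "wser u (cvec \<theta>) \<in> range cvec" for \<theta>
    using csym_iff_real[OF u(2)] u(1) \<sigma> by simp
  have du_real: "dser u (cvec \<theta>) (cvec v) \<in> range cvec" for \<theta> v
    using csym_iff_real[OF wbd_cpair_coeff[OF u(3), of \<i> "cvec v"]] csym_dser[OF u(1), of v] \<sigma>
    by (simp add: dser_def)
  have add_real: "x + y \<in> range cvec" "x - y \<in> range cvec"
    if "x \<in> range cvec" "y \<in> range cvec" for x y :: "complex^'n"
    using that by (auto simp: cvec_add[symmetric] cvec_diff[symmetric])
  have p_real': "wser (p \<mu>) x \<in> range cvec"
    if "max_norm (\<mu> - \<omega>) < h" "x \<in> range cvec" for \<mu> x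
    using that p_real by auto
  have "wser e (cvec \<theta>) \<in> range cvec" for \<theta>
    unfolding defect_e[symmetric] defect_def
    by (intro add_real rangeI p_real' lamh u_real du_real)
  then have e_sym: "csym e" using csym_iff_real[OF e] \<sigma> by simp
  \<comment> \<open>Reality of the defect makes its mean value real, so it is an admissible change
    of the real parameter.\<close>
  define \<delta> where "\<delta> = Re_vec (e 0)"
  have \<delta>: "cvec \<delta> = e 0"
    unfolding \<delta>_def using csym_D[OF e_sym, of 0] by (intro cvec_Re_vec) (simp add: range_cvec_iff)
  define lam' where "lam' = lam - \<delta>"
  have \<delta>_le: "max_norm (lam' - lam) \<le> err \<nu>"
    using wbd_nth[OF e, of 0] by (simp add: lam'_def \<delta>[symmetric])
  have lam': "max_norm (lam' - \<omega>) \<le> 2 * \<epsilon> - 2 * err (Suc \<nu>)"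
    using max_norm_add[of "lam' - lam" "lam - \<omega>"] \<delta>_le lam err_nonneg[of \<nu>] by (simp add: err_Suc)
  have lam'h: "max_norm (lam' - \<omega>) < h" using max_norm_le_h8[OF lam'] h by linarith

  \<comment> \<open>The bound for the correction: below the cut-off no divisor is smaller than
    \<open>\<alpha> / \<Delta> t\<close>.\<close>
  define f where "f = \<Delta> t / \<alpha> * err \<nu>"
  have ft: "f * t \<le> 1 / 2 ^ \<nu> / 32" using correction_small[of \<nu>] by (simp add: f_def t_def)
  have ft1: "f * t \<le> 1 / 32" by (rule order_trans[OF ft]) simp
  have f0: "0 \<le> f" using ruessmann_ge_1[OF \<Delta> t] \<alpha> err_nonneg by (simp add: f_def)
  have f_le: "f \<le> 1 / 32 / t" using ft1 t by (simp add: field_simps)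
  have f_t: "f \<le> 1 / t" using f_le t by (simp add: field_simps)
  define low where "low k \<longleftrightarrow> k \<noteq> 0 \<and> sum_norm k \<le> t" for k :: "int^'n"
  define Fc where "Fc k = (if low k then (1 / (\<i> * cpair k (cvec \<omega>))) *s e k else 0)" for k
  have low_minus: "low (- k) = low k" for k by (simp add: low_def)
  have pair_ge: "\<alpha> / \<Delta> t \<le> \<bar>pairing k \<omega>\<bar>" if "low k" for k
  proof -
    have k: "1 \<le> sum_norm k" using that sum_norm_ge_1 by (auto simp: low_def)
    have "\<alpha> / \<Delta> t \<le> \<alpha> / \<Delta> (sum_norm k)"
      using that \<alpha> ruessmann_ge_1[OF \<Delta> k] ruessmann_ge_1[OF \<Delta> t] ruessmann_mono[OF \<Delta> k, of t]
      by (intro divide_left_mono) (auto simp: low_def)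
    then show ?thesis using dioph[of k] that by (auto simp: low_def)
  qed
  have pair_nz: "pairing k \<omega> \<noteq> 0" if "low k" for k
  proof -
    have "\<alpha> / \<Delta> t > 0" using \<alpha> ruessmann_ge_1[OF \<Delta> t] by simp
    then show ?thesis using pair_ge[OF that] by linarith
  qed
  have Fc: "wbd \<sigma> Fc f"
  proof (rule wbd_compare[OF e, of "\<Delta> t / \<alpha>"])
    fix k :: "int^'n"
    have "max_norm (Fc k) \<le> \<Delta> t / \<alpha> * max_norm (e k)"
    proof (cases "low k")
      case True
      have "\<alpha> / \<Delta> t > 0" using \<alpha> ruessmann_ge_1[OF \<Delta> t] by simp
      then have "1 / \<bar>pairing k \<omega>\<bar> \<le> 1 / (\<alpha> / \<Delta> t)"
        using le_imp_inverse_le[OF pair_ge[OF True]] by (simp only: inverse_eq_divide)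
      then have "1 / \<bar>pairing k \<omega>\<bar> * max_norm (e k) \<le> \<Delta> t / \<alpha> * max_norm (e k)"
        by (intro mult_right_mono) auto
      then show ?thesis
        using True by (simp add: Fc_def max_norm_smult norm_divide norm_mult cpair_cvec)
    next
      case False
      then show ?thesis using \<alpha> ruessmann_ge_1[OF \<Delta> t] by (simp add: Fc_def)
    qed
    then have "max_norm (Fc k) * exp (\<sigma> * sum_norm k) \<le> \<Delta> t / \<alpha> * max_norm (e k) * exp (\<sigma> * sum_norm k)"
      by (rule mult_right_mono) simp
    then show "max_norm (Fc k) * exp (\<sigma> * sum_norm k) \<le> \<Delta> t / \<alpha> * (max_norm (e k) * exp (\<sigma> * sum_norm k))"
      by (simp only: mult.assoc)
  qed (use \<alpha> ruessmann_ge_1[OF \<Delta> t] in \<open>simp_all add: f_def\<close>)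
  have Fsym: "csym Fc"
    unfolding csym_def
  proof
    fix k
    have "vcnj ((1 / (\<i> * cpair (- k) (cvec \<omega>))) *s e (- k)) = (1 / (\<i> * cpair k (cvec \<omega>))) *s e k"
      by (simp only: vcnj_smult csym_D[OF e_sym]) (simp add: cpair_cvec pairing_minus_left)
    then show "vcnj (Fc (- k)) = Fc k"
      unfolding Fc_def low_minus by (simp add: vcnj_def vec_eq_iff)
  qed
  define F where "F \<theta> = wser Fc (cvec \<theta>)" for \<theta>
  have F_real: "F \<theta> \<in> range cvec" for \<theta>
    unfolding F_def using csym_iff_real[OF Fc] Fsym \<sigma> by simp
  have F: "wiener \<sigma> F f" by (rule wienerI[OF Fc]) (simp add: F_def)
  \<comment> \<open>The derivative of the correction along \<open>\<omega>\<close> is the truncated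
    defect itself. It is bounded by \<open>err \<nu>\<close> without a small divisor, which is what
    makes the last of the four terms harmless.\<close>
  define V where "V \<theta> = dser Fc (cvec \<theta>) (cvec \<omega>)" for \<theta>
  define Vc where "Vc k = (if low k then e k else 0)" for k
  have "(\<i> * cpair k (cvec \<omega>)) *s Fc k = Vc k" for k
    using pair_nz[of k] by (simp add: Fc_def Vc_def vector_smult_assoc cpair_cvec)
  then have V_eq: "V \<theta> = wser Vc (cvec \<theta>)" for \<theta> by (simp add: V_def dser_def)
  have Vc: "wbd \<sigma> Vc (err \<nu>)" by (rule wbd_mono[OF e]) (auto simp: Vc_def)
  have V: "wiener \<sigma> V (err \<nu>)" by (rule wienerI[OF Vc V_eq])

  \<comment> \<open>An intermediate width: going from \<open>\<sigma>\<close> to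
    \<open>\<rho>\<close> leaves room for composing with \<open>id + F\<close>, and the remaining
    \<open>1 / t\<close> is spent on differentiating the increment.\<close>
  define \<rho> where "\<rho> = \<sigma>' + 1 / t"
  have \<rho>: "0 \<le> \<rho>" "\<rho> + f \<le> \<sigma>" "\<rho> \<le> \<sigma>" "\<sigma>' \<le> \<rho>" "\<sigma>' + f \<le> \<sigma>"
    using \<sigma> f_t f0 t by (auto simp: \<rho>_def \<sigma>'_eq)
  \<comment> \<open>This is the increment of the embedding,
    \<open>(id + u) \<circ> (id + F) - (id + u)\<close>. Bounding it separately makes the bounds on
    \<open>u\<close> additive over the steps, where composing would multiply them.\<close>
  have "wiener \<rho> (\<lambda>\<theta>. F \<theta> + (wser u (cvec \<theta> + F \<theta>) - wser u (cvec \<theta>))) (f + f * b)"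
  proof (rule wiener_add[OF _ wiener_compose_diff])
    show "wiener \<rho> F f" "wiener \<rho> F f" by (rule wiener_mono[OF F \<rho>(3) order_refl])+
    show "wbd (\<rho> + f) u (s - \<sigma>)" by (rule wbd_mono[OF u(2) \<rho>(2)]) auto
    show "wbd \<rho> (\<lambda>k. (exp (sum_norm k * f) - 1) *\<^sub>R u k) (f * b)"
    proof (rule wbd_compare[OF u(3) f0 order_refl])
      fix k :: "int^'n"
      have "exp (\<rho> * sum_norm k) * (exp (sum_norm k * f) - 1)
        \<le> exp (\<rho> * sum_norm k) * (sum_norm k * f * exp (sum_norm k * f))"
        by (intro mult_left_mono expm1_le) simp
      also have "\<dots> = sum_norm k * f * exp ((\<rho> + f) * sum_norm k)"
        by (simp add: exp_add algebra_simps)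
      also have "\<dots> \<le> sum_norm k * f * exp (\<sigma> * sum_norm k)"
        using \<rho>(2) f0 by (intro mult_left_mono) (auto intro: mult_right_mono)
      finally have "max_norm (u k) * (exp (\<rho> * sum_norm k) * (exp (sum_norm k * f) - 1))
        \<le> max_norm (u k) * (sum_norm k * f * exp (\<sigma> * sum_norm k))"
        by (intro mult_left_mono) auto
      then show "max_norm ((exp (sum_norm k * f) - 1) *\<^sub>R u k) * exp (\<rho> * sum_norm k)
        \<le> f * (max_norm (sum_norm k *\<^sub>R u k) * exp (\<sigma> * sum_norm k))"
        using f0 by (simp add: max_norm_scaleR mult_ac)
    qed
  qed (use \<rho> in auto)
  then obtain g where g: "wbd \<rho> g (f + f * b)"
    and g_eq: "\<And>\<theta>. F \<theta> + (wser u (cvec \<theta> + F \<theta>) - wser u (cvec \<theta>)) = wser g (cvec \<theta>)"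
    unfolding wiener_def by blast
  define u' where "u' k = u k + g k" for k
  have fb: "f + f * b \<le> f * (16 / 15)" using mult_left_mono[OF b(2) f0] by simp
  have g\<sigma>': "wbd \<sigma>' g (f + f * b)" by (rule wbd_mono[OF g \<rho>(4)]) auto
  have u\<sigma>': "wbd \<sigma>' u (s - \<sigma>)" by (rule wbd_mono[OF u(2) \<sigma>'_le]) auto
  have u'_eq: "wser u' (cvec \<theta>) = F \<theta> + wser u (cvec \<theta> + F \<theta>)" for \<theta>
    using wser_add[OF u\<sigma>' g\<sigma>', of "cvec \<theta>"] g_eq[of \<theta>, symmetric] \<sigma>
    by (simp add: u'_def[abs_def])
  have u'1: "wbd \<sigma>' u' (s - \<sigma>')"
  proof (rule wbd_mono[OF wbd_add[OF u\<sigma>' g\<sigma>'] order_refl])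
    have "f * (16 / 15) \<le> 1 / 32 / t * (16 / 15)" using f_le by (rule mult_right_mono) simp
    also have "\<dots> \<le> 3 / t" using t by (simp add: field_simps)
    finally have "f * (16 / 15) \<le> 3 / t" .
    then show "s - \<sigma> + (f + f * b) \<le> s - \<sigma>'" using fb by (simp add: \<sigma>'_eq)
  qed (auto simp: u'_def)
  have u'2: "wbd \<sigma>' (\<lambda>k. sum_norm k *\<^sub>R u' k) ((1 - 1 / 2 ^ Suc \<nu>) / 15)"
  proof (rule wbd_mono[OF wbd_add[OF _ wbd_diff_loss[of \<sigma>' "1/t" g "f + f * b"]] order_refl])
    show "wbd \<sigma>' (\<lambda>k. sum_norm k *\<^sub>R u k) b" by (rule wbd_mono[OF u(3) \<sigma>'_le]) auto
    show "wbd (\<sigma>' + 1 / t) g (f + f * b)" using g by (simp add: \<rho>_def)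
    have "(f + f * b) * t \<le> (f * t) * (16 / 15)" using mult_right_mono[OF fb, of t] t by (simp add: mult_ac)
    also have "\<dots> \<le> 1 / 2 ^ \<nu> / 32 * (16 / 15)" using ft by (intro mult_right_mono) auto
    finally have *: "(f + f * b) / (1 / t) \<le> 1 / 2 ^ \<nu> / 32 * (16 / 15)" by simp
    define c :: real where "c = 1 / 2 ^ \<nu>"
    have eq: "(1 - 1 / 2 ^ Suc \<nu>) / 15 = (1 - c / 2) / (15 :: real)" by (simp add: c_def)
    have bc: "b = (1 - c) / 15" by (simp add: b_def c_def)
    define X where "X = (f + f * b) / (1 / t)"
    \<comment> \<open>The increment \<open>c / 30\<close> is exactly the difference of the
      derivative bounds of two consecutive steps; this fixes the constant
      \<open>1 / 15\<close>.\<close>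
    have "X \<le> c / 32 * (16 / 15)" using * by (simp only: X_def c_def)
    then have "(1 - c) / 15 + X \<le> (1 - c / 2) / 15" by (simp add: field_simps)
    then show "b + (f + f * b) / (1 / t) \<le> (1 - 1 / 2 ^ Suc \<nu>) / 15"
      unfolding eq X_def[symmetric] bc[symmetric] .
  qed (use t in \<open>auto simp: u'_def scaleR_add_right\<close>)
  have u'_real: "wser u' (cvec \<theta>) \<in> range cvec" for \<theta>
  proof -
    obtain x where x: "F \<theta> = cvec x" using F_real[of \<theta>] by auto
    show ?thesis unfolding u'_eq
      using u_real[of "\<theta> + x"] F_real[of \<theta>] by (intro add_real) (simp_all add: x cvec_add)
  qed
  then have u'3: "csym u'" using csym_iff_real[OF u'1] \<sigma> by simp

  \<comment> \<open>The chain rule, read off from uniqueness of the derivative of the function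
    \<open>wser u'\<close>, because the coefficients of the composition are known only through a
    bound.\<close>
  have du': "dser u' (cvec \<theta>) (cvec \<omega>) = V \<theta> + dser u (cvec \<theta> + F \<theta>) (cvec \<omega>)
      + dser u (cvec \<theta> + F \<theta>) (V \<theta>)" for \<theta>
  proof -
    obtain x where x: "F \<theta> = cvec x" using F_real[of \<theta>] by auto
    have 1: "((\<lambda>\<theta>. wser u' (cvec \<theta>)) has_derivative (\<lambda>v. dser u' (cvec \<theta>) (cvec v))) (at \<theta>)"
      by (rule wser_has_derivative_real[OF u'1 \<sigma>(2)])
    have dF: "(F has_derivative (\<lambda>v. dser Fc (cvec \<theta>) (cvec v))) (at \<theta>)"
      unfolding F_def by (rule wser_has_derivative_real[OF Fc \<sigma>(1)])
    have inner: "((\<lambda>\<theta>. cvec \<theta> + F \<theta>) has_derivative (\<lambda>v. cvec v + dser Fc (cvec \<theta>) (cvec v))) (at \<theta>)"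
      by (intro has_derivative_add dF bounded_linear_imp_has_derivative bounded_linear_cvec)
    have "(wser u has_derivative dser u (cvec \<theta> + F \<theta>)) (at (cvec \<theta> + F \<theta>))"
      by (rule wser_has_derivative[OF u(2)]) (use \<sigma> in \<open>simp add: x cvec_add[symmetric]\<close>)
    from has_derivative_add[OF dF has_derivative_compose[OF inner this]]
    have 2: "((\<lambda>\<theta>. F \<theta> + wser u (cvec \<theta> + F \<theta>)) has_derivative
      (\<lambda>v. dser Fc (cvec \<theta>) (cvec v) + dser u (cvec \<theta> + F \<theta>) (cvec v + dser Fc (cvec \<theta>) (cvec v)))) (at \<theta>)" .
    have "(\<lambda>v. dser u' (cvec \<theta>) (cvec v)) =
      (\<lambda>v. dser Fc (cvec \<theta>) (cvec v) + dser u (cvec \<theta> + F \<theta>) (cvec v + dser Fc (cvec \<theta>) (cvec v)))"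
      using has_derivative_unique[OF 1[unfolded u'_eq] 2] .
    then have "dser u' (cvec \<theta>) (cvec \<omega>) = V \<theta> + dser u (cvec \<theta> + F \<theta>) (cvec \<omega> + V \<theta>)"
      by (simp add: fun_eq_iff V_def)
    moreover have "dser u (cvec \<theta> + F \<theta>) (cvec \<omega> + V \<theta>) =
        dser u (cvec \<theta> + F \<theta>) (cvec \<omega>) + dser u (cvec \<theta> + F \<theta>) (V \<theta>)"
      by (rule dser_linear(1)[OF u(3)]) (use \<sigma> in \<open>simp add: x cvec_add[symmetric]\<close>)
    ultimately show ?thesis by (simp add: add.assoc)
  qed

  define q where "q k = p lam' k - p lam k" for k
  define eh where "eh k = (if k \<noteq> 0 \<and> \<not> low k then e k else 0)" for k
  have q: "wbd s q (err \<nu> / 12)"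
    unfolding q_def
    by (rule wbd_mono[OF p_lipschitz[OF max_norm_le_h8[OF lam] max_norm_le_h8[OF lam']] order_refl])
      (use \<delta>_le in auto)
  have defect': "defect u' lam' \<theta> = ((wser e (cvec \<theta> + F \<theta>) - wser e (cvec \<theta>)) + wser eh (cvec \<theta>))
     + (wser q (cvec \<theta> + wser u' (cvec \<theta>)) + - dser u (cvec \<theta> + F \<theta>) (V \<theta>))" for \<theta>
  proof -
    obtain x where x: "F \<theta> = cvec x" using F_real[of \<theta>] by auto
    have \<theta>x: "cvec \<theta> + F \<theta> = cvec (\<theta> + x)" by (simp add: x cvec_add)
    define Y where "Y = cvec \<theta> + wser u' (cvec \<theta>)"
    have Y: "Y = cvec (\<theta> + x) + wser u (cvec (\<theta> + x))"
      by (simp add: Y_def u'_eq \<theta>x add.assoc[symmetric])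
    obtain y where y: "Y = cvec y" using u'_real[of \<theta>] by (auto simp: Y_def cvec_add[symmetric])
    have "wser e (cvec (\<theta> + x)) = cvec lam + wser (p lam) Y - cvec \<omega> - dser u (cvec (\<theta> + x)) (cvec \<omega>)"
      unfolding defect_e[symmetric] defect_def Y ..
    moreover have "wser q Y = wser (p lam') Y - wser (p lam) Y"
      unfolding q_def using r T(3)[of 0]
      by (intro wser_diff[OF p_wbd[OF lam'h] p_wbd[OF lamh]]) (simp add: y)
    moreover have "defect u' lam' \<theta> = cvec lam - e 0 + wser (p lam') Y - cvec \<omega>
        - (V \<theta> + dser u (cvec (\<theta> + x)) (cvec \<omega>) + dser u (cvec (\<theta> + x)) (V \<theta>))"
      unfolding defect_def du' Y_def[symmetric] \<theta>x by (simp add: lam'_def cvec_diff \<delta>)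
    moreover have "wser eh (cvec \<theta>) = wser e (cvec \<theta>) - e 0 - V \<theta>"
    proof -
      have eq: "eh k = (e k - (if k = 0 then e 0 else 0)) - Vc k" for k
        by (simp add: eh_def Vc_def low_def)
      have "wser eh (cvec \<theta>) = wser (\<lambda>k. e k - (if k = 0 then e 0 else 0)) (cvec \<theta>) - wser Vc (cvec \<theta>)"
        unfolding eq using \<sigma>
        by (intro wser_diff[OF _ Vc, of _ "err \<nu>"] wbd_mono[OF e]) auto
      also have "wser (\<lambda>k. e k - (if k = 0 then e 0 else 0)) (cvec \<theta>) = wser e (cvec \<theta>) - e 0"
        using \<sigma> by (subst wser_diff[OF e wbd_single]) (auto simp: wser_single)
      finally show ?thesis by (simp add: V_eq)
    qed
    \<comment> \<open>The cancellation is stated for abstract vectors: the mean value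
      \<open>e0\<close> removed from the parameter and the derivative \<open>v\<close> of the
      correction cancel the low part of the defect.\<close>
    moreover have "D = ((ex - et) + eh) + (q + - dv)"
      if "ex = l + P - w - dx" "q = P' - P" "D = l - e0 + P' - w - (v + dx + dv)" "eh = et - e0 - v"
      for ex et eh q D l P P' w dx dv v e0 :: "complex^'n"
      using that by simp
    ultimately show ?thesis
      unfolding \<theta>x Y_def[symmetric] by blast
  qed
  have small1: "wiener \<sigma>' (\<lambda>\<theta>. wser e (cvec \<theta> + F \<theta>) - wser e (cvec \<theta>)) (err \<nu> / 32)"
  proof (rule wiener_compose_diff)
    show "wiener \<sigma>' F f" by (rule wiener_mono[OF F \<sigma>'_le order_refl])
    show "wbd (\<sigma>' + f) e (err \<nu>)" by (rule wbd_mono[OF e \<rho>(5)]) auto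
    show "wbd \<sigma>' (\<lambda>k. (exp (sum_norm k * f) - 1) *\<^sub>R e k) (err \<nu> / 32)"
    proof (rule wbd_compare[OF e, of "1 / 32"])
      fix k :: "int^'n"
      \<comment> \<open>The frequency in units of the cut-off. The loss \<open>3 / t\<close> is
        worth \<open>exp (3 * x)\<close>: two of these factors absorb the exponential of
        \<open>sum_norm k * f\<close>, and the third absorbs the linear factor
        \<open>x\<close>.\<close>
      define x where "x = sum_norm k / t"
      have x: "0 \<le> x" using t by (simp add: x_def)
      have xf: "sum_norm k * f \<le> x / 32"
        using mult_left_mono[OF f_le, of "sum_norm k"] by (simp add: x_def)
      have xe: "x \<le> exp x" using exp_ge_add_one_self[of x] by linarith
      have xf0: "0 \<le> sum_norm k * f" using f0 by simp
      have "exp (sum_norm k * f) - 1 \<le> sum_norm k * f * exp (sum_norm k * f)" by (rule expm1_le)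
      also have "\<dots> \<le> x / 32 * exp (2 * x)" using xf xf0 x by (intro mult_mono) auto
      also have "\<dots> \<le> exp x / 32 * exp (2 * x)"
        using xe by (intro mult_right_mono divide_right_mono) auto
      also have "\<dots> = exp (3 * x) / 32" by (simp add: exp_add[symmetric])
      finally have "exp (\<sigma>' * sum_norm k) * (exp (sum_norm k * f) - 1) \<le> exp (\<sigma>' * sum_norm k) * (exp (3 * x) / 32)"
        by (intro mult_left_mono) auto
      also have "\<dots> = exp (\<sigma> * sum_norm k) / 32"
        by (simp add: exp_add[symmetric] \<sigma>'_eq x_def left_diff_distrib)
      finally have *: "exp (\<sigma>' * sum_norm k) * (exp (sum_norm k * f) - 1) \<le> exp (\<sigma> * sum_norm k) / 32" .
      show "max_norm ((exp (sum_norm k * f) - 1) *\<^sub>R e k) * exp (\<sigma>' * sum_norm k)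
          \<le> 1 / 32 * (max_norm (e k) * exp (\<sigma> * sum_norm k))"
        using mult_left_mono[OF *, of "max_norm (e k)"] xf0 by (simp add: max_norm_scaleR mult_ac)
    qed auto
  qed (use \<sigma> in simp)
  have small2: "wiener \<sigma>' (\<lambda>\<theta>. wser eh (cvec \<theta>)) (err \<nu> / 16)"
  proof (rule wienerI[OF wbd_compare[OF e, of "1 / 16"] refl])
    fix k :: "int^'n"
    show "max_norm (eh k) * exp (\<sigma>' * sum_norm k) \<le> 1 / 16 * (max_norm (e k) * exp (\<sigma> * sum_norm k))"
      proof (cases "k \<noteq> 0 \<and> \<not> low k")
        case True
        \<comment> \<open>A nonzero frequency that was not solved for lies above the cut-off, so the
          loss of width damps it by at least \<open>exp (- 3)\<close>.\<close>
        then have "1 \<le> sum_norm k / t" using t by (auto simp: low_def)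
        then have "exp (- 3 * (sum_norm k / t)) \<le> exp (- 3 :: real)" by simp
        then have "exp (- 3 * (sum_norm k / t)) \<le> 1 / 16" using exp_neg_3_le by linarith
        then have "exp (\<sigma> * sum_norm k) * exp (- 3 * (sum_norm k / t)) \<le> exp (\<sigma> * sum_norm k) * (1 / 16)"
          by (intro mult_left_mono) auto
        moreover have "exp (\<sigma> * sum_norm k) * exp (- 3 * (sum_norm k / t)) = exp (\<sigma>' * sum_norm k)"
          by (simp add: exp_add[symmetric] \<sigma>'_eq left_diff_distrib)
        ultimately have "exp (\<sigma>' * sum_norm k) \<le> exp (\<sigma> * sum_norm k) * (1 / 16)" by linarith
        from mult_left_mono[OF this, of "max_norm (e k)"] show ?thesis using True by (simp add: eh_def)
      next
        case False
        then have "eh k = 0" by (auto simp: eh_def)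
        then show ?thesis by simp
      qed
  qed auto
  have small3: "wiener \<sigma>' (\<lambda>\<theta>. wser q (cvec \<theta> + wser u' (cvec \<theta>))) (err \<nu> / 12)"
  proof (rule wiener_compose)
    show "wiener \<sigma>' (\<lambda>\<theta>. wser u' (cvec \<theta>)) (s - \<sigma>')" by (rule wienerI[OF u'1 refl])
    show "wbd (\<sigma>' + (s - \<sigma>')) q (err \<nu> / 12)" using q by simp
  qed (use \<sigma> in simp)
  have small4: "wiener \<sigma>' (\<lambda>\<theta>. - dser u (cvec \<theta> + F \<theta>) (V \<theta>)) (b * err \<nu>)"
  proof (rule wiener_minus[OF wiener_compose_dser])
    show "wiener \<sigma>' F f" by (rule wiener_mono[OF F \<sigma>'_le order_refl])
    show "wiener \<sigma>' V (err \<nu>)" by (rule wiener_mono[OF V \<sigma>'_le order_refl])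
    show "wbd (\<sigma>' + f) (\<lambda>k. sum_norm k *\<^sub>R u k) b" by (rule wbd_mono[OF u(3) \<rho>(5)]) auto
  qed (use \<sigma> in auto)
  have "wiener \<sigma>' (defect u' lam') ((err \<nu> / 32 + err \<nu> / 16) + (err \<nu> / 12 + b * err \<nu>))"
    unfolding defect'[abs_def] using \<sigma>
    by (intro wiener_add small1 small2 small3 small4) auto
  then have "wiener \<sigma>' (defect u' lam') (err (Suc \<nu>))"
  proof (rule wiener_mono[OF _ order_refl])
    \<comment> \<open>The four fractions 1/32, 1/16, 1/12 and 1/15 add up to 39/160, just below the
      required 1/4.\<close>
    have "b * err \<nu> \<le> 1 / 15 * err \<nu>" using b err_nonneg by (intro mult_right_mono) auto
    then show "(err \<nu> / 32 + err \<nu> / 16) + (err \<nu> / 12 + b * err \<nu>) \<le> err (Suc \<nu>)"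
      using err_nonneg[of \<nu>] by (simp add: err_Suc)
  qed
  then have "kam_inv (Suc \<nu>) u' lam'"
    using u'1 u'2 u'3 lam' by (simp add: kam_inv_def \<sigma>'_def)
  moreover have "wbd (s - r) (\<lambda>k. u' k - u k) (1 / 2 ^ \<nu>)"
  proof (rule wbd_mono[OF g])
    show "s - r \<le> \<rho>" using width_ge[of "Suc \<nu>"] \<rho>(4) by (simp add: \<sigma>'_def)
    have "f * 1 \<le> f * t" using t f0 by (intro mult_left_mono) auto
    then have "f * (16 / 15) \<le> 1 / 2 ^ \<nu> / 32 * (16 / 15)" using ft by (intro mult_right_mono) auto
    also have "\<dots> \<le> 1 / 2 ^ \<nu>" by (simp add: field_simps)
    finally show "f + f * b \<le> 1 / 2 ^ \<nu>" using fb by linarith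
  qed (simp add: u'_def)
  ultimately show ?thesis using \<delta>_le by blast
qed

end

section \<open>Convergence of the iteration\<close>

lemma tendsto_max_normI:
  fixes x :: "nat \<Rightarrow> 'a::real_normed_vector^'n"
  assumes "\<And>n. max_norm (x n - L) \<le> B n" "B \<longlonglongrightarrow> 0"
  shows "x \<longlonglongrightarrow> L"
proof (rule LIM_zero_cancel, rule Lim_null_comparison)
  show "\<forall>\<^sub>F n in sequentially. norm (x n - L) \<le> real CARD('n) * B n"
    using assms(1) by (intro always_eventually allI order_trans[OF norm_le_max_norm] mult_left_mono) auto
  show "(\<lambda>n. real CARD('n) * B n) \<longlonglongrightarrow> 0"
    using assms(2) by (rule tendsto_mult_right_zero)
qed

lemma tendsto_max_norm:
  "(x \<longlongrightarrow> L) F \<Longrightarrow> ((\<lambda>n. max_norm (x n)) \<longlongrightarrow> max_norm L) F"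
  by (rule continuous_on_tendsto_compose[of UNIV max_norm])
    (auto intro!: continuous_on_max_norm continuous_on_id)

lemma geometric_steps_convergent:
  fixes x :: "nat \<Rightarrow> 'a::banach^'n"
  assumes "\<And>n. max_norm (x (Suc n) - x n) \<le> C * (1 / 2) ^ n"
  shows "convergent x"
proof -
  have "summable (\<lambda>n. x (Suc n) - x n)"
  proof (rule summable_comparison_test')
    show "summable (\<lambda>n. real CARD('n) * (C * (1 / 2) ^ n))"
      by (intro summable_mult summable_geometric) simp
    show "norm (x (Suc n) - x n) \<le> real CARD('n) * (C * (1 / 2) ^ n)" for n
      using assms[of n] by (intro order_trans[OF norm_le_max_norm] mult_left_mono) auto
  qed
  then have "convergent (\<lambda>n. (\<Sum>i<n. x (Suc i) - x i) + x 0)"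
    unfolding summable_iff_convergent by (intro convergent_add convergent_const)
  then show ?thesis by (simp add: sum_lessThan_telescope)
qed

text \<open>Each inequality in \<open>wbd\<close> involves only finitely many coefficients, so
  pointwise convergence of the coefficients is enough.\<close>

lemma wbd_tendsto:
  fixes c :: "nat \<Rightarrow> int^'n \<Rightarrow> complex^'n"
  assumes "\<And>n. n \<ge> N \<Longrightarrow> wbd s (c n) M" "\<And>k. (\<lambda>n. c n k) \<longlonglongrightarrow> d k"
  shows "wbd s d M"
  unfolding wbd_def
proof safe
  fix K :: "(int^'n) set" assume K: "finite K"
  have "(\<lambda>n. \<Sum>k\<in>K. max_norm (c n k) * exp (s * sum_norm k)) \<longlonglongrightarrow>
      (\<Sum>k\<in>K. max_norm (d k) * exp (s * sum_norm k))"
    by (intro tendsto_sum tendsto_mult tendsto_max_norm tendsto_const assms(2))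
  then show "(\<Sum>k\<in>K. max_norm (d k) * exp (s * sum_norm k)) \<le> M"
    by (rule LIMSEQ_le_const2) (use assms(1) K in \<open>auto simp: wbd_def\<close>)
qed

context kam_setup
begin

lemma kam_sequence:
  obtains u lam where "\<And>\<nu>. kam_inv \<nu> (u \<nu>) (lam \<nu>)"
    "\<And>\<nu>. wbd (s - r) (\<lambda>k. u (Suc \<nu>) k - u \<nu> k) (1 / 2 ^ \<nu>)"
    "\<And>\<nu>. max_norm (lam (Suc \<nu>) - lam \<nu>) \<le> err \<nu>"
proof -
  have "\<exists>X. \<forall>\<nu>. kam_inv \<nu> (fst (X \<nu>)) (snd (X \<nu>)) \<and>
      (wbd (s - r) (\<lambda>k. fst (X (Suc \<nu>)) k - fst (X \<nu>) k) (1 / 2 ^ \<nu>) \<and>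
       max_norm (snd (X (Suc \<nu>)) - snd (X \<nu>)) \<le> err \<nu>)"
  proof (rule dependent_nat_choice)
    show "\<exists>x. kam_inv 0 (fst x) (snd x)" using kam_inv_0 by (intro exI[of _ "(\<lambda>_. 0, \<omega>)"]) simp
    fix x \<nu> assume "kam_inv \<nu> (fst x) (snd x)"
    then obtain u' lam' where "kam_inv (Suc \<nu>) u' lam'" "wbd (s - r) (\<lambda>k. u' k - fst x k) (1 / 2 ^ \<nu>)"
      "max_norm (lam' - snd x) \<le> err \<nu>"
      using kam_step by blast
    then show "\<exists>y. kam_inv (Suc \<nu>) (fst y) (snd y) \<and>
        wbd (s - r) (\<lambda>k. fst y k - fst x k) (1 / 2 ^ \<nu>) \<and> max_norm (snd y - snd x) \<le> err \<nu>"
      by (intro exI[of _ "(u', lam')"]) simp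
  qed
  then obtain X where X: "\<And>\<nu>. kam_inv \<nu> (fst (X \<nu>)) (snd (X \<nu>)) \<and>
      (wbd (s - r) (\<lambda>k. fst (X (Suc \<nu>)) k - fst (X \<nu>) k) (1 / 2 ^ \<nu>) \<and>
       max_norm (snd (X (Suc \<nu>)) - snd (X \<nu>)) \<le> err \<nu>)" by blast
  show thesis
    by (rule that[of "\<lambda>\<nu>. fst (X \<nu>)" "\<lambda>\<nu>. snd (X \<nu>)"]) (use X in auto)
qed

lemma sr_pos: "0 < s - r"
  using r by simp

lemma s_pos: "0 < s"
  using r T(3)[of 0] by simp

lemma kam_limit:
  obtains u lam where "csym u" "wbd (s - r) u r" "wbd (s - r) (\<lambda>k. sum_norm k *\<^sub>R u k) (1 / 15)"
    "max_norm (lam - \<omega>) \<le> h / 8" "\<And>\<theta>. defect u lam \<theta> = 0"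
proof -
  obtain u lam where inv: "\<And>\<nu>. kam_inv \<nu> (u \<nu>) (lam \<nu>)"
    and du: "\<And>\<nu>. wbd (s - r) (\<lambda>k. u (Suc \<nu>) k - u \<nu> k) (1 / 2 ^ \<nu>)"
    and dlam: "\<And>\<nu>. max_norm (lam (Suc \<nu>) - lam \<nu>) \<le> err \<nu>"
    using kam_sequence by blast
  have "convergent (\<lambda>\<nu>. u \<nu> k)" for k
  proof (rule geometric_steps_convergent[where C = 1])
    fix \<nu>
    have "max_norm (u (Suc \<nu>) k - u \<nu> k) * 1 \<le> max_norm (u (Suc \<nu>) k - u \<nu> k) * exp ((s - r) * sum_norm k)"
      using sr_pos by (intro mult_left_mono) auto
    then show "max_norm (u (Suc \<nu>) k - u \<nu> k) \<le> 1 * (1 / 2) ^ \<nu>"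
      using wbd_nth[OF du, of \<nu> k] by (simp add: power_one_over)
  qed
  then obtain U where U: "\<And>k. (\<lambda>\<nu>. u \<nu> k) \<longlonglongrightarrow> U k" unfolding convergent_def by metis
  have "convergent lam"
  proof (rule geometric_steps_convergent[where C = \<epsilon>])
    fix \<nu>
    have "(1 / 4 :: real) ^ \<nu> \<le> (1 / 2) ^ \<nu>" by (rule power_mono) simp_all
    then have "err \<nu> \<le> \<epsilon> * (1 / 2) ^ \<nu>"
      using mult_left_mono[of "(1/4) ^ \<nu>" "(1/2) ^ \<nu>" \<epsilon>] \<epsilon>(1) by (simp add: err_def power_one_over)
    then show "max_norm (lam (Suc \<nu>) - lam \<nu>) \<le> \<epsilon> * (1 / 2) ^ \<nu>" using dlam[of \<nu>] by linarith
  qed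
  then obtain L where L: "lam \<longlonglongrightarrow> L" unfolding convergent_def by blast

  have u1: "wbd (s - r) (u \<nu>) r" for \<nu>
    by (rule wbd_mono[of "width \<nu>" _ "s - width \<nu>"])
      (use inv[of \<nu>] width_ge[of \<nu>] in \<open>auto simp: kam_inv_def\<close>)
  have u2: "wbd (s - r) (\<lambda>k. sum_norm k *\<^sub>R u \<nu> k) (1 / 15)" for \<nu>
    by (rule wbd_mono[of "width \<nu>" _ "(1 - 1 / 2 ^ \<nu>) / 15"])
      (use inv[of \<nu>] width_ge[of \<nu>] in \<open>auto simp: kam_inv_def\<close>)
  have U1: "wbd (s - r) U r" by (rule wbd_tendsto[where c = u, OF u1 U])
  have U2: "wbd (s - r) (\<lambda>k. sum_norm k *\<^sub>R U k) (1 / 15)"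
    by (rule wbd_tendsto[where c = "\<lambda>\<nu> k. sum_norm k *\<^sub>R u \<nu> k", OF u2])
      (intro tendsto_scaleR tendsto_const U)
  have usym: "csym (u \<nu>)" for \<nu> using inv by (auto simp: kam_inv_def)
  have Usym: "csym U"
    unfolding csym_def
  proof
    fix k
    have "(\<lambda>\<nu>. vcnj (u \<nu> (- k))) \<longlonglongrightarrow> vcnj (U (- k))"
      by (intro bounded_linear.tendsto[OF bounded_linear_vcnj] U)
    then show "vcnj (U (- k)) = U k"
      unfolding csym_D[OF usym] by (rule LIMSEQ_unique[OF _ U])
  qed
  have lam8: "max_norm (lam \<nu> - \<omega>) \<le> h / 8" for \<nu>
    using inv[of \<nu>] max_norm_le_h8 by (auto simp: kam_inv_def)
  have L8: "max_norm (L - \<omega>) \<le> h / 8"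
    by (rule LIMSEQ_le_const2[OF tendsto_max_norm[OF tendsto_diff[OF L tendsto_const]]])
      (use lam8 in auto)
  have near: "max_norm (\<mu> - \<omega>) < h" if "max_norm (\<mu> - \<omega>) \<le> h / 8" for \<mu>
    using that h by linarith

  \<comment> \<open>Telescoping the increments at the common width \<open>s - r\<close> gives an
    explicit rate in the weighted norm, not only convergence of each coefficient.\<close>
  have tail: "wbd (s - r) (\<lambda>k. U k - u \<nu> k) (2 / 2 ^ \<nu>)" for \<nu>
  proof (rule wbd_tendsto[where N = \<nu> and c = "\<lambda>n k. u n k - u \<nu> k"])
    have *: "wbd (s - r) (\<lambda>k. u (\<nu> + j) k - u \<nu> k) (2 / 2 ^ \<nu> - 2 / 2 ^ (\<nu> + j))" for j
    proof (induction j)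
      case 0
      then show ?case by (simp add: wbd_def)
    next
      case (Suc j)
      have "wbd (s - r) (\<lambda>k. u (\<nu> + Suc j) k - u \<nu> k)
        ((2 / 2 ^ \<nu> - 2 / 2 ^ (\<nu> + j)) + 1 / 2 ^ (\<nu> + j))"
        by (rule wbd_add[OF Suc du[of "\<nu> + j"]]) simp
      moreover have "(2 / 2 ^ \<nu> - 2 / 2 ^ (\<nu> + j)) + 1 / 2 ^ (\<nu> + j) = (2 / 2 ^ \<nu> - 2 / 2 ^ (\<nu> + Suc j) :: real)"
        by (simp add: power_add)
      ultimately show ?case by simp
    qed
    show "wbd (s - r) (\<lambda>k. u n k - u \<nu> k) (2 / 2 ^ \<nu>)" if n: "n \<ge> \<nu>" for n
    proof -
      obtain j where "n = \<nu> + j" using n le_Suc_ex by blast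
      then show ?thesis by (intro wbd_mono[OF *[of j]]) auto
    qed
    show "(\<lambda>n. u n k - u \<nu> k) \<longlonglongrightarrow> U k - u \<nu> k" for k
      by (intro tendsto_diff U tendsto_const)
  qed
  have pow0: "(\<lambda>\<nu>. C / 2 ^ \<nu> :: real) \<longlonglongrightarrow> 0" for C
    using tendsto_mult_right_zero[OF LIMSEQ_realpow_zero[of "1/2"], of C]
    by (simp add: power_one_over)
  have zero: "defect U L \<theta> = 0" for \<theta>
  proof -
    have w: "(\<lambda>\<nu>. wser (u \<nu>) (cvec \<theta>)) \<longlonglongrightarrow> wser U (cvec \<theta>)" for \<theta>
    proof (rule tendsto_max_normI[OF _ pow0[of 2]])
      fix \<nu>
      have "wser (\<lambda>k. U k - u \<nu> k) (cvec \<theta>) = wser U (cvec \<theta>) - wser (u \<nu>) (cvec \<theta>)"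
        using sr_pos by (intro wser_diff[OF U1 u1]) simp
      then show "max_norm (wser (u \<nu>) (cvec \<theta>) - wser U (cvec \<theta>)) \<le> 2 / 2 ^ \<nu>"
        using wser_summable_real(2)[OF tail, of \<nu> \<theta>] sr_pos by (simp add: max_norm_diff_commute)
    qed
    have d: "(\<lambda>\<nu>. dser (u \<nu>) (cvec \<theta>) (cvec \<omega>)) \<longlonglongrightarrow> dser U (cvec \<theta>) (cvec \<omega>)"
    proof (rule tendsto_max_normI[OF _ pow0[of "2 / (s - r) * max_norm \<omega>"]])
      fix \<nu>
      have "(\<lambda>k. (\<i> * cpair k (cvec \<omega>)) *s (U k - u \<nu> k)) =
          (\<lambda>k. (\<i> * cpair k (cvec \<omega>)) *s U k - (\<i> * cpair k (cvec \<omega>)) *s u \<nu> k)"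
        by (simp add: fun_eq_iff vec_eq_iff algebra_simps)
      then have "dser (\<lambda>k. U k - u \<nu> k) (cvec \<theta>) (cvec \<omega>) =
          dser U (cvec \<theta>) (cvec \<omega>) - dser (u \<nu>) (cvec \<theta>) (cvec \<omega>)"
        unfolding dser_def using sr_pos
        by (simp only:) (intro wser_diff[OF wbd_cpair_coeff[OF U2] wbd_cpair_coeff[OF u2]], simp)
      \<comment> \<open>All of the width \<open>s - r\<close> is given up for the derivative: only
        values at real angles are compared, so width 0 suffices.\<close>
      moreover have db: "wbd 0 (\<lambda>k. sum_norm k *\<^sub>R (U k - u \<nu> k)) (2 / 2 ^ \<nu> / (s - r))"
        by (rule wbd_diff_loss) (use tail sr_pos in simp_all)
      have "max_norm (dser (\<lambda>k. U k - u \<nu> k) (cvec \<theta>) (cvec \<omega>)) \<le> 2 / 2 ^ \<nu> / (s - r) * max_norm \<omega>"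
        using dser_bound[OF db, of "cvec \<theta>" "cvec \<omega>"] by simp
      ultimately show "max_norm (dser (u \<nu>) (cvec \<theta>) (cvec \<omega>) - dser U (cvec \<theta>) (cvec \<omega>))
          \<le> 2 / (s - r) * max_norm \<omega> / 2 ^ \<nu>"
        by (simp add: max_norm_diff_commute mult_ac)
    qed
    define y where "y \<nu> = \<theta> + Re_vec (wser (u \<nu>) (cvec \<theta>))" for \<nu>
    define Y where "Y = \<theta> + Re_vec (wser U (cvec \<theta>))"
    have yY: "y \<longlonglongrightarrow> Y"
      unfolding y_def Y_def
      by (intro tendsto_add tendsto_const bounded_linear.tendsto[OF bounded_linear_Re_vec] w)
    have cy: "cvec \<theta> + wser (u \<nu>) (cvec \<theta>) = cvec (y \<nu>)" for \<nu>
      using csym_iff_real[OF u1, of \<nu>] usym sr_pos by (simp add: y_def cvec_add cvec_Re_vec)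
    have cY: "cvec \<theta> + wser U (cvec \<theta>) = cvec Y"
      using csym_iff_real[OF U1] Usym sr_pos by (simp add: Y_def cvec_add cvec_Re_vec)
    \<comment> \<open>Parameter and argument move at the same time. Continuity in the angle is used
      at the limiting parameter, and the Lipschitz bound compares parameters at a common
      angle.\<close>
    have "(\<lambda>\<nu>. wser (p L) (cvec (y \<nu>))) \<longlonglongrightarrow> wser (p L) (cvec Y)"
      by (rule continuous_on_tendsto_compose[OF wser_continuous_real[OF p_wbd[OF near[OF L8]]] yY])
        (use s_pos in auto)
    moreover have "(\<lambda>\<nu>. wser (p (lam \<nu>)) (cvec (y \<nu>)) - wser (p L) (cvec (y \<nu>))) \<longlonglongrightarrow> 0"
    proof (rule tendsto_max_normI)
      fix \<nu>
      have "wser (\<lambda>k. p (lam \<nu>) k - p L k) (cvec (y \<nu>)) = wser (p (lam \<nu>)) (cvec (y \<nu>)) - wser (p L) (cvec (y \<nu>))"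
        using s_pos by (intro wser_diff[OF p_wbd[OF near[OF lam8]] p_wbd[OF near[OF L8]]]) simp
      then show "max_norm (wser (p (lam \<nu>)) (cvec (y \<nu>)) - wser (p L) (cvec (y \<nu>)) - 0) \<le> max_norm (lam \<nu> - L) / 12"
        using wser_summable_real(2)[OF p_lipschitz[OF L8 lam8], of \<nu> "y \<nu>"] s_pos by simp
      have "(\<lambda>\<nu>. max_norm (lam \<nu> - L) / 12) \<longlonglongrightarrow> max_norm (L - L) / 12"
        by (intro tendsto_divide tendsto_max_norm tendsto_diff L tendsto_const) simp
      then show "(\<lambda>\<nu>. max_norm (lam \<nu> - L) / 12) \<longlonglongrightarrow> 0" by simp
    qed
    ultimately have "(\<lambda>\<nu>. wser (p L) (cvec (y \<nu>)) + (wser (p (lam \<nu>)) (cvec (y \<nu>)) - wser (p L) (cvec (y \<nu>))))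
        \<longlonglongrightarrow> wser (p L) (cvec Y) + 0" by (rule tendsto_add)
    then have pc: "(\<lambda>\<nu>. wser (p (lam \<nu>)) (cvec (y \<nu>))) \<longlonglongrightarrow> wser (p L) (cvec Y)" by simp
    have "(\<lambda>\<nu>. defect (u \<nu>) (lam \<nu>) \<theta>) \<longlonglongrightarrow> defect U L \<theta>"
      unfolding defect_def cy cY
      by (intro tendsto_diff tendsto_add tendsto_const pc d bounded_linear.tendsto[OF bounded_linear_cvec] L)
    moreover have "(\<lambda>\<nu>. defect (u \<nu>) (lam \<nu>) \<theta>) \<longlonglongrightarrow> 0"
    proof (rule tendsto_max_normI)
      fix \<nu>
      show "max_norm (defect (u \<nu>) (lam \<nu>) \<theta> - 0) \<le> err \<nu>"
        using wiener_max_norm_le[of "width \<nu>" "defect (u \<nu>) (lam \<nu>)" "err \<nu>"] inv[of \<nu>] width_pos[of \<nu>]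
        by (simp add: kam_inv_def)
      show "err \<longlonglongrightarrow> 0"
        using tendsto_mult_right_zero[OF LIMSEQ_realpow_zero[of "1/4"], of \<epsilon>]
        by (simp add: err_def[abs_def] power_one_over)
    qed
    ultimately show ?thesis by (rule LIMSEQ_unique)
  qed
  show thesis by (rule that[OF Usym U1 U2 L8 zero])
qed

text \<open>Composing with a translation removes the mean value of the conjugacy.\<close>

lemma kam_limit_normalised:
  obtains v lam where "csym v" "v 0 = 0" "wbd (s - r) v r"
    "wbd (s - r) (\<lambda>k. sum_norm k *\<^sub>R v k) (1 / 15)"
    "max_norm (lam - \<omega>) \<le> h / 8" "\<And>\<theta>. defect v lam \<theta> = 0"
proof -
  obtain u lam where u: "csym u" "wbd (s - r) u r" "wbd (s - r) (\<lambda>k. sum_norm k *\<^sub>R u k) (1 / 15)"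
    and lam: "max_norm (lam - \<omega>) \<le> h / 8" and zero: "\<And>\<theta>. defect u lam \<theta> = 0"
    using kam_limit by blast
  \<comment> \<open>With this translation \<open>(id + u) (\<theta> + c) - \<theta>\<close> has mean
    value \<open>u 0 + cvec c = 0\<close>. A constant vector field is invariant under translations,
    so the conjugacy is preserved.\<close>
  define c where "c = - Re_vec (u 0)"
  have c: "cvec c = - u 0"
    using csym_D[OF u(1), of 0] by (simp add: c_def cvec_minus range_cvec_iff cvec_Re_vec)
  \<comment> \<open>A real translation multiplies each coefficient by a number of modulus 1, so all
    bounds on \<open>u\<close> carry over.\<close>
  define v where "v k = (if k = 0 then 0 else exp (\<i> * cpair k (cvec c)) *s u k)" for k
  have v_le: "max_norm (v k) \<le> max_norm (u k)" for k
    by (simp add: v_def max_norm_smult cpair_cvec)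
  have v1: "wbd (s - r) v r" by (rule wbd_mono[OF u(2) order_refl order_refl v_le])
  have v2: "wbd (s - r) (\<lambda>k. sum_norm k *\<^sub>R v k) (1 / 15)"
    by (rule wbd_mono[OF u(3) order_refl order_refl]) (simp add: max_norm_scaleR mult_left_mono v_le)
  have wv: "wser v (cvec \<theta>) = wser u (cvec (\<theta> + c)) + cvec c" for \<theta>
  proof -
    have "exp (\<i> * cpair k (cvec \<theta>)) *s v k =
        exp (\<i> * cpair k (cvec (\<theta> + c))) *s u k - exp (\<i> * cpair k (cvec (\<theta> + c))) *s (if k = 0 then u 0 else 0)" for k
      by (simp add: v_def cvec_add cpair_add exp_add distrib_left vector_smult_assoc)
    then have "wser v (cvec \<theta>) = wser u (cvec (\<theta> + c)) - wser (\<lambda>k. if k = 0 then u 0 else 0) (cvec (\<theta> + c))"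
      unfolding wser_def using sr_pos
      by (simp only:) (intro infsum_diff wser_summable_real(1)[OF u(2)] wser_summable_real(1)[OF wbd_single[of "s - r"]], simp_all)
    then show ?thesis by (simp add: wser_single c)
  qed
  have dv: "dser v (cvec \<theta>) (cvec \<omega>) = dser u (cvec (\<theta> + c)) (cvec \<omega>)" for \<theta>
    unfolding dser_def wser_def
    by (intro infsum_cong) (simp add: v_def cvec_add cpair_add exp_add distrib_left vector_smult_assoc mult_ac)
  have dz: "defect v lam \<theta> = 0" for \<theta>
    using zero[of "\<theta> + c"] unfolding defect_def wv dv by (simp add: cvec_add add_ac)
  have "wser v (cvec \<theta>) \<in> range cvec" for \<theta>
  proof -
    have "wser u (cvec (\<theta> + c)) \<in> range cvec" using csym_iff_real[OF u(2)] u(1) sr_pos by simp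
    then obtain x where "wser u (cvec (\<theta> + c)) = cvec x" by blast
    then show ?thesis unfolding wv by (simp only: cvec_add[symmetric] rangeI)
  qed
  then have "csym v" using csym_iff_real[OF v1] sr_pos by simp
  moreover have "v 0 = 0" by (simp add: v_def)
  ultimately show thesis using that v1 v2 lam dz by blast
qed

text \<open>The final estimates come from the Fourier coefficients of the conjugacy equation, not from
  the iteration.\<close>

lemma kam_estimates:
  assumes v: "v 0 = 0" "wbd (s - r) v r" "wbd (s - r) (\<lambda>k. sum_norm k *\<^sub>R v k) D"
    and lam: "max_norm (lam - \<omega>) < h" and zero: "\<And>\<theta>. defect v lam \<theta> = 0"
    and \<Delta>_exp: "\<And>k. k \<ge> 1 \<Longrightarrow> \<Delta> k * exp (- r * k) \<le> Lam \<Delta> \<tau>"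
  shows "max_norm (lam - \<omega>) \<le> \<epsilon>" "wbd (s - 2 * r) v (Lam \<Delta> \<tau> / \<alpha> * \<epsilon>)"
proof -
  \<comment> \<open>The embedding is bounded by \<open>r\<close> at width \<open>s - r\<close>,
    which together use the width \<open>s\<close> exactly, so the composed perturbation keeps the
    full bound \<open>\<epsilon>\<close>.\<close>
  have "wiener (s - r) (\<lambda>\<theta>. wser (p lam) (cvec \<theta> + wser v (cvec \<theta>))) \<epsilon>"
    by (rule wiener_compose[OF wienerI[OF v(2) refl]]) (use sr_pos p_wbd[OF lam] in auto)
  then obtain g where g: "wbd (s - r) g \<epsilon>"
    and g_eq: "\<And>\<theta>. wser (p lam) (cvec \<theta> + wser v (cvec \<theta>)) = wser g (cvec \<theta>)"
    unfolding wiener_def by blast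
  define d where "d k = (\<i> * cpair k (cvec \<omega>)) *s v k" for k
  have d: "wbd (s - r) d (norm \<i> * max_norm (cvec \<omega>) * D)"
    unfolding d_def by (rule wbd_cpair_coeff[OF v(3)])
  let ?m = "\<lambda>k. if k = 0 then cvec (lam - \<omega>) else 0 :: complex^'n"
  have m: "wbd (s - r) ?m (max_norm (lam - \<omega>))"
    using wbd_single[of "s - r" 0 "cvec (lam - \<omega>)"] by simp
  have "wser (\<lambda>k. g k + ?m k) (cvec \<theta>) = wser d (cvec \<theta>)" for \<theta>
  proof -
    have "wser (\<lambda>k. g k + ?m k) (cvec \<theta>) = wser g (cvec \<theta>) + cvec (lam - \<omega>)"
      using sr_pos by (subst wser_add[OF g m]) (auto simp: wser_single)
    also have "\<dots> = wser d (cvec \<theta>)"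
      using zero[of \<theta>] unfolding defect_def g_eq dser_def d_def[symmetric]
      by (simp add: cvec_diff algebra_simps)
    finally show ?thesis .
  qed
  then have "fourier_coeff (\<lambda>\<theta>. wser (\<lambda>k. g k + ?m k) (cvec \<theta>)) k = fourier_coeff (\<lambda>\<theta>. wser d (cvec \<theta>)) k" for k
    by simp
  \<comment> \<open>The conjugacy equation frequency by frequency: at 0 it determines the shift of
    the parameter, elsewhere it gives \<open>v k\<close> as \<open>g k\<close> over the
    divisor.\<close>
  then have coeff: "g k + ?m k = d k" for k
    using sr_pos by (simp only: fourier_coeff_wser[OF d] fourier_coeff_wser[OF wbd_add[OF g m refl]] less_imp_le)
  have "cvec (lam - \<omega>) = - g 0" using coeff[of 0] by (simp add: d_def v(1) eq_neg_iff_add_eq_0 add.commute)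
  then have "max_norm (lam - \<omega>) = max_norm (g 0)" by (metis max_norm_cvec max_norm_minus)
  then show "max_norm (lam - \<omega>) \<le> \<epsilon>" using wbd_nth[OF g, of 0] by simp
  have L0: "0 \<le> Lam \<Delta> \<tau>" using Lam_ge_1[OF \<Delta> \<tau>] by simp
  show "wbd (s - 2 * r) v (Lam \<Delta> \<tau> / \<alpha> * \<epsilon>)"
  proof (rule wbd_compare[OF g _ order_refl])
    show "0 \<le> Lam \<Delta> \<tau> / \<alpha>" using L0 \<alpha> by simp
    fix k :: "int^'n"
    show "max_norm (v k) * exp ((s - 2 * r) * sum_norm k)
        \<le> Lam \<Delta> \<tau> / \<alpha> * (max_norm (g k) * exp ((s - r) * sum_norm k))"
      proof (cases "k = 0")
        case True
        \<comment> \<open>The divisor vanishes at \<open>k = 0\<close> and the equation leaves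
          \<open>v 0\<close> free; the normalisation settles this case.\<close>
        then show ?thesis using L0 \<alpha> by (simp add: v(1))
      next
        case False
        have k: "1 \<le> sum_norm k" by (rule sum_norm_ge_1[OF False])
        have Dk: "1 \<le> \<Delta> (sum_norm k)" by (rule ruessmann_ge_1[OF \<Delta> k])
        have "g k = d k" using coeff[of k] False by simp
        then have "max_norm (g k) = \<bar>pairing k \<omega>\<bar> * max_norm (v k)"
          by (simp add: d_def max_norm_smult norm_mult cpair_cvec)
        then have "\<alpha> / \<Delta> (sum_norm k) * max_norm (v k) \<le> max_norm (g k)"
          using mult_right_mono[OF dioph[OF False], of "max_norm (v k)"] by simp
        then have "max_norm (v k) \<le> \<Delta> (sum_norm k) / \<alpha> * max_norm (g k)"
          using \<alpha> Dk by (simp add: field_simps)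
        moreover have split: "exp ((s - 2 * r) * sum_norm k) = exp (- r * sum_norm k) * exp ((s - r) * sum_norm k)"
          by (simp add: exp_add[symmetric] algebra_simps)
        ultimately have "max_norm (v k) * exp ((s - 2 * r) * sum_norm k)
          \<le> \<Delta> (sum_norm k) / \<alpha> * max_norm (g k) * exp ((s - 2 * r) * sum_norm k)"
          by (intro mult_right_mono) simp_all
        also have "\<dots> = (\<Delta> (sum_norm k) * exp (- r * sum_norm k)) * (max_norm (g k) * exp ((s - r) * sum_norm k) / \<alpha>)"
          unfolding split by simp
        also have "\<dots> \<le> Lam \<Delta> \<tau> * (max_norm (g k) * exp ((s - r) * sum_norm k) / \<alpha>)"
          using \<alpha> by (intro mult_right_mono \<Delta>_exp k) auto
        finally show ?thesis by simp
      qed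
  qed
qed

end

section \<open>The conjugating diffeomorphism\<close>

lemma complex_linear_matrix:
  fixes f :: "complex^'m \<Rightarrow> complex^'n"
  assumes "\<And>x y. f (x + y) = f x + f y" "\<And>a x. f (a *s x) = a *s f x"
  shows "\<exists>A :: complex^'m^'n. f = (\<lambda>u. A *v u)"
proof -
  have "Vector_Spaces.linear (*s) (*s) f"
    unfolding Vector_Spaces.linear_iff by (intro conjI allI assms vec.vector_space_axioms)
  then have "f = (\<lambda>u. matrix f *v u)" by (simp add: fun_eq_iff matrix_works)
  then show ?thesis by blast
qed

lemma open_strip: "open (strip \<sigma>)"
proof -
  have "bounded_linear (Im_vec :: complex^'n \<Rightarrow> real^'n)"
  proof (rule bounded_linear_intro[where K = "real CARD('n)"])
    show "norm (Im_vec z) \<le> norm z * real CARD('n)" for z :: "complex^'n"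
    proof -
      have "norm (Im_vec z) \<le> real CARD('n) * max_norm (Im_vec z)" by (rule norm_le_max_norm)
      also have "\<dots> \<le> real CARD('n) * norm z"
        using order_trans[OF max_norm_Im_vec max_norm_le_norm] by (intro mult_left_mono) auto
      finally show ?thesis by (simp add: mult.commute)
    qed
  qed (simp_all add: Im_vec_def vec_eq_iff)
  then have "continuous_on UNIV (Im_vec :: complex^'n \<Rightarrow> real^'n)"
    by (rule bounded_linear.continuous_on) (rule continuous_on_id)
  then show ?thesis
    unfolding strip_def by (intro open_Collect_less continuous_intros)
qed

context
  fixes v :: "int^'n \<Rightarrow> complex^'n" and \<sigma> M b :: real
  assumes \<sigma>: "\<sigma> > 0" and sym: "csym v" and v: "wbd \<sigma> v M" "wbd \<sigma> (\<lambda>k. sum_norm k *\<^sub>R v k) b"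
    and b: "b < 1"
begin

abbreviation (input) "psi \<theta> \<equiv> \<theta> + Re_vec (wser v (cvec \<theta>))"
abbreviation (input) "cpsi z \<equiv> z + wser v z"

lemma wser_v_real: "cvec (Re_vec (wser v (cvec \<theta>))) = wser v (cvec \<theta>)"
  using csym_iff_real[OF v(1)] sym \<sigma> by (intro cvec_Re_vec) simp

lemma cvec_psi: "cvec (psi \<theta>) = cpsi (cvec \<theta>)"
  by (simp add: cvec_add wser_v_real)

lemma strip_Im: "z \<in> strip \<sigma> \<Longrightarrow> max_norm (Im_vec z) \<le> \<sigma>"
  by (simp add: strip_def)

lemma cvec_strip: "cvec \<theta> \<in> strip \<sigma>"
  using \<sigma> by (simp add: strip_def)

text \<open>A perturbation of the identity with Lipschitz constant \<open>b < 1\<close> cannot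
  identify two points.\<close>

lemma inj_cpsi: "inj_on (\<lambda>z. cpsi z) (strip \<sigma>)"
proof (rule inj_onI)
  fix z w assume zw: "z \<in> strip \<sigma>" "w \<in> strip \<sigma>" and eq: "z + wser v z = w + wser v w"
  then have "z - w = wser v w - wser v z" by (simp add: algebra_simps)
  then have "max_norm (z - w) \<le> b * max_norm (z - w)"
    using wser_lipschitz[OF v strip_Im[OF zw(2)] strip_Im[OF zw(1)]] by (metis max_norm_diff_commute)
  then have "(1 - b) * max_norm (z - w) \<le> 0" by (simp add: algebra_simps)
  then have "max_norm (z - w) \<le> 0" using b by (simp add: mult_le_0_iff)
  then have "max_norm (z - w) = 0" using max_norm_nonneg[of "z - w"] by linarith
  then show "z = w" by simp
qed

lemma cpsi_has_derivative:
  "z \<in> strip \<sigma> \<Longrightarrow> ((\<lambda>z. cpsi z) has_derivative (\<lambda>u. u + dser v z u)) (at z)"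
  by (intro has_derivative_add has_derivative_ident wser_has_derivative[OF v(1)]) (simp add: strip_def)

lemma cpsi_derivative_linear:
  assumes "z \<in> strip \<sigma>"
  shows "(x + y) + dser v z (x + y) = (x + dser v z x) + (y + dser v z y)"
    "(a *s x) + dser v z (a *s x) = a *s (x + dser v z x)"
  using dser_linear[OF v(2) strip_Im[OF assms]] by (simp_all add: vector_add_ldistrib)

lemma cpsi_derivative_inj:
  assumes "z \<in> strip \<sigma>" "x + dser v z x = 0"
  shows "x = 0"
proof -
  have "max_norm x = max_norm (dser v z x)" using assms(2) by (metis add_eq_0_iff max_norm_minus)
  also have "\<dots> \<le> b * max_norm x" by (rule dser_bound[OF v(2) strip_Im[OF assms(1)]])
  finally have "(1 - b) * max_norm x \<le> 0" by (simp add: algebra_simps)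
  then have "max_norm x \<le> 0" using b by (simp add: mult_le_0_iff)
  then have "max_norm x = 0" using max_norm_nonneg[of x] by linarith
  then show ?thesis by simp
qed

lemma continuous_cpsi: "continuous_on (strip \<sigma>) (\<lambda>z. cpsi z)"
  using cpsi_has_derivative has_derivative_continuous by (blast intro: continuous_at_imp_continuous_on)

lemma inj_psi: "inj (\<lambda>\<theta>. psi \<theta>)"
proof (rule injI)
  fix x y assume "psi x = psi y"
  then have "cpsi (cvec x) = cpsi (cvec y)" unfolding cvec_psi[symmetric] by simp
  then have "cvec x = cvec y" using inj_cpsi cvec_strip by (blast dest: inj_onD)
  then show "x = y" by (metis Re_vec_cvec)
qed

text \<open>A preimage of \<open>x\<close> is a fixed point of
  \<open>y \<mapsto> x - Re_vec (wser v (cvec y))\<close>. The periodic part is bounded on real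
  angles, so this map sends a large ball around \<open>x\<close> to itself and Brouwer's theorem
  applies.\<close>

lemma surj_psi: "surj (\<lambda>\<theta>. psi \<theta>)"
proof -
  have "\<exists>y. psi y = x" for x
  proof -
    define R where "R = real CARD('n) * M + 1"
    have M: "0 \<le> M" using v(1) by (rule wbd_nonneg)
    let ?g = "\<lambda>y. x - Re_vec (wser v (cvec y))"
    have "continuous_on (cball x R) ?g"
      using \<sigma> by (intro continuous_intros bounded_linear.continuous_on[OF bounded_linear_Re_vec]
          continuous_on_subset[OF wser_continuous_real[OF v(1)]]) auto
    moreover have "?g \<in> cball x R \<rightarrow> cball x R"
    proof
      fix y
      have "norm (Re_vec (wser v (cvec y))) \<le> real CARD('n) * max_norm (Re_vec (wser v (cvec y)))"
        by (rule norm_le_max_norm)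
      also have "\<dots> \<le> real CARD('n) * M"
        using order_trans[OF max_norm_Re_vec wser_summable_real(2)[OF v(1)]] \<sigma>
        by (intro mult_left_mono) auto
      finally show "?g y \<in> cball x R" by (simp add: dist_norm R_def)
    qed
    moreover have "R > 0" using M by (simp add: R_def add_nonneg_pos)
    ultimately obtain y where "?g y = y" using brouwer_ball[of R x ?g] by blast
    then have "psi y = x" by (simp add: algebra_simps)
    then show ?thesis by blast
  qed
  then show ?thesis unfolding surj_def by metis
qed

lemma psi_diffeo: "real_analytic_torus_diffeo (\<lambda>\<theta>. psi \<theta>)"
proof -
  have bij: "bij (\<lambda>\<theta>. psi \<theta>)" using inj_psi surj_psi by (simp add: bij_def)
  have "holo_vec_on (\<lambda>z. cpsi z) (strip \<sigma>)"
    unfolding holo_vec_on_def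
  proof (intro conjI open_strip ballI)
    fix z :: "complex^'n" assume z: "z \<in> strip \<sigma>"
    obtain A :: "complex^'n^'n" where A: "(\<lambda>u. u + dser v z u) = (\<lambda>u. A *v u)"
      using complex_linear_matrix[of "\<lambda>u. u + dser v z u", OF cpsi_derivative_linear[OF z]] by blast
    show "\<exists>A :: complex^'n^'n. ((\<lambda>z. cpsi z) has_derivative (\<lambda>u. A *v u)) (at z)"
      using cpsi_has_derivative[OF z] unfolding A by (rule exI[of _ A])
  qed
  then have ra: "real_analytic (\<lambda>\<theta>. psi \<theta>)"
    unfolding real_analytic_def using cvec_psi cvec_strip
    by (intro exI[of _ "\<lambda>z. cpsi z"] exI[of _ "strip \<sigma>"]) auto
  \<comment> \<open>Analyticity of the inverse is obtained on the image of the complex strip, which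
    is open by invariance of domain; there the inverse restricts to the real inverse.\<close>
  define G where "G = inv_into (strip \<sigma>) (\<lambda>z. cpsi z)"
  have G: "G (cpsi z) = z" if "z \<in> strip \<sigma>" for z
    unfolding G_def using inv_into_f_f[OF inj_cpsi that] .
  have "holo_vec_on G ((\<lambda>z. cpsi z) ` strip \<sigma>)"
    unfolding holo_vec_on_def
  proof (intro conjI ballI)
    show "open ((\<lambda>z. cpsi z) ` strip \<sigma>)"
      by (rule invariance_of_domain[OF continuous_cpsi open_strip inj_cpsi])
    fix w assume "w \<in> (\<lambda>z. cpsi z) ` strip \<sigma>"
    then obtain z where z: "z \<in> strip \<sigma>" and w: "w = cpsi z" by blast
    define D where "D u = u + dser v z u" for u
    have der: "((\<lambda>z. cpsi z) has_derivative D) (at z)"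
      using cpsi_has_derivative[OF z] by (simp add: D_def[abs_def])
    have lin: "D (x + y) = D x + D y" "D (a *s x) = a *s D x" for x y a
      unfolding D_def by (rule cpsi_derivative_linear[OF z])+
    have linear: "linear D" using der has_derivative_linear by blast
    have inj: "inj D"
      unfolding linear_injective_0[OF linear] D_def using cpsi_derivative_inj[OF z] by blast
    have surj: "surj D" by (rule linear_inj_imp_surj[OF linear inj])
    have DI: "D (inv D y) = y" for y by (rule surj_f_inv_f[OF surj])
    have ID: "inv D (D x) = x" for x by (rule inv_f_f[OF inj])
    \<comment> \<open>The inverse of a complex-linear bijection is complex-linear, as needed to
      represent the derivative of \<open>G\<close> by a complex matrix.\<close>
    have add: "inv D (x + y) = inv D x + inv D y" for x y
      using ID[of "inv D x + inv D y"] by (simp add: lin DI)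
    have smult: "inv D (a *s x) = a *s inv D x" for a x
      using ID[of "a *s inv D x"] by (simp add: lin DI)
    obtain A :: "complex^'n^'n" where A: "inv D = (\<lambda>u. A *v u)"
      using complex_linear_matrix[of "inv D", OF add smult] by blast
    have "(G has_derivative inv D) (at (cpsi z))"
      by (rule has_derivative_inverse_strong[OF open_strip z continuous_cpsi G der])
        (auto simp: fun_eq_iff DI)
    then show "\<exists>A :: complex^'n^'n. (G has_derivative (\<lambda>u. A *v u)) (at w)"
      unfolding A w by (rule exI[of _ A])
  qed
  moreover have "cvec x \<in> (\<lambda>z. cpsi z) ` strip \<sigma>" and "G (cvec x) = cvec (inv (\<lambda>\<theta>. psi \<theta>) x)" for x
  proof -
    have "cpsi (cvec (inv (\<lambda>\<theta>. psi \<theta>) x)) = cvec x"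
      unfolding cvec_psi[symmetric] using surj_f_inv_f[OF surj_psi, of x] by simp
    then show "cvec x \<in> (\<lambda>z. cpsi z) ` strip \<sigma>" "G (cvec x) = cvec (inv (\<lambda>\<theta>. psi \<theta>) x)"
      using G[OF cvec_strip, of "inv (\<lambda>\<theta>. psi \<theta>) x"] cvec_strip[of "inv (\<lambda>\<theta>. psi \<theta>) x"]
      by (auto simp: image_iff intro!: bexI[of _ "cvec (inv (\<lambda>\<theta>. psi \<theta>) x)"])
  qed
  ultimately have rai: "real_analytic (inv (\<lambda>\<theta>. psi \<theta>))"
    unfolding real_analytic_def
    by (intro exI[of _ G] exI[of _ "(\<lambda>z. cpsi z) ` strip \<sigma>"]) auto
  have "psi (\<theta> + lattice_vec k) = psi \<theta> + lattice_vec k" for \<theta> k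
    by (simp add: cvec_add wser_lattice)
  then show ?thesis
    unfolding real_analytic_torus_diffeo_def using bij ra rai by blast
qed

text \<open>The hypothesis says that the Jacobian of the conjugacy maps \<open>\<omega>\<close> to
  the vector field at the image point. The Jacobian is injective because \<open>b < 1\<close>, so
  its inverse returns \<open>\<omega>\<close>.\<close>

lemma psi_pull_back:
  assumes conj: "\<And>\<theta>. cvec \<omega> + dser v (cvec \<theta>) (cvec \<omega>) = cvec (X (psi \<theta>))"
  shows "pull_back (\<lambda>\<theta>. psi \<theta>) X = (\<lambda>\<theta>. \<omega>)"
proof
  fix \<theta>
  define d where "d w = Re_vec (dser v (cvec \<theta>) (cvec w))" for w
  have d: "dser v (cvec \<theta>) (cvec w) = cvec (d w)" for w
    unfolding d_def
    using csym_iff_real[OF wbd_cpair_coeff[OF v(2), of \<i> "cvec w"]] csym_dser[OF sym, of w] \<sigma>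
    by (intro cvec_Re_vec[symmetric]) (simp add: dser_def)
  have der: "((\<lambda>\<theta>. psi \<theta>) has_derivative (\<lambda>w. w + d w)) (at \<theta>)"
    unfolding d_def
    by (rule has_derivative_add[OF has_derivative_ident bounded_linear.has_derivative[OF
            bounded_linear_Re_vec wser_has_derivative_real[OF v(1) \<sigma>]]])
  note D = frechet_derivative_at[OF der, symmetric] and lin = has_derivative_linear[OF der]
  have "inj (\<lambda>w. w + d w)"
    unfolding linear_injective_0[OF lin]
  proof (intro allI impI)
    fix w assume "w + d w = 0"
    then have "cvec w + dser v (cvec \<theta>) (cvec w) = 0" by (simp add: d flip: cvec_add)
    then have "cvec w = 0" by (rule cpsi_derivative_inj[OF cvec_strip])
    from arg_cong[OF this, of Re_vec] show "w = 0" by (simp add: Re_vec_def zero_vec_def)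
  qed
  from inv_f_f[OF this, of \<omega>] have "inv (\<lambda>w. w + d w) (\<omega> + d \<omega>) = \<omega>" .
  moreover have "\<omega> + d \<omega> = X (psi \<theta>)"
    using arg_cong[OF conj[of \<theta>], of Re_vec] unfolding d cvec_add[symmetric] Re_vec_cvec .
  ultimately have "inv (\<lambda>w. w + d w) (X (psi \<theta>)) = \<omega>" by (simp only:)
  then show "pull_back (\<lambda>\<theta>. psi \<theta>) X \<theta> = \<omega>" by (simp add: pull_back_def D)
qed

end

section \<open>Assembling the theorem over all frequencies\<close>

lemma ball_subset_cnbhd:
  assumes "\<omega> \<in> \<Omega>" "max_norm (\<mu> - cvec \<omega>) < h"
  shows "\<mu> \<in> cnbhd \<Omega> h"
proof -
  have "(INF \<omega>\<in>\<Omega>. ereal (max_norm (\<mu> - cvec \<omega>))) \<le> ereal (max_norm (\<mu> - cvec \<omega>))"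
    using assms(1) by (rule INF_lower)
  also have "\<dots> < ereal h" using assms(2) by simp
  finally show ?thesis by (simp add: cnbhd_def)
qed

theorem mainTheorem1:
  fixes \<alpha> s h \<epsilon> \<tau> r :: real
    and \<Delta> :: "real \<Rightarrow> real"
    and \<Omega> :: "(real^'n) set"
    and P :: "complex^'n \<Rightarrow> complex^'n \<Rightarrow> complex^'n"
  assumes "\<alpha> > 0"
    and "ruessmann \<Delta>"
    and "compact \<Omega>"
    and "\<And>\<omega> k. \<omega> \<in> \<Omega> \<Longrightarrow> k \<noteq> 0 \<Longrightarrow> \<bar>pairing k \<omega>\<bar> \<ge> \<alpha> / \<Delta> (sum_norm k)"
    and "s > 0" and "h > 0"
    and "real_analytic_family s (cnbhd \<Omega> h) (\<lambda>\<theta> \<omega>. \<omega> + P \<theta> \<omega>)"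
    and "\<epsilon> \<ge> 0"
    and "weighted_norm s (cnbhd \<Omega> h) (\<lambda>\<theta> \<omega>. P (cvec \<theta>) \<omega>) = ennreal \<epsilon>"
    and "\<epsilon> < h / 16"
    and "h / 16 \<le> \<alpha> / (32 * Lam \<Delta> \<tau>)"
    and "\<tau> \<ge> 1"
    and "r = 8 * integral {\<tau>..} (\<lambda>t. ln (Lam \<Delta> t) / t\<^sup>2)"
    and "r < s / 2"
  shows "\<exists>(\<phi> :: real^'n \<Rightarrow> real^'n) (\<Phi> :: real^'n \<Rightarrow> real^'n \<Rightarrow> real^'n).
    (\<forall>\<omega>\<in>\<Omega>. cvec (\<phi> \<omega>) \<in> cnbhd \<Omega> h \<and>
       real_analytic_torus_diffeo (\<Phi> \<omega>) \<and>
       pull_back (\<Phi> \<omega>) (\<lambda>\<theta>. \<phi> \<omega> + Re_vec (P (cvec \<theta>) (cvec (\<phi> \<omega>)))) = (\<lambda>\<theta>. \<omega>)) \<and>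
    sup_norm \<Omega> (\<lambda>\<omega>. \<phi> \<omega> - \<omega>) \<le> ennreal \<epsilon> \<and>
    weighted_norm (s - 2 * r) \<Omega> (\<lambda>\<theta> \<omega>. cvec (\<Phi> \<omega> \<theta> - \<theta>)) \<le> ennreal (Lam \<Delta> \<tau> / \<alpha> * \<epsilon>)"
proof -
  note \<alpha> = assms(1) and \<Delta> = assms(2) and s = assms(5) and h = assms(6) and fam = assms(7)
    and \<tau> = assms(12) and r_eq = assms(13)
  let ?W = "cnbhd \<Omega> h"
  obtain T :: "nat \<Rightarrow> real" where "T 0 = \<tau>" and T: "\<And>\<nu>. T \<nu> \<ge> 1"
    "\<And>\<nu>. Lam \<Delta> (T \<nu>) = 2 ^ \<nu> * Lam \<Delta> \<tau>" "\<And>m. (\<Sum>\<nu><m. 3 / T \<nu>) \<le> r"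
    unfolding r_eq by (rule cutoffs_exist[OF \<Delta> \<tau>]) blast
  have less15: "1 / 15 < (1::real)" by simp
  have r0: "0 \<le> r" using T(3)[of 0] by simp
  have norm: "weighted_norm s ?W (\<lambda>\<theta> \<omega>. P (cvec \<theta>) \<omega>) \<le> ennreal \<epsilon>" using assms(9) by simp
  have \<Delta>_exp: "\<Delta> k * exp (- r * k) \<le> Lam \<Delta> \<tau>" if "k \<ge> 1" for k
    using Delta_exp_le_Lam[OF \<Delta> \<tau> that] unfolding r_eq .
  \<comment> \<open>Everything the conclusion needs about one frequency, phrased without the locale
    so that it outlives its interpretation and can be fed to the choice below.\<close>
  define Q where "Q \<omega> lam v \<longleftrightarrow> csym v \<and> wbd (s - r) v r \<and>
      wbd (s - r) (\<lambda>k. sum_norm k *\<^sub>R v k) (1 / 15) \<and> cvec lam \<in> ?W \<and> max_norm (lam - \<omega>) \<le> \<epsilon> \<and>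
      wbd (s - 2 * r) v (Lam \<Delta> \<tau> / \<alpha> * \<epsilon>) \<and>
      (\<forall>\<theta>. cvec \<omega> + dser v (cvec \<theta>) (cvec \<omega>) =
        cvec (lam + Re_vec (P (cvec (\<theta> + Re_vec (wser v (cvec \<theta>)))) (cvec lam))))" for \<omega> lam v
  have "\<exists>lam v. Q \<omega> lam v"
    if \<omega>: "\<omega> \<in> \<Omega>" for \<omega>
  proof -
    note ball = ball_subset_cnbhd[OF \<omega>]
    have ballr: "cvec \<mu> \<in> ?W" if "max_norm (\<mu> - \<omega>) < h" for \<mu>
      using that by (intro ball) (simp add: cvec_diff[symmetric])
    define p where "p \<mu> = fourier_coeff (\<lambda>\<theta>. P (cvec \<theta>) (cvec \<mu>))" for \<mu>
    have p_series: "P (cvec \<theta>) (cvec \<mu>) = wser (p \<mu>) (cvec \<theta>)" if "max_norm (\<mu> - \<omega>) < h" for \<mu> \<theta>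
      unfolding p_def by (rule perturbation_series[OF s ball fam assms(8) norm ballr[OF that]])
    have p_real: "P (cvec \<theta>) (cvec \<mu>) \<in> range cvec" if "max_norm (\<mu> - \<omega>) < h" for \<mu> \<theta>
      by (rule perturbation_real[OF s ball fam assms(8) norm ballr[OF that]])
    interpret kam_setup \<omega> s h \<epsilon> \<alpha> \<tau> r \<Delta> p T
    proof
      show "\<alpha> / \<Delta> (sum_norm k) \<le> \<bar>pairing k \<omega>\<bar>" if "k \<noteq> 0" for k
        using assms(4)[OF \<omega> that] .
      show "wbd s (p \<mu>) \<epsilon>" if "max_norm (\<mu> - \<omega>) < h" for \<mu>
        unfolding p_def by (rule perturbation_wbd[OF s ball fam assms(8) norm ballr[OF that]])
      show "wser (p \<mu>) (cvec \<theta>) \<in> range cvec" if "max_norm (\<mu> - \<omega>) < h" for \<mu> \<theta>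
        using p_real[OF that, of \<theta>] by (simp add: p_series[OF that])
      show "wbd s (\<lambda>k. p \<nu> k - p \<mu> k) (max_norm (\<nu> - \<mu>) / 12)"
        if "max_norm (\<mu> - \<omega>) \<le> h / 8" "max_norm (\<nu> - \<omega>) \<le> h / 8" for \<mu> \<nu>
        unfolding p_def
        by (rule perturbation_lipschitz[OF s ball fam assms(8) norm that _ h]) (use assms(10) in simp_all)
    qed (use assms T r0 in auto)
    obtain v lam where v: "csym v" "v 0 = 0" "wbd (s - r) v r"
        "wbd (s - r) (\<lambda>k. sum_norm k *\<^sub>R v k) (1 / 15)"
      and lam8: "max_norm (lam - \<omega>) \<le> h / 8" and zero: "\<And>\<theta>. defect v lam \<theta> = 0"
      using kam_limit_normalised by blast
    have lamh: "max_norm (lam - \<omega>) < h" using lam8 h by linarith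
    note est = kam_estimates[OF v(2,3,4) lamh zero \<Delta>_exp]
    have "cvec \<omega> + dser v (cvec \<theta>) (cvec \<omega>) =
        cvec (lam + Re_vec (P (cvec (\<theta> + Re_vec (wser v (cvec \<theta>)))) (cvec lam)))" for \<theta>
    proof -
      have sr: "0 < s - r" using assms(14) r0 by linarith
      have "cvec lam + wser (p lam) (cvec (\<theta> + Re_vec (wser v (cvec \<theta>)))) - cvec \<omega>
          - dser v (cvec \<theta>) (cvec \<omega>) = 0"
        using zero[of \<theta>] unfolding defect_def cvec_psi[OF sr v(1,3,4) less15] .
      then have "cvec \<omega> + dser v (cvec \<theta>) (cvec \<omega>) =
          cvec lam + wser (p lam) (cvec (\<theta> + Re_vec (wser v (cvec \<theta>))))"
        by (simp add: algebra_simps)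
      then show ?thesis
        unfolding cvec_add[of lam] cvec_Re_vec[OF p_real[OF lamh]] p_series[OF lamh] .
    qed
    then have "Q \<omega> lam v" unfolding Q_def by (intro conjI allI v est ballr lamh)
    then show ?thesis by blast
  qed
  \<comment> \<open>Parameter and coefficients are chosen for each frequency separately; the bounds
    are the same for all frequencies and therefore pass to the suprema.\<close>
  then have "\<exists>\<phi> v. \<forall>\<omega>\<in>\<Omega>. Q \<omega> (\<phi> \<omega>) (v \<omega>)" by metis
  then obtain \<phi> v where Q: "\<And>\<omega>. \<omega> \<in> \<Omega> \<Longrightarrow> Q \<omega> (\<phi> \<omega>) (v \<omega>)" by blast
  note pv = Q[unfolded Q_def]
  define \<Phi> where "\<Phi> \<omega> \<theta> = \<theta> + Re_vec (wser (v \<omega>) (cvec \<theta>))" for \<omega> \<theta>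
  have sr: "0 < s - r" "0 < s - 2 * r" using assms(14) r0 by linarith+
  show ?thesis
  proof (intro exI conjI ballI)
    fix \<omega> assume \<omega>: "\<omega> \<in> \<Omega>"
    have v: "csym (v \<omega>)" "wbd (s - r) (v \<omega>) r" "wbd (s - r) (\<lambda>k. sum_norm k *\<^sub>R v \<omega> k) (1 / 15)"
      using pv[OF \<omega>] by blast+
    show "cvec (\<phi> \<omega>) \<in> ?W" using pv[OF \<omega>] by blast
    show "real_analytic_torus_diffeo (\<Phi> \<omega>)"
      unfolding \<Phi>_def[abs_def] by (rule psi_diffeo[OF sr(1) v less15])
    show "pull_back (\<Phi> \<omega>) (\<lambda>\<theta>. \<phi> \<omega> + Re_vec (P (cvec \<theta>) (cvec (\<phi> \<omega>)))) = (\<lambda>\<theta>. \<omega>)"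
      unfolding \<Phi>_def[abs_def]
      by (rule psi_pull_back[OF sr(1) v less15]) (use pv[OF \<omega>] in auto)
  next
    show "sup_norm \<Omega> (\<lambda>\<omega>. \<phi> \<omega> - \<omega>) \<le> ennreal \<epsilon>"
      unfolding sup_norm_def using pv by (intro SUP_least ennreal_leI) blast
    show "weighted_norm (s - 2 * r) \<Omega> (\<lambda>\<theta> \<omega>. cvec (\<Phi> \<omega> \<theta> - \<theta>)) \<le> ennreal (Lam \<Delta> \<tau> / \<alpha> * \<epsilon>)"
    proof (rule weighted_norm_leI)
      show "wbd (s - 2 * r) (fourier_coeff (\<lambda>\<theta>. cvec (\<Phi> \<omega> \<theta> - \<theta>))) (Lam \<Delta> \<tau> / \<alpha> * \<epsilon>)"
        if \<omega>: "\<omega> \<in> \<Omega>" for \<omega>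
      proof -
        have v: "csym (v \<omega>)" "wbd (s - r) (v \<omega>) r" "wbd (s - r) (\<lambda>k. sum_norm k *\<^sub>R v \<omega> k) (1 / 15)"
          using pv[OF \<omega>] by blast+
        have "(\<lambda>\<theta>. cvec (\<Phi> \<omega> \<theta> - \<theta>)) = (\<lambda>\<theta>. wser (v \<omega>) (cvec \<theta>))"
          by (simp add: \<Phi>_def wser_v_real[OF sr(1) v less15])
        then have "fourier_coeff (\<lambda>\<theta>. cvec (\<Phi> \<omega> \<theta> - \<theta>)) = v \<omega>"
          using fourier_coeff_wser[OF v(2)] sr(1) by (simp add: fun_eq_iff)
        then show ?thesis using pv[OF \<omega>] by simp
      qed
    qed
  qed
qed

end
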